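(* Let $\gamma=q-q^{-1}$. Let $O_1,O_2$ and $O_{ij}$ (for $0\le i,j\le n-1$, $(i,j)\neq(0,0)$) be the linear maps $\mathcal A_q^-\to\mathcal A_q^-$ determined by requiring, for all $g\in\mathcal A_q^-$ and all $\psi\in\mathcal A_q^+$, $$(O_1(g),\psi)_J=-(g,\,Z_{11}\,\mathrm{Ad}(K_\beta^{-1})(\psi))_J,\qquad (O_2(g),\psi)_J=(g,\psi Z_{11})_J,\qquad (O_{ij}(g),\psi)_J=(g,\psi Z_{i+1,j+1})_J .$$ Then for every $g\in\mathcal A_q^-$ the following identity holds in $\mathcal U_q$: $$E_\beta g-gE_\beta=O_1(g)K_\beta+O_2(g)K_\beta^{-1}+\sum_{i=1}^{n-1}O_{i0}(g)\frac{X_i}{(X_i,\check X_i)_J}K_\beta^{-1}+\sum_{j=1}^{n-1}O_{0j}(g)\frac{Y_j}{(Y_j,\check Y_j)_J}K_\beta^{-1}+\sum_{i,j=1}^{n-1}O_{ij}(g)\frac{X_iY_j}{(X_i,\check X_i)_J(Y_j,\check Y_j)_J}K_\beta^{-1}.$$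
   Context: Let $n\ge1$ and let $q\in\mathbb C\setminus\{0\}$ not be a root of unity. $\mathcal U_q=\mathcal U_q(su(n,n)^{\mathbb C})$ is the quantized enveloping algebra of type $A_{2n-1}$ over $\mathbb C$ with generators $E_\alpha,F_\alpha,K_\alpha^{\pm1}$, $\alpha\in\Pi=\{\mu_1,\dots,\mu_{n-1},\beta,\nu_1,\dots,\nu_{n-1}\}$; the Dynkin diagram is the chain $\mu_{n-1}-\cdots-\mu_1-\beta-\nu_1-\cdots-\nu_{n-1}$, with $(\alpha,\alpha)=2$, $(\alpha,\alpha')=-1$ for neighbours and $0$ otherwise. Relations: $K_\alpha E_{\alpha'}K_\alpha^{-1}=q^{(\alpha,\alpha')}E_{\alpha'}$, $K_\alpha F_{\alpha'}K_\alpha^{-1}=q^{-(\alpha,\alpha')}F_{\alpha'}$, $[E_\alpha,F_{\alpha'}]=\delta_{\alpha\alpha'}(K_\alpha-K_\alpha^{-1})/(q-q^{-1})$, and the quantum Serre relations. Coproduct: $\Delta(E_\alpha)=E_\alpha\otimes1+K_\alpha\otimes E_\alpha$, $\Delta(F_\alpha)=F_\alpha\otimes K_\alpha^{-1}+1\otimes F_\alpha$, $\Delta(K_\alpha)=K_\alpha\otimes K_\alpha$. $K_\xi$ for $\xi$ in the root lattice is defined multiplicatively, and $\mathrm{Ad}(K_\xi)(x)=K_\xi xK_\xi^{-1}$. Lusztig automorphisms (Jantzen's conventions): $T_\alpha(E_\alpha)=-F_\alpha K_\alpha$, $T_\alpha(F_\alpha)=-K_\alpha^{-1}E_\alpha$,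 $T_\alpha(K_\gamma)=K_\gamma K_\alpha^{-(\alpha,\gamma)}$; for neighbours $T_\alpha(E_\gamma)=E_\alpha E_\gamma-q^{-1}E_\gamma E_\alpha$, $T_\alpha(F_\gamma)=F_\gamma F_\alpha-qF_\alpha F_\gamma$; for $\gamma\ne\alpha$ not a neighbour $T_\alpha$ fixes $E_\gamma,F_\gamma$. For $1\le i,j\le n$: $Z_{ij}=T_{\nu_{j-1}}\cdots T_{\nu_1}T_{\mu_{i-1}}\cdots T_{\mu_1}(E_\beta)$ and $W_{ij}=T_{\nu_{j-1}}\cdots T_{\nu_1}T_{\mu_{i-1}}\cdots T_{\mu_1}(F_\beta)$ (empty products are the identity). In particular $Z_{11}=E_\beta$. $\mathcal A_q^+$ and $\mathcal A_q^-$ are the subalgebras generated by all $Z_{ij}$ and all $W_{ij}$, respectively. Root vectors: for $1\le i\le n-1$, $\check X_i=T_{\mu_i}T_{\mu_{i-1}}\cdots T_{\mu_2}(E_{\mu_1})$ (so $\check X_1=E_{\mu_1}$), $X_i=T_{\mu_i}\cdots T_{\mu_2}(F_{\mu_1})$, and $\check Y_j=T_{\nu_j}\cdots T_{\nu_2}(E_{\nu_1})$, $Y_j=T_{\nu_j}\cdots T_{\nu_2}(F_{\nu_1})$. $(\cdot,\cdot)_J$ is the unique bilinear pairing (the $q$-Killing form) between $\mathcal U_q^{\le0}$ (generated by the $F_\alpha,K_\alpha^{\pm1}$) and $\mathcal U_q^{\ge0}$ (generated by the $E_\alpha,K_\alpha^{\pm1}$) with $(y,xx')_J=(\Delta(y),x'\otimes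 x)_J$, $(yy',x)_J=(y\otimes y',\Delta(x))_J$, $(K_\mu,K_\nu)_J=q^{-(\mu,\nu)}$, $(F_\alpha,E_{\alpha'})_J=-\delta_{\alpha\alpha'}(q-q^{-1})^{-1}$, $(K_\mu,E_\alpha)_J=0=(F_\alpha,K_\mu)_J$. Its restriction to $\mathcal A_q^-\times\mathcal A_q^+$ is non-degenerate (in each weight), so the maps in the claim are well defined. One has $(X_i,\check X_i)_J=(Y_j,\check Y_j)_J=-1/\gamma$. *)

theory Defs
  imports
    Complex_Main
    "HOL-Library.Poly_Mapping"
    "HOL-Library.Product_Plus"
    "HOL-Algebra.QuotRing"
    "HOL-Algebra.Generated_Rings"
begin

section \<open>Simple roots\<close>

text \<open>
  The simple root at position \<open>a\<close> of the chain
  \<open>\<mu>(n-1) - ... - \<mu>(1) - \<beta> - \<nu>(1) - ... - \<nu>(n-1)\<close> is represented by the integer \<open>a\<close>,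
  where \<open>\<beta>\<close> sits at position \<open>0\<close>.
\<close>

definition mu :: "nat \<Rightarrow> int" where "mu i = - int i"
definition beta :: int where "beta = 0"
definition nu :: "nat \<Rightarrow> int" where "nu j = int j"

definition simple_roots :: "nat \<Rightarrow> int set" where
  "simple_roots n = {beta} \<union> mu ` {1..n-1} \<union> nu ` {1..n-1}"

definition neighbours :: "int \<Rightarrow> int \<Rightarrow> bool" where
  "neighbours \<alpha> \<gamma> \<longleftrightarrow> \<bar>\<alpha> - \<gamma>\<bar> = 1"

definition root_form :: "int \<Rightarrow> int \<Rightarrow> int" where
  "root_form \<alpha> \<gamma> = (if \<alpha> = \<gamma> then 2 else if neighbours \<alpha> \<gamma> then -1 else 0)"

text \<open>Elements of the root lattice are given by their coefficients on the simple roots.\<close>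

definition lattice_form :: "nat \<Rightarrow> (int \<Rightarrow> int) \<Rightarrow> (int \<Rightarrow> int) \<Rightarrow> int" where
  "lattice_form n \<xi> \<eta> =
     (\<Sum>\<alpha>\<in>simple_roots n. \<Sum>\<gamma>\<in>simple_roots n. \<xi> \<alpha> * \<eta> \<gamma> * root_form \<alpha> \<gamma>)"

section \<open>Free algebras\<close>

text \<open>
  The free algebra is the monoid algebra of the free monoid of words.  Likewise the monoid algebra
  of pairs of words is the tensor product of the free algebra with itself, the basis element
  \<open>(u, v)\<close> being \<open>u \<otimes> v\<close>.
\<close>

datatype gen = GE int | GF int | GK int | GKinv int

datatype uword = Word (letters: "gen list")

instantiation uword :: monoid_add
begin

definition zero_uword :: uword where "0 = Word []"
definition plus_uword :: "uword \<Rightarrow> uword \<Rightarrow> uword" where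
  "u + v = Word (letters u @ letters v)"

instance
  by standard (auto simp: zero_uword_def plus_uword_def)

end

type_synonym falg = "uword \<Rightarrow>\<^sub>0 complex"
type_synonym falg2 = "(uword \<times> uword) \<Rightarrow>\<^sub>0 complex"

definition const :: "complex \<Rightarrow> ('m::monoid_add \<Rightarrow>\<^sub>0 complex)" where
  "const c = Poly_Mapping.single 0 c"

definition var :: "gen \<Rightarrow> falg" where
  "var g = Poly_Mapping.single (Word [g]) 1"

abbreviation fE :: "int \<Rightarrow> falg" where "fE \<alpha> \<equiv> var (GE \<alpha>)"
abbreviation fF :: "int \<Rightarrow> falg" where "fF \<alpha> \<equiv> var (GF \<alpha>)"
abbreviation fK :: "int \<Rightarrow> falg" where "fK \<alpha> \<equiv> var (GK \<alpha>)"
abbreviation fKinv :: "int \<Rightarrow> falg" where "fKinv \<alpha> \<equiv> var (GKinv \<alpha>)"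

definition tens :: "gen list \<Rightarrow> gen list \<Rightarrow> falg2" where
  "tens u v = Poly_Mapping.single (Word u, Word v) 1"

text \<open>The unital algebra homomorphism from the free algebra that maps each generator \<open>g\<close> to \<open>\<phi> g\<close>.\<close>

definition free_ext :: "(gen \<Rightarrow> ('m::monoid_add \<Rightarrow>\<^sub>0 complex)) \<Rightarrow> falg \<Rightarrow> ('m \<Rightarrow>\<^sub>0 complex)" where
  "free_ext \<phi> x =
     (\<Sum>w\<in>Poly_Mapping.keys x. const (Poly_Mapping.lookup x w) * prod_list (map \<phi> (letters w)))"

definition free_on :: "gen set \<Rightarrow> falg set" where
  "free_on G = {x. \<forall>w\<in>Poly_Mapping.keys x. set (letters w) \<subseteq> G}"

definition gens_le :: "nat \<Rightarrow> gen set" where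
  "gens_le n = GF ` simple_roots n \<union> GK ` simple_roots n \<union> GKinv ` simple_roots n"

definition gens_ge :: "nat \<Rightarrow> gen set" where
  "gens_ge n = GE ` simple_roots n \<union> GK ` simple_roots n \<union> GKinv ` simple_roots n"

definition free_alg :: "nat \<Rightarrow> falg ring" where
  "free_alg n = \<lparr>carrier = free_on (gens_le n \<union> gens_ge n), mult = (*), one = 1, zero = 0, add = (+)\<rparr>"

section \<open>The quantized enveloping algebra\<close>

text \<open>Each relation \<open>l = r\<close> is listed as the element \<open>l - r\<close> of the free algebra.\<close>

definition torus_rels :: "nat \<Rightarrow> falg set" where
  "torus_rels n =
     (\<Union>\<alpha>\<in>simple_roots n. {fK \<alpha> * fKinv \<alpha> - 1, fKinv \<alpha> * fK \<alpha> - 1}) \<union>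
     (\<Union>\<alpha>\<in>simple_roots n. \<Union>\<gamma>\<in>simple_roots n. {fK \<alpha> * fK \<gamma> - fK \<gamma> * fK \<alpha>})"

definition weight_rels :: "nat \<Rightarrow> complex \<Rightarrow> falg set" where
  "weight_rels n q =
     (\<Union>\<alpha>\<in>simple_roots n. \<Union>\<gamma>\<in>simple_roots n.
        {fK \<alpha> * fE \<gamma> * fKinv \<alpha> - const (q powi (root_form \<alpha> \<gamma>)) * fE \<gamma>,
         fK \<alpha> * fF \<gamma> * fKinv \<alpha> - const (q powi (- root_form \<alpha> \<gamma>)) * fF \<gamma>})"

definition EF_rels :: "nat \<Rightarrow> complex \<Rightarrow> falg set" where
  "EF_rels n q =
     (\<Union>\<alpha>\<in>simple_roots n. \<Union>\<gamma>\<in>simple_roots n.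
        {fE \<alpha> * fF \<gamma> - fF \<gamma> * fE \<alpha> -
           (if \<alpha> = \<gamma> then const (1 / (q - inverse q)) * (fK \<alpha> - fKinv \<alpha>) else 0)})"

definition serre :: "complex \<Rightarrow> falg \<Rightarrow> falg \<Rightarrow> falg" where
  "serre q x y = x * x * y - const (q + inverse q) * (x * y * x) + y * x * x"

definition serre_rels :: "nat \<Rightarrow> complex \<Rightarrow> falg set" where
  "serre_rels n q =
     (\<Union>\<alpha>\<in>simple_roots n. \<Union>\<gamma>\<in>{\<gamma>\<in>simple_roots n. neighbours \<alpha> \<gamma>}.
        {serre q (fE \<alpha>) (fE \<gamma>), serre q (fF \<alpha>) (fF \<gamma>)}) \<union>
     (\<Union>\<alpha>\<in>simple_roots n. \<Union>\<gamma>\<in>{\<gamma>\<in>simple_roots n. \<gamma> \<noteq> \<alpha> \<and> \<not> neighbours \<alpha> \<gamma>}.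
        {fE \<alpha> * fE \<gamma> - fE \<gamma> * fE \<alpha>, fF \<alpha> * fF \<gamma> - fF \<gamma> * fF \<alpha>})"

definition rel_ideal :: "nat \<Rightarrow> complex \<Rightarrow> falg set" where
  "rel_ideal n q =
     Idl\<^bsub>free_alg n\<^esub> (torus_rels n \<union> weight_rels n q \<union> EF_rels n q \<union> serre_rels n q)"

text \<open>Elements of the quantized enveloping algebra are cosets of the two-sided ideal of relations.\<close>

type_synonym uq_elem = "falg set"

definition Uq :: "nat \<Rightarrow> complex \<Rightarrow> uq_elem ring" where
  "Uq n q = free_alg n Quot rel_ideal n q"

definition cls :: "nat \<Rightarrow> complex \<Rightarrow> falg \<Rightarrow> uq_elem" where
  "cls n q x = rel_ideal n q +>\<^bsub>free_alg n\<^esub> x"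

definition scal :: "nat \<Rightarrow> complex \<Rightarrow> complex \<Rightarrow> uq_elem \<Rightarrow> uq_elem" where
  "scal n q c u = cls n q (const c) \<otimes>\<^bsub>Uq n q\<^esub> u"

definition E :: "nat \<Rightarrow> complex \<Rightarrow> int \<Rightarrow> uq_elem" where "E n q \<alpha> = cls n q (fE \<alpha>)"
definition F :: "nat \<Rightarrow> complex \<Rightarrow> int \<Rightarrow> uq_elem" where "F n q \<alpha> = cls n q (fF \<alpha>)"
definition K :: "nat \<Rightarrow> complex \<Rightarrow> int \<Rightarrow> uq_elem" where "K n q \<alpha> = cls n q (fK \<alpha>)"
definition Kinv :: "nat \<Rightarrow> complex \<Rightarrow> int \<Rightarrow> uq_elem" where "Kinv n q \<alpha> = cls n q (fKinv \<alpha>)"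

definition fK_pow :: "int \<Rightarrow> int \<Rightarrow> falg" where
  "fK_pow \<alpha> m = (if m \<ge> 0 then fK \<alpha> ^ nat m else fKinv \<alpha> ^ nat (- m))"

definition K_lat :: "nat \<Rightarrow> complex \<Rightarrow> (int \<Rightarrow> int) \<Rightarrow> uq_elem" where
  "K_lat n q \<xi> =
     cls n q (prod_list (map (\<lambda>\<alpha>. fK_pow \<alpha> (\<xi> \<alpha>)) (sorted_list_of_set (simple_roots n))))"

definition subalg :: "nat \<Rightarrow> complex \<Rightarrow> uq_elem set \<Rightarrow> uq_elem set" where
  "subalg n q S = generate_ring (Uq n q) (range (\<lambda>c. cls n q (const c)) \<union> S)"

definition U_le :: "nat \<Rightarrow> complex \<Rightarrow> uq_elem set" where
  "U_le n q =
     subalg n q (F n q ` simple_roots n \<union> K n q ` simple_roots n \<union> Kinv n q ` simple_roots n)"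

definition U_ge :: "nat \<Rightarrow> complex \<Rightarrow> uq_elem set" where
  "U_ge n q =
     subalg n q (E n q ` simple_roots n \<union> K n q ` simple_roots n \<union> Kinv n q ` simple_roots n)"

section \<open>Lusztig's automorphisms and the root vectors\<close>

text \<open>
  \<open>T q \<alpha>\<close> is the endomorphism of the free algebra with the prescribed values on generators.  It maps
  the ideal of relations into itself and induces Lusztig's automorphism of \<open>Uq n q\<close>, so that the
  class of an iterated image under \<open>T q \<alpha>\<close> is the iterated image of the class under Lusztig's
  automorphisms.
\<close>

fun T_gen :: "complex \<Rightarrow> int \<Rightarrow> gen \<Rightarrow> falg" where
  "T_gen q \<alpha> (GE \<gamma>) =
     (if \<gamma> = \<alpha> then - (fF \<alpha> * fK \<alpha>)
      else if neighbours \<alpha> \<gamma> then fE \<alpha> * fE \<gamma> - const (inverse q) * (fE \<gamma> * fE \<alpha>)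
      else fE \<gamma>)"
| "T_gen q \<alpha> (GF \<gamma>) =
     (if \<gamma> = \<alpha> then - (fKinv \<alpha> * fE \<alpha>)
      else if neighbours \<alpha> \<gamma> then fF \<gamma> * fF \<alpha> - const q * (fF \<alpha> * fF \<gamma>)
      else fF \<gamma>)"
| "T_gen q \<alpha> (GK \<gamma>) = fK \<gamma> * fK_pow \<alpha> (- root_form \<alpha> \<gamma>)"
| "T_gen q \<alpha> (GKinv \<gamma>) = fKinv \<gamma> * fK_pow \<alpha> (root_form \<alpha> \<gamma>)"

definition T :: "complex \<Rightarrow> int \<Rightarrow> falg \<Rightarrow> falg" where
  "T q \<alpha> = free_ext (T_gen q \<alpha>)"

text \<open>
  \<open>T_comp q [\<alpha>1, ..., \<alpha>k]\<close> is \<open>T q \<alpha>1 \<circ> ... \<circ> T q \<alpha>k\<close>.  Note that \<open>rev [a..<b]\<close> is \<open>[b - 1, ..., a]\<close>.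
\<close>

definition T_comp :: "complex \<Rightarrow> int list \<Rightarrow> falg \<Rightarrow> falg" where
  "T_comp q \<alpha>s = foldr (T q) \<alpha>s"

definition Z :: "nat \<Rightarrow> complex \<Rightarrow> nat \<Rightarrow> nat \<Rightarrow> uq_elem" where
  "Z n q i j = cls n q (T_comp q (map nu (rev [1..<j]) @ map mu (rev [1..<i])) (fE beta))"

definition W :: "nat \<Rightarrow> complex \<Rightarrow> nat \<Rightarrow> nat \<Rightarrow> uq_elem" where
  "W n q i j = cls n q (T_comp q (map nu (rev [1..<j]) @ map mu (rev [1..<i])) (fF beta))"

definition X_check :: "nat \<Rightarrow> complex \<Rightarrow> nat \<Rightarrow> uq_elem" where
  "X_check n q i = cls n q (T_comp q (map mu (rev [2..<Suc i])) (fE (mu 1)))"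

definition X :: "nat \<Rightarrow> complex \<Rightarrow> nat \<Rightarrow> uq_elem" where
  "X n q i = cls n q (T_comp q (map mu (rev [2..<Suc i])) (fF (mu 1)))"

definition Y_check :: "nat \<Rightarrow> complex \<Rightarrow> nat \<Rightarrow> uq_elem" where
  "Y_check n q j = cls n q (T_comp q (map nu (rev [2..<Suc j])) (fE (nu 1)))"

definition Y :: "nat \<Rightarrow> complex \<Rightarrow> nat \<Rightarrow> uq_elem" where
  "Y n q j = cls n q (T_comp q (map nu (rev [2..<Suc j])) (fF (nu 1)))"

definition A_plus :: "nat \<Rightarrow> complex \<Rightarrow> uq_elem set" where
  "A_plus n q = subalg n q {Z n q i j | i j. i \<in> {1..n} \<and> j \<in> {1..n}}"

definition A_minus :: "nat \<Rightarrow> complex \<Rightarrow> uq_elem set" where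
  "A_minus n q = subalg n q {W n q i j | i j. i \<in> {1..n} \<and> j \<in> {1..n}}"

section \<open>The q-Killing form\<close>

text \<open>The coproduct, as an algebra homomorphism from the free algebra to its tensor square.\<close>

fun coprod_gen :: "gen \<Rightarrow> falg2" where
  "coprod_gen (GE \<alpha>) = tens [GE \<alpha>] [] + tens [GK \<alpha>] [GE \<alpha>]"
| "coprod_gen (GF \<alpha>) = tens [GF \<alpha>] [GKinv \<alpha>] + tens [] [GF \<alpha>]"
| "coprod_gen (GK \<alpha>) = tens [GK \<alpha>] [GK \<alpha>]"
| "coprod_gen (GKinv \<alpha>) = tens [GKinv \<alpha>] [GKinv \<alpha>]"

definition coprod :: "falg \<Rightarrow> falg2" where
  "coprod = free_ext coprod_gen"

text \<open>\<open>tens_apply n q b t\<close> applies the bilinear map \<open>b\<close> to the two tensor factors of \<open>t\<close>.\<close>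

definition tens_apply :: "nat \<Rightarrow> complex \<Rightarrow> (uq_elem \<Rightarrow> uq_elem \<Rightarrow> complex) \<Rightarrow> falg2 \<Rightarrow> complex" where
  "tens_apply n q b t =
     (\<Sum>(u, v)\<in>Poly_Mapping.keys t. Poly_Mapping.lookup t (u, v) *
        b (cls n q (Poly_Mapping.single u 1)) (cls n q (Poly_Mapping.single v 1)))"

definition bilinear_pairing ::
  "nat \<Rightarrow> complex \<Rightarrow> uq_elem set \<Rightarrow> uq_elem set \<Rightarrow> (uq_elem \<Rightarrow> uq_elem \<Rightarrow> complex) \<Rightarrow> bool" where
  "bilinear_pairing n q A B J \<longleftrightarrow>
     (\<forall>y\<in>A. \<forall>y'\<in>A. \<forall>x\<in>B. J (y \<oplus>\<^bsub>Uq n q\<^esub> y') x = J y x + J y' x) \<and>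
     (\<forall>y\<in>A. \<forall>x\<in>B. \<forall>x'\<in>B. J y (x \<oplus>\<^bsub>Uq n q\<^esub> x') = J y x + J y x') \<and>
     (\<forall>c. \<forall>y\<in>A. \<forall>x\<in>B. J (scal n q c y) x = c * J y x \<and> J y (scal n q c x) = c * J y x)"

text \<open>
  Each \<open>y\<close> in \<open>U_le n q\<close> is the class of some \<open>f\<close> in \<open>free_on (gens_le n)\<close>, and its coproduct is
  represented by \<open>coprod f\<close>; similarly for \<open>U_ge n q\<close>.
\<close>

definition q_Killing_form :: "nat \<Rightarrow> complex \<Rightarrow> (uq_elem \<Rightarrow> uq_elem \<Rightarrow> complex) \<Rightarrow> bool" where
  "q_Killing_form n q J \<longleftrightarrow>
     bilinear_pairing n q (U_le n q) (U_ge n q) J \<and>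
     (\<forall>f\<in>free_on (gens_le n). \<forall>x\<in>U_ge n q. \<forall>x'\<in>U_ge n q.
        J (cls n q f) (x \<otimes>\<^bsub>Uq n q\<^esub> x') = tens_apply n q (\<lambda>u v. J u x' * J v x) (coprod f)) \<and>
     (\<forall>y\<in>U_le n q. \<forall>y'\<in>U_le n q. \<forall>f\<in>free_on (gens_ge n).
        J (y \<otimes>\<^bsub>Uq n q\<^esub> y') (cls n q f) = tens_apply n q (\<lambda>u v. J y u * J y' v) (coprod f)) \<and>
     (\<forall>\<xi> \<eta>. J (K_lat n q \<xi>) (K_lat n q \<eta>) = q powi (- lattice_form n \<xi> \<eta>)) \<and>
     (\<forall>\<alpha>\<in>simple_roots n. \<forall>\<gamma>\<in>simple_roots n.
        J (F n q \<alpha>) (E n q \<gamma>) = (if \<alpha> = \<gamma> then - inverse (q - inverse q) else 0)) \<and>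
     (\<forall>\<xi>. \<forall>\<alpha>\<in>simple_roots n. J (K_lat n q \<xi>) (E n q \<alpha>) = 0 \<and> J (F n q \<alpha>) (K_lat n q \<xi>) = 0)"

definition linear_endo ::
  "nat \<Rightarrow> complex \<Rightarrow> uq_elem set \<Rightarrow> (uq_elem \<Rightarrow> uq_elem) \<Rightarrow> bool" where
  "linear_endo n q A L \<longleftrightarrow>
     (\<forall>g\<in>A. L g \<in> A) \<and>
     (\<forall>g\<in>A. \<forall>h\<in>A. L (g \<oplus>\<^bsub>Uq n q\<^esub> h) = L g \<oplus>\<^bsub>Uq n q\<^esub> L h) \<and>
     (\<forall>c. \<forall>g\<in>A. L (scal n q c g) = scal n q c (L g))"

text \<open>\<open>L\<close> is the linear endomorphism of \<open>A_minus n q\<close> determined by \<open>(L g, \<psi>) = R g \<psi>\<close>.\<close>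

definition determined_by ::
  "nat \<Rightarrow> complex \<Rightarrow> (uq_elem \<Rightarrow> uq_elem \<Rightarrow> complex) \<Rightarrow> (uq_elem \<Rightarrow> uq_elem \<Rightarrow> complex) \<Rightarrow>
   (uq_elem \<Rightarrow> uq_elem) \<Rightarrow> bool" where
  "determined_by n q J R L \<longleftrightarrow>
     (let sol = (\<lambda>M. linear_endo n q (A_minus n q) M \<and>
                     (\<forall>g\<in>A_minus n q. \<forall>\<psi>\<in>A_plus n q. J (M g) \<psi> = R g \<psi>))
      in sol L \<and> (\<forall>M. sol M \<longrightarrow> (\<forall>g\<in>A_minus n q. M g = L g)))"

end

theory Submission
  imports Defs
begin

text \<open>
  By induction on \<open>g\<close> in \<open>A\<^sup>-\<close> there are \<open>a\<close> in \<open>A\<^sup>-\<close> and \<open>x\<close> with \<open>[E\<^sub>\<beta>, g] = a K\<^sub>\<beta> + x K\<^sub>\<beta>\<inverse>\<close>,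
  \<open>(g, E\<^sub>\<beta> Ad(K\<^sub>\<beta>\<inverse>) \<psi>) = - (a, \<psi>)\<close> and \<open>(g, \<psi> E\<^sub>\<beta>) = (x K\<^sub>\<beta>\<inverse>, \<psi>)\<close>: all three properties are stable under
  products, and for \<open>g = W\<^sub>i\<^sub>j\<close> the element \<open>x\<close> is a multiple of \<open>X\<^sub>i\<^sub>-\<^sub>1 Y\<^sub>j\<^sub>-\<^sub>1\<close>, with \<open>X\<^sub>0 = Y\<^sub>0 = 1\<close>.
  The commutation relations between the root vectors and the \<open>W\<^sub>k\<^sub>l\<close> show that always
  \<open>x = \<Sum> b\<^sub>i\<^sub>j X\<^sub>i Y\<^sub>j\<close> with \<open>b\<^sub>i\<^sub>j\<close> in \<open>A\<^sup>-\<close>.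

  The coproduct turns multiplication by \<open>E\<^sub>c\<close> on one side of the pairing into a skew derivation on the
  other side.  For \<open>c \<noteq> \<beta>\<close> this derivation kills \<open>A\<^sup>-\<close>, and its counterpart for \<open>F\<^sub>c\<close> kills \<open>A\<^sup>+\<close>.
  Since \<open>Z\<^sub>i\<^sub>+\<^sub>1\<^sub>,\<^sub>j\<^sub>+\<^sub>1\<close> is the product of the root vectors dual to \<open>X\<^sub>i\<close>, \<open>Y\<^sub>j\<close> and of \<open>E\<^sub>\<beta>\<close>, up to terms ending
  in some \<open>E\<^sub>c\<close>, it follows that \<open>(g, \<psi> Z\<^sub>i\<^sub>+\<^sub>1\<^sub>,\<^sub>j\<^sub>+\<^sub>1)\<close> is \<open>(b\<^sub>i\<^sub>j, \<psi>)\<close> times the norms of the root vectors.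
\<close>

section \<open>q-commutators in complex algebras\<close>

text \<open>Behind the two summands lies a general fact: the commutator of E_beta with an element of
  the negative part consists of two skew derivations, dual under the form to left and to right
  multiplication by E_beta. The first preserves A^-. The second does not, and the products X_i Y_j
  measure how far it leaves A^-; the coefficients b_ij are pinned down by the pairing rather than by
  linear independence of these products. The form is specified through coproducts of words, and
  uniqueness of elements with given pairings is at hand only inside A^-; skew derivations are
  therefore relations between elements, not functions. Root vectors are treated as nested
  q-commutators along segments of the diagram. Lusztig's automorphisms enter only when these are
  matched with Z, W, X and Y, which produces powers of -1/q that later cancel against powers of -q
  in the pairings.\<close>

lemma one_plus_inverse_square:
  fixes q :: complex
  assumes "q \<noteq> 0" "q\<^sup>2 \<noteq> -1"
  shows "1 + 1 / q * (1 / q) \<noteq> 0"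
proof
  assume "1 + 1 / q * (1 / q) = 0"
  moreover have "(1 + 1 / q * (1 / q)) * (q * q) = q * q + 1"
    using assms(1) by (simp add: distrib_right)
  ultimately have "q * q + 1 = 0" by (metis mult_zero_left)
  then show False using assms(2) by (simp add: power2_eq_square add_eq_0_iff2)
qed

text \<open>The simp rules collect all scalars in front of a monomial, so identities between
  q-commutators reduce to \<open>calg_simps\<close> once the words are in a common order.\<close>

class calg = ring + monoid_mult +
  fixes sc :: "complex \<Rightarrow> 'a \<Rightarrow> 'a" (infixr "*c" 75)
  assumes sc_add: "c *c (x + y) = c *c x + c *c y"
    and add_sc: "(c + d) *c x = c *c x + d *c x"
    and sc_sc [simp]: "c *c d *c x = (c * d) *c x"
    and one_sc [simp]: "1 *c x = x"
    and sc_mult [simp]: "(c *c x) * y = c *c (x * y)"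
    and mult_sc [simp]: "x * (c *c y) = c *c (x * y)"
begin

lemma zero_sc [simp]: "0 *c x = 0"
  using add_sc[of 0 0 x] by simp

lemma sc_zero [simp]: "c *c 0 = 0"
  using sc_add[of c 0 0] by simp

lemma sc_minus [simp]: "c *c (- x) = - (c *c x)"
  by (rule minus_unique[symmetric]) (simp add: sc_add[symmetric])

lemma minus_sc [simp]: "(- c) *c x = - (c *c x)"
  by (rule minus_unique[symmetric]) (simp add: add_sc[symmetric])

lemma sc_diff: "c *c (x - y) = c *c x - c *c y"
  using sc_add[of c x "- y"] by simp

lemma diff_sc: "(c - d) *c x = c *c x - d *c x"
  using add_sc[of c "- d" x] by simp

lemma sc_cancel:
  assumes "c *c x = c *c y" "c \<noteq> 0"
  shows "x = y"
proof -
  have "(1 / c) *c c *c x = (1 / c) *c c *c y" using assms(1) by metis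
  then show ?thesis using assms(2) by simp
qed

definition br :: "complex \<Rightarrow> 'a \<Rightarrow> 'a \<Rightarrow> 'a" where
  "br p x y = x * y - p *c (y * x)"

lemmas calg_simps = sc_add add_sc sc_diff diff_sc algebra_simps

text \<open>Both sides have the outer terms x y z and p^2 z y x; the mixed terms agree because x z y
  = z x y and y x z = y z x.\<close>

lemma br_assoc:
  assumes "x * z = z * x"
  shows "br p (br p x y) z = br p x (br p y z)"
proof -
  have "z * (x * y) = x * (z * y)" using assms by (metis mult.assoc)
  then show ?thesis using assms by (simp add: br_def calg_simps)
qed

lemma br_right_commute:
  assumes "y * z = z * y"
  shows "br p (br p x y) z = br p (br p x z) y"
proof -
  have "y * (z * x) = z * (y * x)" using assms by (metis mult.assoc)
  then show ?thesis using assms by (simp add: br_def calg_simps)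
qed

lemma commute_br:
  assumes "z * x = x * z" "z * y = y * z"
  shows "z * br p x y = br p x y * z"
proof -
  have "z * (x * y) = x * (y * z)" "z * (y * x) = y * (x * z)"
    using assms by (metis mult.assoc)+
  then show ?thesis by (simp add: br_def calg_simps)
qed

text \<open>The two bracketings of f give two linear relations between B f, f B and the commutator
  of the q-brackets [A, B] and [B, C]. Eliminating that commutator leaves (1 + q^-2) (B f - f B) =
  0.\<close>

lemma middle_commute:
  assumes AC: "A * C = C * A" and q: "q \<noteq> 0" "q\<^sup>2 \<noteq> -1"
    and BC: "B * br q B C = (1 / q) *c (br q B C * B)"
    and AB: "br q A B * B = (1 / q) *c (B * br q A B)"
  shows "B * br q A (br q B C) = br q A (br q B C) * B"
proof -
  define D where "D = br q B C"
  define G where "G = br q A B"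
  define f where "f = br q A D"
  have f2: "f = br q G C"
    unfolding f_def D_def G_def using br_assoc[OF AC] by simp
  have BD: "B * D = (1 / q) *c (D * B)" and GB: "G * B = (1 / q) *c (B * G)"
    using BC AB by (simp_all add: D_def G_def)
  have GB': "G * (B * x) = (1 / q) *c (B * (G * x))" for x
    using GB by (metis mult.assoc sc_mult)
  have BG: "B * G = q *c (G * B)" using GB q by simp
  have AB': "A * B = G + q *c (B * A)" by (simp add: G_def br_def)
  have BA: "B * A = (1 / q) *c (A * B) - (1 / q) *c G" using q by (simp add: AB' calg_simps)
  have BA': "B * (A * x) = (1 / q) *c (A * (B * x)) - (1 / q) *c (G * x)" for x
    using BA by (metis left_diff_distrib mult.assoc sc_mult)
  \<comment> \<open>Here f is read as \<open>br q G C\<close>.\<close>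
  have "G * D - D * G = (1 / q) *c (B * f) - q *c (f * B)"
  proof -
    have "D * G = B * (C * G) - q *c (C * (B * G))"
      by (simp add: D_def br_def calg_simps)
    also have "\<dots> = B * (C * G) - (q * q) *c (C * (G * B))"
      by (simp add: BG)
    finally have 1: "D * G = B * (C * G) - (q * q) *c (C * (G * B))" .
    have 2: "G * D = (1 / q) *c (B * (G * C)) - q *c (G * (C * B))"
      by (simp add: D_def br_def calg_simps GB')
    show ?thesis unfolding 1 2 using q
      by (simp add: f2 br_def calg_simps)
  qed
  \<comment> \<open>Here f is read as \<open>br q A D\<close>.\<close>
  moreover have "B * f - f * B
      = (1 / q * (1 / q) - 1) *c (f * B) - (1 / q) *c (G * D - D * G)"
  proof -
    have e1: "B * f = B * (A * D) - D * (B * A)"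
    proof -
      have "D * (B * A) = q *c (B * (D * A))" using BD q by (simp add: mult.assoc[symmetric])
      then show ?thesis using q by (simp add: f_def br_def calg_simps)
    qed
    have e2: "B * (A * D) = (1 / q * (1 / q)) *c (A * (D * B)) - (1 / q) *c (G * D)"
      by (simp add: BA' BD)
    have e3: "D * (B * A) = (1 / q) *c (D * (A * B)) - (1 / q) *c (D * G)"
      by (simp add: BA right_diff_distrib)
    have e4: "f * B = A * (D * B) - q *c (D * (A * B))"
      by (simp add: f_def br_def calg_simps)
    show ?thesis unfolding e1 e2 e3 using q by (simp add: e4 calg_simps)
  qed
  ultimately have *: "B * f - f * B
      = (1 / q * (1 / q) - 1) *c (f * B) - (1 / q) *c ((1 / q) *c (B * f) - q *c (f * B))"
    by simp
  have "(1 + 1 / q * (1 / q)) *c (B * f) = (1 + 1 / q * (1 / q)) *c (f * B)"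
    using * q by (simp add: calg_simps)
  moreover have "1 + 1 / q * (1 / q) \<noteq> 0" using q by (rule one_plus_inverse_square)
  ultimately show ?thesis
    unfolding f_def D_def by (rule sc_cancel)
qed

text \<open>\<open>chain q s a m\<close> is the root vector of the segment \<open>a, \<dots>, a + m\<close>.\<close>

primrec chain :: "complex \<Rightarrow> (nat \<Rightarrow> 'a) \<Rightarrow> nat \<Rightarrow> nat \<Rightarrow> 'a" where
  "chain q s a 0 = s a"
| "chain q s a (Suc m) = br q (s a) (chain q s (Suc a) m)"

lemma commute_chain:
  assumes "\<And>i. a \<le> i \<Longrightarrow> i \<le> a + m \<Longrightarrow> z * s i = s i * z"
  shows "z * chain q s a m = chain q s a m * z"
  using assms
proof (induction m arbitrary: a)
  case (Suc m)
  then show ?case by (auto intro!: commute_br)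
qed simp

lemma qcommute_br:
  assumes "z * x = x * z" "z * y = p *c (y * z)"
  shows "z * br q x y = p *c (br q x y * z)"
proof -
  have "z * (x * y) = p *c (x * (y * z))" "z * (y * x) = p *c (y * (x * z))"
    using assms by (metis mult.assoc mult_sc sc_mult)+
  then show ?thesis by (simp add: br_def calg_simps)
qed

lemma qcommute_br':
  assumes "z * x = p *c (x * z)" "z * y = y * z"
  shows "z * br q x y = p *c (br q x y * z)"
proof -
  have "z * (x * y) = p *c (x * (y * z))" "z * (y * x) = p *c (y * (x * z))"
    using assms by (metis mult.assoc mult_sc sc_mult)+
  then show ?thesis by (simp add: br_def calg_simps)
qed

end

text \<open>\<open>serre_left\<close> and \<open>serre_right\<close> are the quantum Serre
  relations, rewritten so that the q-bracket of two neighbours q-commutes with each of them.\<close>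

locale serre_chain =
  fixes q :: complex and s :: "nat \<Rightarrow> 'a::calg" and L :: nat
  assumes q: "q \<noteq> 0" "q\<^sup>2 \<noteq> -1"
    and far: "\<And>i j. i + 2 \<le> j \<Longrightarrow> j \<le> L \<Longrightarrow> s i * s j = s j * s i"
    and serre_left: "\<And>i. Suc i \<le> L \<Longrightarrow>
      s i * br q (s i) (s (Suc i)) = (1 / q) *c (br q (s i) (s (Suc i)) * s i)"
    and serre_right: "\<And>i. Suc i \<le> L \<Longrightarrow>
      s (Suc i) * br q (s i) (s (Suc i)) = q *c (br q (s i) (s (Suc i)) * s (Suc i))"
begin

abbreviation "R \<equiv> chain q s"

lemma far_chain:
  assumes "a + m \<le> L" "c \<le> L" "c + 2 \<le> a \<or> a + m + 2 \<le> c"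
  shows "s c * R a m = R a m * s c"
proof (rule commute_chain)
  fix i assume "a \<le> i" "i \<le> a + m"
  then have "c + 2 \<le> i \<or> i + 2 \<le> c" "i \<le> L" using assms by auto
  then show "s c * s i = s i * s c" using far[of c i] far[of i c] assms(2) by auto
qed

lemma chain_far_chain:
  assumes "a + m + 2 \<le> b" "b + k \<le> L"
  shows "R a m * R b k = R b k * R a m"
proof (rule commute_chain)
  fix i assume "b \<le> i" "i \<le> b + k"
  then show "R a m * s i = s i * R a m" using assms by (intro far_chain[symmetric]) auto
qed

text \<open>The recursion of \<open>chain\<close> cuts a segment only after its first node;
  iterating \<open>br_assoc\<close> allows a cut anywhere.\<close>

lemma chain_split:
  assumes "a + m + Suc k \<le> L"
  shows "R a (m + Suc k) = br q (R a m) (R (Suc (a + m)) k)"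
  using assms
proof (induction m arbitrary: a)
  case (Suc m)
  have "R a (Suc m + Suc k) = br q (s a) (br q (R (Suc a) m) (R (Suc (Suc a + m)) k))"
    using Suc.IH[of "Suc a"] Suc.prems by simp
  also have "\<dots> = br q (br q (s a) (R (Suc a) m)) (R (Suc (Suc a + m)) k)"
    using Suc.prems by (intro br_assoc[symmetric] far_chain) auto
  finally show ?case by simp
qed simp

lemma chain_left_end:
  assumes "a + Suc m \<le> L"
  shows "s a * R a (Suc m) = (1 / q) *c (R a (Suc m) * s a)"
proof (cases m)
  case 0
  then show ?thesis using serre_left assms by simp
next
  case (Suc k)
  have "R a (Suc m) = br q (R a (Suc 0)) (R (Suc (Suc a)) k)"
    using chain_split[of a "Suc 0" k] assms Suc by simp
  moreover have "s a * R (Suc (Suc a)) k = R (Suc (Suc a)) k * s a"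
    using assms Suc by (intro far_chain) auto
  ultimately show ?thesis using serre_left[of a] assms by (auto intro!: qcommute_br')
qed

lemma chain_right_end:
  assumes "a + Suc m \<le> L"
  shows "s (a + Suc m) * R a (Suc m) = q *c (R a (Suc m) * s (a + Suc m))"
  using assms
proof (induction m arbitrary: a)
  case 0
  then show ?case using serre_right by simp
next
  case (Suc m)
  have "s (a + Suc (Suc m)) * s a = s a * s (a + Suc (Suc m))"
    using Suc.prems by (intro far[symmetric]) auto
  then show ?case using Suc.IH[of "Suc a"] Suc.prems
    by (subst (1 2) chain.simps) (rule qcommute_br, auto)
qed

text \<open>This is \<open>middle_commute\<close> with the node c as B and the parts of the segment
  on its two sides as A and C.\<close>

lemma inner_commute:
  assumes "a < c" "c < a + m" "a + m \<le> L"
  shows "s c * R a m = R a m * s c"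
proof -
  \<comment> \<open>The segment has i + 1 nodes to the left of c and j + 1 nodes to its
    right.\<close>
  obtain i where i: "c = Suc (a + i)" using assms(1) less_imp_Suc_add by blast
  obtain j where j: "m = Suc i + Suc j"
    using assms(2) i by (metis add_Suc_right add_less_cancel_left less_imp_Suc_add add_Suc)
  have R1: "R a m = br q (R a i) (R c (Suc j))"
    using chain_split[of a i "Suc j"] assms(3) i j by simp
  have R2: "br q (R a i) (s c) = R a (Suc i)"
    using chain_split[of a i 0] assms(3) i j by simp
  have "s c * br q (R a i) (br q (s c) (R (Suc c) j)) = br q (R a i) (br q (s c) (R (Suc c) j)) * s c"
  proof (rule middle_commute[OF _ q])
    show "R a i * R (Suc c) j = R (Suc c) j * R a i"
      using assms i j by (intro chain_far_chain) auto
    show "s c * br q (s c) (R (Suc c) j) = (1 / q) *c (br q (s c) (R (Suc c) j) * s c)"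
      using chain_left_end[of c j] assms i j by simp
    have "s c * R a (Suc i) = q *c (R a (Suc i) * s c)"
      using chain_right_end[of a i] assms i j by simp
    then show "br q (R a i) (s c) * s c = (1 / q) *c (s c * br q (R a i) (s c))"
      using q by (simp add: R2)
  qed
  then show ?thesis by (simp add: R1)
qed

lemma tail_commute:
  assumes "Suc i < k" "k \<le> L"
  shows "R 1 i * R 0 k = R 0 k * R 1 i"
  by (rule commute_chain[symmetric]) (use assms inner_commute[of 0 _ k] in auto)

text \<open>The segments 1, ..., i + 1 and 0, ..., i + 1 share their right end. Only that node
  contributes a factor q, the others being inner nodes of the longer segment.\<close>

lemma tail_qcommute:
  assumes "Suc i \<le> L"
  shows "R 1 i * R 0 (Suc i) = q *c (R 0 (Suc i) * R 1 i)"
proof -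
  have *: "R a m * R 0 (Suc i) = q *c (R 0 (Suc i) * R a m)" if "1 \<le> a" "a + m = Suc i" for a m
    using that
  proof (induction m arbitrary: a)
    case 0
    then show ?case using chain_right_end[of 0 i] assms by simp
  next
    case (Suc m)
    have "R 0 (Suc i) * s a = s a * R 0 (Suc i)"
      using Suc.prems assms by (intro inner_commute[symmetric]) auto
    moreover have "R 0 (Suc i) * R (Suc a) m = (1 / q) *c (R (Suc a) m * R 0 (Suc i))"
      using Suc.IH[of "Suc a"] Suc.prems q by simp
    ultimately have "R 0 (Suc i) * R a (Suc m) = (1 / q) *c (R a (Suc m) * R 0 (Suc i))"
      by (auto intro: qcommute_br)
    then show ?case using q by simp
  qed
  show ?thesis using *[of 1 i] by simp
qed

text \<open>The remaining case, where straightening leaves a correction. Both long segments are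
  q-brackets with the same right part C, namely [B, C] and [A, C], and B A = q A B; the correction
  is the product in which C has changed partners.\<close>

lemma tail_commutator:
  assumes "i < k" "Suc k \<le> L"
  shows "R 1 k * R 0 (Suc i) = R 0 (Suc i) * R 1 k + (q - 1 / q) *c (R 0 (Suc k) * R 1 i)"
proof -
  define A where "A = R 0 (Suc i)"
  define B where "B = R 1 i"
  obtain m where m: "k = i + Suc m" using assms(1) less_imp_Suc_add by auto
  define C where "C = R (Suc (Suc i)) m"
  have BA: "B * A = q *c (A * B)" using tail_qcommute[of i] assms by (simp add: A_def B_def)
  have X: "R 1 k = B * C - q *c (C * B)"
    using chain_split[of 1 i m] assms m by (simp add: B_def C_def br_def)
  have W: "R 0 (Suc k) = A * C - q *c (C * A)"
    using chain_split[of 0 "Suc i" m] assms m by (simp add: A_def C_def br_def)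
  have BW: "B * R 0 (Suc k) = R 0 (Suc k) * B"
    using tail_commute[of i "Suc k"] assms by (simp add: B_def)
  have AB: "A * (B * x) = (1 / q) *c (B * (A * x))" for x
    using BA q by (simp add: mult.assoc[symmetric])
  have 1: "R 1 k * A = B * (C * A) - (q * q) *c (C * (A * B))"
    unfolding X by (simp add: calg_simps BA)
  have 2: "A * R 1 k = (1 / q) *c (B * (A * C)) - q *c (A * (C * B))"
    unfolding X by (simp add: calg_simps AB)
  have "R 1 k * A - A * R 1 k = q *c (R 0 (Suc k) * B) - (1 / q) *c (B * R 0 (Suc k))"
    unfolding 1 2 W using q by (simp add: calg_simps)
  then show ?thesis unfolding BW A_def[symmetric] B_def[symmetric]
    by (simp add: calg_simps)
qed

end

section \<open>Homomorphisms from the free algebra\<close>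

lemma sum_monomials: "(\<Sum>w\<in>Poly_Mapping.keys x. Poly_Mapping.single w (Poly_Mapping.lookup x w)) = x"
proof (rule poly_mapping_eqI)
  fix k
  show "Poly_Mapping.lookup (\<Sum>w\<in>Poly_Mapping.keys x. Poly_Mapping.single w (Poly_Mapping.lookup x w)) k
      = Poly_Mapping.lookup x k"
    by (cases "k \<in> Poly_Mapping.keys x")
      (auto simp: lookup_sum lookup_single when_def sum.delta in_keys_iff)
qed

lemma const_simps [simp]:
  "const 0 = 0" "const 1 = 1" "const (c + d) = const c + const d" "const (- c) = - const c"
  "const (c * d) = const c * const d"
  by (simp_all add: const_def single_add single_uminus mult_single one_poly_mapping_def[symmetric])

lemma const_mult_single: "const c * Poly_Mapping.single w d = Poly_Mapping.single w (c * d)"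
  "Poly_Mapping.single w d * const c = Poly_Mapping.single w (c * d)"
  by (simp_all add: const_def mult_single mult.commute)

lemma const_commute: "const c * x = x * const c"
  by (subst (1 2) sum_monomials[of x, symmetric])
    (simp only: sum_distrib_left sum_distrib_right const_mult_single)

lemma free_ext_superset:
  assumes "finite S" "Poly_Mapping.keys x \<subseteq> S"
  shows "free_ext \<phi> x = (\<Sum>w\<in>S. const (Poly_Mapping.lookup x w) * prod_list (map \<phi> (letters w)))"
  unfolding free_ext_def
  by (rule sum.mono_neutral_left) (use assms in \<open>auto simp: in_keys_iff\<close>)

lemma free_ext_add [simp]: "free_ext \<phi> (x + y) = free_ext \<phi> x + free_ext \<phi> y"
proof -
  let ?S = "Poly_Mapping.keys x \<union> Poly_Mapping.keys y"
  have "Poly_Mapping.keys (x + y) \<subseteq> ?S" by (rule Poly_Mapping.keys_add)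
  then show ?thesis
    by (simp add: free_ext_superset[of ?S] lookup_add sum.distrib distrib_right)
qed

lemma free_ext_zero [simp]: "free_ext \<phi> 0 = 0"
  by (simp add: free_ext_def)

lemma free_ext_minus [simp]: "free_ext \<phi> (- x) = - free_ext \<phi> x"
  using free_ext_add[of \<phi> x "- x"] by (simp add: add_eq_0_iff del: free_ext_add)

lemma free_ext_diff [simp]: "free_ext \<phi> (x - y) = free_ext \<phi> x - free_ext \<phi> y"
  using free_ext_add[of \<phi> x "- y"] by simp

lemma free_ext_sum: "free_ext \<phi> (sum f A) = (\<Sum>i\<in>A. free_ext \<phi> (f i))"
  by (induction A rule: infinite_finite_induct) simp_all

lemma free_ext_single:
  "free_ext \<phi> (Poly_Mapping.single w c) = const c * prod_list (map \<phi> (letters w))"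
  by (simp add: free_ext_def)

lemma letters_simps [simp]: "letters (0 :: uword) = []" "letters (u + v) = letters u @ letters v"
  by (simp_all add: zero_uword_def plus_uword_def)

lemma free_ext_const [simp]: "free_ext \<phi> (const c) = const c"
  by (simp add: const_def[of c] free_ext_single)

lemma free_ext_one [simp]: "free_ext \<phi> 1 = 1"
  using free_ext_const[of \<phi> 1] by simp

lemma free_ext_var [simp]: "free_ext \<phi> (var g) = \<phi> g"
  by (simp add: var_def free_ext_single)

lemma free_ext_mult [simp]: "free_ext \<phi> (x * y) = free_ext \<phi> x * free_ext \<phi> y"
proof -
  have single: "free_ext \<phi> (Poly_Mapping.single u c * Poly_Mapping.single v d)
      = free_ext \<phi> (Poly_Mapping.single u c) * free_ext \<phi> (Poly_Mapping.single v d)" for u v c d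
  proof -
    let ?P = "prod_list (map \<phi> (letters u))" and ?Q = "prod_list (map \<phi> (letters v))"
    have "const c * ?P * (const d * ?Q) = const c * (?P * const d) * ?Q" by (simp only: mult.assoc)
    also have "\<dots> = const c * (const d * ?P) * ?Q" by (simp only: const_commute[of d ?P])
    finally show ?thesis by (simp add: mult_single free_ext_single mult.assoc)
  qed
  show ?thesis
    by (subst (1 2) sum_monomials[of x, symmetric], subst (1 2) sum_monomials[of y, symmetric])
      (simp only: sum_product free_ext_sum single)
qed

lemma free_on_simps [simp, intro]:
  "x \<in> free_on G \<Longrightarrow> y \<in> free_on G \<Longrightarrow> x + y \<in> free_on G"
  "x \<in> free_on G \<Longrightarrow> - x \<in> free_on G"
  "const c \<in> free_on G" "0 \<in> free_on G" "1 \<in> free_on G"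
  "g \<in> G \<Longrightarrow> var g \<in> free_on G"
  "x \<in> free_on G \<Longrightarrow> y \<in> free_on G \<Longrightarrow> x - y \<in> free_on G"
  "x \<in> free_on G \<Longrightarrow> y \<in> free_on G \<Longrightarrow> x * y \<in> free_on G"
proof -
  show add: "x + y \<in> free_on G" if "x \<in> free_on G" "y \<in> free_on G" for x y
    using that Poly_Mapping.keys_add[of x y] by (auto simp: free_on_def dest!: subsetD)
  show min: "- x \<in> free_on G" if "x \<in> free_on G" for x
    using that by (auto simp: free_on_def)
  show "x - y \<in> free_on G" if "x \<in> free_on G" "y \<in> free_on G" for x y
    using add[OF that(1) min[OF that(2)]] by simp
  show c: "const c \<in> free_on G" for c
    by (auto simp: free_on_def const_def split: if_splits)
  show "0 \<in> free_on G" "1 \<in> free_on G" using c[of 0] c[of 1] by simp_all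
  show "var g \<in> free_on G" if "g \<in> G" using that by (simp add: free_on_def var_def)
  show "x * y \<in> free_on G" if "x \<in> free_on G" "y \<in> free_on G" for x y
  proof -
    have "set (letters w) \<subseteq> G" if w: "w \<in> Poly_Mapping.keys (x * y)" for w
    proof -
      obtain u v where "w = u + v" "u \<in> Poly_Mapping.keys x" "v \<in> Poly_Mapping.keys y"
        using subsetD[OF keys_mult w] by blast
      then show ?thesis using \<open>x \<in> free_on G\<close> \<open>y \<in> free_on G\<close> by (auto simp: free_on_def)
    qed
    then show ?thesis by (simp add: free_on_def)
  qed
qed

lemma free_on_mono: "G \<subseteq> H \<Longrightarrow> free_on G \<subseteq> free_on H"
  by (auto simp: free_on_def)

abbreviation gens :: "nat \<Rightarrow> gen set" where "gens n \<equiv> gens_le n \<union> gens_ge n"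

lemma ring_free_alg: "ring (free_alg n)"
proof (rule ringI)
  show "abelian_group (free_alg n)"
  proof (rule abelian_groupI)
    show "\<exists>y\<in>carrier (free_alg n). y \<oplus>\<^bsub>free_alg n\<^esub> x = \<zero>\<^bsub>free_alg n\<^esub>"
      if "x \<in> carrier (free_alg n)" for x
      using that by (intro bexI[of _ "- x"]) (simp_all add: free_alg_def)
  qed (simp_all add: free_alg_def add.assoc add.commute)
  show "Group.monoid (free_alg n)"
    by (rule monoidI) (simp_all add: free_alg_def mult.assoc)
qed (simp_all add: free_alg_def distrib_left distrib_right)

lemma rels_carrier:
  "torus_rels n \<union> weight_rels n q \<union> EF_rels n q \<union> serre_rels n q \<subseteq> carrier (free_alg n)"
proof -
  have "fE a \<in> carrier (free_alg n)" "fF a \<in> carrier (free_alg n)" "fK a \<in> carrier (free_alg n)"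
    "fKinv a \<in> carrier (free_alg n)" if "a \<in> simple_roots n" for a
    using that by (auto simp: free_alg_def gens_le_def gens_ge_def)
  then show ?thesis
    by (simp add: torus_rels_def weight_rels_def EF_rels_def serre_rels_def serre_def free_alg_def
        UN_subset_iff)
qed

lemma ideal_rel: "ideal (rel_ideal n q) (free_alg n)"
  unfolding rel_ideal_def by (rule ring.genideal_ideal[OF ring_free_alg rels_carrier])

lemma ring_Uq: "ring (Uq n q)"
  unfolding Uq_def by (rule ideal.quotient_is_ring[OF ideal_rel])

lemma cls_hom: "cls n q \<in> ring_hom (free_alg n) (Uq n q)"
  using ideal.rcos_ring_hom[OF ideal_rel, of n q] unfolding cls_def[abs_def] Uq_def .

lemma carrier_Uq: "carrier (Uq n q) = cls n q ` free_on (gens n)"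
  by (auto simp: Uq_def FactRing_def A_RCOSETS_defs cls_def a_r_coset_def free_alg_def)

lemma cls_simps:
  assumes "x \<in> free_on (gens n)" "y \<in> free_on (gens n)"
  shows "cls n q (x + y) = cls n q x \<oplus>\<^bsub>Uq n q\<^esub> cls n q y"
    "cls n q (x * y) = cls n q x \<otimes>\<^bsub>Uq n q\<^esub> cls n q y"
    "cls n q (- x) = \<ominus>\<^bsub>Uq n q\<^esub> cls n q x"
    "cls n q (x - y) = cls n q x \<ominus>\<^bsub>Uq n q\<^esub> cls n q y"
proof -
  interpret U: ring "Uq n q" by (rule ring_Uq)
  have c: "cls n q z \<in> carrier (Uq n q)" if "z \<in> free_on (gens n)" for z
    using that by (auto simp: carrier_Uq)
  have add: "cls n q (u + v) = cls n q u \<oplus>\<^bsub>Uq n q\<^esub> cls n q v"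
    if "u \<in> free_on (gens n)" "v \<in> free_on (gens n)" for u v
    using ring_hom_add[OF cls_hom, of u n v q] that by (simp add: free_alg_def)
  show "cls n q (x + y) = cls n q x \<oplus>\<^bsub>Uq n q\<^esub> cls n q y" by (rule add) fact+
  show "cls n q (x * y) = cls n q x \<otimes>\<^bsub>Uq n q\<^esub> cls n q y"
    using ring_hom_mult[OF cls_hom, of x n y q] assms by (simp add: free_alg_def)
  have 0: "cls n q 0 = \<zero>\<^bsub>Uq n q\<^esub>"
    using add[of 0 0] c[of 0] by (metis U.l_neg U.add.l_cancel_one' add_0 free_on_simps(4))
  have m: "cls n q (- z) = \<ominus>\<^bsub>Uq n q\<^esub> cls n q z" if "z \<in> free_on (gens n)" for z
  proof (rule U.minus_equality[symmetric])
    show "cls n q (- z) \<oplus>\<^bsub>Uq n q\<^esub> cls n q z = \<zero>\<^bsub>Uq n q\<^esub>"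
      using add[of "- z" z] that by (simp add: 0)
  qed (use that c in auto)
  show "cls n q (- x) = \<ominus>\<^bsub>Uq n q\<^esub> cls n q x" by (rule m) fact
  show "cls n q (x - y) = cls n q x \<ominus>\<^bsub>Uq n q\<^esub> cls n q y"
    using add[of x "- y"] m[of y] assms by (simp add: a_minus_def)
qed

lemma cls_one: "cls n q 1 = \<one>\<^bsub>Uq n q\<^esub>"
  using ring_hom_one[OF cls_hom, of n q] by (simp add: free_alg_def)

lemma cls_rel:
  assumes "x - y \<in> torus_rels n \<union> weight_rels n q \<union> EF_rels n q \<union> serre_rels n q"
    "x \<in> free_on (gens n)" "y \<in> free_on (gens n)"
  shows "cls n q x = cls n q y"
proof -
  interpret U: ring "Uq n q" by (rule ring_Uq)
  have "x - y \<in> rel_ideal n q"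
    unfolding rel_ideal_def using ring.genideal_self[OF ring_free_alg rels_carrier] assms(1) by blast
  then have "cls n q (x - y) = \<zero>\<^bsub>Uq n q\<^esub>"
    unfolding cls_def Uq_def using ring.a_rcos_zero[OF ring_free_alg ideal_rel] by (simp add: FactRing_def)
  then have "cls n q x \<ominus>\<^bsub>Uq n q\<^esub> cls n q y = \<zero>\<^bsub>Uq n q\<^esub>"
    using cls_simps(4) assms(2,3) by metis
  then show ?thesis using assms(2,3) by (simp add: carrier_Uq)
qed

section \<open>The quantized enveloping algebra as a type\<close>

definition commutator_formula :: "nat \<Rightarrow> complex \<Rightarrow> (uq_elem \<Rightarrow> uq_elem \<Rightarrow> complex) \<Rightarrow>
    (uq_elem \<Rightarrow> uq_elem) \<Rightarrow> (uq_elem \<Rightarrow> uq_elem) \<Rightarrow> (nat \<Rightarrow> nat \<Rightarrow> uq_elem \<Rightarrow> uq_elem) \<Rightarrow>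
    uq_elem \<Rightarrow> bool" where
  "commutator_formula n q J O1 O2 Op g \<longleftrightarrow> (let U = Uq n q in
    E n q beta \<otimes>\<^bsub>U\<^esub> g \<ominus>\<^bsub>U\<^esub> g \<otimes>\<^bsub>U\<^esub> E n q beta =
      O1 g \<otimes>\<^bsub>U\<^esub> K n q beta \<oplus>\<^bsub>U\<^esub> O2 g \<otimes>\<^bsub>U\<^esub> Kinv n q beta
      \<oplus>\<^bsub>U\<^esub> (\<Oplus>\<^bsub>U\<^esub>i\<in>{1..n-1}. Op i 0 g
            \<otimes>\<^bsub>U\<^esub> scal n q (1 / J (X n q i) (X_check n q i)) (X n q i) \<otimes>\<^bsub>U\<^esub> Kinv n q beta)
      \<oplus>\<^bsub>U\<^esub> (\<Oplus>\<^bsub>U\<^esub>j\<in>{1..n-1}. Op 0 j g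
            \<otimes>\<^bsub>U\<^esub> scal n q (1 / J (Y n q j) (Y_check n q j)) (Y n q j) \<otimes>\<^bsub>U\<^esub> Kinv n q beta)
      \<oplus>\<^bsub>U\<^esub> (\<Oplus>\<^bsub>U\<^esub>i\<in>{1..n-1}. \<Oplus>\<^bsub>U\<^esub>j\<in>{1..n-1}. Op i j g
            \<otimes>\<^bsub>U\<^esub> scal n q (1 / (J (X n q i) (X_check n q i) * J (Y n q j) (Y_check n q j)))
                (X n q i \<otimes>\<^bsub>U\<^esub> Y n q j) \<otimes>\<^bsub>U\<^esub> Kinv n q beta))"

text \<open>The theorem as a single predicate of the parameter pair, so that the choice of
  \<open>crit\<close> can refer to it.\<close>

definition commutator_claim :: "nat \<times> complex \<Rightarrow> bool" where
  "commutator_claim p \<longleftrightarrow> (case p of (n, q) \<Rightarrow> \<forall>J O1 O2 Op g.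
     q_Killing_form n q J \<longrightarrow>
     determined_by n q J
       (\<lambda>g \<psi>. - J g (Z n q 1 1 \<otimes>\<^bsub>Uq n q\<^esub> (Kinv n q beta \<otimes>\<^bsub>Uq n q\<^esub> \<psi> \<otimes>\<^bsub>Uq n q\<^esub> K n q beta))) O1 \<longrightarrow>
     determined_by n q J (\<lambda>g \<psi>. J g (\<psi> \<otimes>\<^bsub>Uq n q\<^esub> Z n q 1 1)) O2 \<longrightarrow>
     (\<forall>i j. i \<le> n - 1 \<longrightarrow> j \<le> n - 1 \<longrightarrow> (i, j) \<noteq> (0, 0) \<longrightarrow>
       determined_by n q J (\<lambda>g \<psi>. J g (\<psi> \<otimes>\<^bsub>Uq n q\<^esub> Z n q (i + 1) (j + 1))) (Op i j)) \<longrightarrow>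
     g \<in> A_minus n q \<longrightarrow> commutator_formula n q J O1 O2 Op g)"

definition admissible :: "nat \<times> complex \<Rightarrow> bool" where
  "admissible p \<longleftrightarrow> (case p of (n, q) \<Rightarrow> n \<ge> 1 \<and> q \<noteq> 0 \<and> (\<forall>k\<ge>1. q ^ k \<noteq> 1))"

text \<open>A type cannot depend on \<open>n\<close> and \<open>q\<close>.  To calculate in a type of the class of rings,
  \<open>n\<close> and \<open>q\<close> are frozen at a pair of parameters that would violate the claim if any pair did, so
  that the claim for these parameters implies the claim for all.\<close>

definition crit :: "nat \<times> complex" where
  "crit = (SOME p. admissible p \<and> (commutator_claim p \<longrightarrow> (\<forall>p'. admissible p' \<longrightarrow> commutator_claim p')))"

text \<open>The drinker's paradox: choose a violating pair if there is one and any admissible pair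
  otherwise. The second case requires an admissible pair to exist, and (1, 2) is one.\<close>

lemma crit: "admissible crit" "commutator_claim crit \<Longrightarrow> admissible p \<Longrightarrow> commutator_claim p"
proof -
  have "(2 :: complex) ^ k \<noteq> 1" if "k \<ge> 1" for k
  proof
    assume "(2 :: complex) ^ k = 1"
    then have "norm ((2 :: complex) ^ k) = 1" by simp
    then have "(2 :: real) ^ k = 1" by (simp add: norm_power)
    then show False using one_less_power[of "2 :: real" k] that by simp
  qed
  then have "admissible (1, 2)" by (auto simp: admissible_def)
  then have "\<exists>p. admissible p \<and> (commutator_claim p \<longrightarrow> (\<forall>p'. admissible p' \<longrightarrow> commutator_claim p'))"
    by blast
  from someI_ex[OF this]
  show "admissible crit" "commutator_claim crit \<Longrightarrow> admissible p \<Longrightarrow> commutator_claim p"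
    unfolding crit_def by blast+
qed

definition N :: nat where "N = fst crit"
definition Q :: complex where "Q = snd crit"

lemma N: "N \<ge> 1" and Q: "Q \<noteq> 0" "k \<ge> 1 \<Longrightarrow> Q ^ k \<noteq> 1"
  using crit(1) unfolding N_def Q_def admissible_def by (auto simp: case_prod_unfold)

text \<open>If q^2 were -1, then q would be a fourth root of unity. The first inequality permits the
  division in \<open>middle_commute\<close>; the other two give \<open>gam\<close> \<noteq>
  0.\<close>

lemma Q2: "Q\<^sup>2 \<noteq> -1" "Q\<^sup>2 \<noteq> 1" "Q * Q \<noteq> 1"
proof -
  show "Q\<^sup>2 \<noteq> -1"
  proof
    assume "Q\<^sup>2 = -1"
    then have "(Q\<^sup>2)\<^sup>2 = 1" by simp
    then show False using Q(2)[of 4] by (simp flip: power_mult)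
  qed
  show "Q\<^sup>2 \<noteq> 1" using Q(2)[of 2] by simp
  then show "Q * Q \<noteq> 1" by (simp add: power2_eq_square)
qed

definition gam :: complex where "gam = Q - 1 / Q"

lemma gam: "gam \<noteq> 0"
  using Q Q2 by (auto simp: gam_def field_simps)

typedef uq = "carrier (Uq N Q)"
  using ring.ring_simprules(2)[OF ring_Uq] by blast

abbreviation FA :: "falg set" where "FA \<equiv> free_on (gens N)"

text \<open>Outside \<open>FA\<close> the class need not lie in the carrier and the value is
  arbitrary, hence the membership conditions in the rules below.\<close>

definition ev :: "falg \<Rightarrow> uq" where "ev f = Abs_uq (cls N Q f)"

lemma cls_in: "f \<in> FA \<Longrightarrow> cls N Q f \<in> carrier (Uq N Q)"
  by (auto simp: carrier_Uq)

lemma Rep_ev [simp]: "f \<in> FA \<Longrightarrow> Rep_uq (ev f) = cls N Q f"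
  unfolding ev_def by (rule Abs_uq_inverse[OF cls_in])

lemma ev_cases:
  obtains f where "f \<in> FA" "x = ev f"
  using Rep_uq[of x] by (metis (no_types, lifting) Rep_uq_inverse carrier_Uq ev_def imageE)

lemma ev_eq: "cls N Q f = cls N Q g \<Longrightarrow> ev f = ev g"
  by (simp add: ev_def)

instantiation uq :: calg
begin

definition zero_uq :: uq where "0 = ev 0"
definition one_uq :: uq where "1 = ev 1"
definition plus_uq :: "uq \<Rightarrow> uq \<Rightarrow> uq" where "x + y = Abs_uq (Rep_uq x \<oplus>\<^bsub>Uq N Q\<^esub> Rep_uq y)"
definition minus_uq :: "uq \<Rightarrow> uq \<Rightarrow> uq" where "x - y = Abs_uq (Rep_uq x \<ominus>\<^bsub>Uq N Q\<^esub> Rep_uq y)"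
definition uminus_uq :: "uq \<Rightarrow> uq" where "- x = Abs_uq (\<ominus>\<^bsub>Uq N Q\<^esub> Rep_uq x)"
definition times_uq :: "uq \<Rightarrow> uq \<Rightarrow> uq" where "x * y = Abs_uq (Rep_uq x \<otimes>\<^bsub>Uq N Q\<^esub> Rep_uq y)"
definition sc_uq :: "complex \<Rightarrow> uq \<Rightarrow> uq" where "c *c x = Abs_uq (scal N Q c (Rep_uq x))"

lemma ev_ops:
  assumes "f \<in> FA" "g \<in> FA"
  shows "ev f + ev g = ev (f + g)" "ev f - ev g = ev (f - g)" "- ev f = ev (- f)"
    "ev f * ev g = ev (f * g)" "c *c ev f = ev (const c * f)"
  using assms unfolding plus_uq_def minus_uq_def uminus_uq_def times_uq_def sc_uq_def scal_def
  by (simp_all add: ev_def[symmetric] cls_simps[symmetric])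

instance
proof
  fix a b c :: uq and r s :: complex
  obtain f g h where fgh: "f \<in> FA" "a = ev f" "g \<in> FA" "b = ev g" "h \<in> FA" "c = ev h"
    using ev_cases by metis
  have const: "x * (const r * y) = const r * (x * y)" for x y :: falg
    by (metis const_commute mult.assoc)
  show "a + b + c = a + (b + c)" "a + b = b + a" "0 + a = a" "- a + a = 0" "a - b = a + - b"
    "a * b * c = a * (b * c)" "(a + b) * c = a * c + b * c" "a * (b + c) = a * b + a * c"
    "1 * a = a" "a * 1 = a" "r *c (a + b) = r *c a + r *c b" "(r + s) *c a = r *c a + s *c a"
    "r *c s *c a = (r * s) *c a" "1 *c a = a" "r *c a * b = r *c (a * b)" "a * r *c b = r *c (a * b)"
    using fgh by (simp_all add: ev_ops zero_uq_def one_uq_def algebra_simps const)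
qed

end

lemma ev_simps [simp]:
  assumes "f \<in> FA"
  shows "g \<in> FA \<Longrightarrow> ev (f + g) = ev f + ev g" "g \<in> FA \<Longrightarrow> ev (f - g) = ev f - ev g"
    "g \<in> FA \<Longrightarrow> ev (f * g) = ev f * ev g" "ev (- f) = - ev f" "ev (const c * f) = c *c ev f"
  using assms by (simp_all add: ev_ops)

lemma ev_const [simp]: "ev 0 = 0" "ev 1 = 1" "ev (const c) = c *c 1"
  using ev_simps(5)[of 1 c] by (simp_all add: zero_uq_def one_uq_def)

section \<open>Relations\<close>

definition gE :: "int \<Rightarrow> uq" where "gE a = ev (fE a)"
definition gF :: "int \<Rightarrow> uq" where "gF a = ev (fF a)"
definition gK :: "int \<Rightarrow> uq" where "gK a = ev (fK a)"
definition gL :: "int \<Rightarrow> uq" where "gL a = ev (fKinv a)"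

definition I :: "int set" where "I = simple_roots N"

lemma simple_roots_iff:
  assumes "n \<ge> 1"
  shows "a \<in> simple_roots n \<longleftrightarrow> \<bar>a\<bar> < int n"
proof -
  have "\<bar>a\<bar> < int n \<longleftrightarrow> a = 0 \<or> (\<exists>i\<in>{1..n-1}. a = - int i) \<or> (\<exists>i\<in>{1..n-1}. a = int i)"
  proof
    assume a: "\<bar>a\<bar> < int n"
    consider "a = 0" | "a < 0" | "a > 0" by linarith
    then show "a = 0 \<or> (\<exists>i\<in>{1..n-1}. a = - int i) \<or> (\<exists>i\<in>{1..n-1}. a = int i)"
    proof cases
      case 2
      then show ?thesis using a by (intro disjI2 disjI1 bexI[of _ "nat (- a)"]) auto
    next
      case 3
      then show ?thesis using a by (intro disjI2 bexI[of _ "nat a"]) auto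
    qed simp
  qed (use assms in auto)
  then show ?thesis by (auto simp: simple_roots_def mu_def nu_def beta_def)
qed

lemma I_iff: "a \<in> I \<longleftrightarrow> \<bar>a\<bar> < int N"
  unfolding I_def by (rule simple_roots_iff[OF N])

lemma gens_mem [simp]:
  "fE a \<in> FA \<longleftrightarrow> a \<in> I" "fF a \<in> FA \<longleftrightarrow> a \<in> I" "fK a \<in> FA \<longleftrightarrow> a \<in> I" "fKinv a \<in> FA \<longleftrightarrow> a \<in> I"
  by (auto simp: free_on_def var_def gens_le_def gens_ge_def I_def)

lemma ev_rel:
  assumes "x - y \<in> torus_rels N \<union> weight_rels N Q \<union> EF_rels N Q \<union> serre_rels N Q"
    "x \<in> FA" "y \<in> FA"
  shows "ev x = ev y"
  by (rule ev_eq, rule cls_rel) fact+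

lemma KL [simp]:
  assumes "a \<in> I"
  shows "gK a * gL a = 1" "gL a * gK a = 1"
  using ev_rel[of "fK a * fKinv a" 1] ev_rel[of "fKinv a * fK a" 1] assms
  by (auto simp: torus_rels_def gK_def gL_def I_def[symmetric])

context
  fixes a b :: int
  assumes ab: "a \<in> I" "b \<in> I"
begin

lemma KEL: "gK a * gE b * gL a = (Q powi root_form a b) *c gE b"
  using ev_rel[of "fK a * fE b * fKinv a" "const (Q powi root_form a b) * fE b"] ab
  by (auto simp: weight_rels_def gK_def gL_def gE_def I_def[symmetric])

lemma KFL: "gK a * gF b * gL a = (Q powi (- root_form a b)) *c gF b"
  using ev_rel[of "fK a * fF b * fKinv a" "const (Q powi (- root_form a b)) * fF b"] ab
  by (auto simp: weight_rels_def gK_def gL_def gF_def I_def[symmetric])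

lemma EF: "gE a * gF b - gF b * gE a = (if a = b then (1 / gam) *c (gK a - gL a) else 0)"
proof -
  have "ev (fE a * fF b - fF b * fE a)
      = ev (if a = b then const (1 / (Q - inverse Q)) * (fK a - fKinv a) else 0)"
    by (rule ev_rel) (use ab in \<open>auto simp: EF_rels_def I_def[symmetric]\<close>)
  then show ?thesis
    using ab by (auto simp: gE_def gF_def gK_def gL_def gam_def inverse_eq_divide split: if_splits)
qed

lemma far_EE: "\<bar>a - b\<bar> \<ge> 2 \<Longrightarrow> gE a * gE b = gE b * gE a"
  and far_FF: "\<bar>a - b\<bar> \<ge> 2 \<Longrightarrow> gF a * gF b = gF b * gF a"
proof -
  assume f: "\<bar>a - b\<bar> \<ge> 2"
  have "{fE a * fE b - fE b * fE a, fF a * fF b - fF b * fF a} \<subseteq> serre_rels N Q"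
    unfolding serre_rels_def using ab f
    by (intro le_supI2 subset_trans[OF _ UN_upper[of a]] subset_trans[OF _ UN_upper[of b]])
      (auto simp: neighbours_def I_def)
  then have "ev (fE a * fE b) = ev (fE b * fE a)" "ev (fF a * fF b) = ev (fF b * fF a)"
    using ab by (auto intro!: ev_rel simp del: ev_simps)
  then show "gE a * gE b = gE b * gE a" "gF a * gF b = gF b * gF a"
    using ab by (simp_all add: gE_def gF_def)
qed

lemma serre_FF:
  assumes n: "\<bar>a - b\<bar> = 1"
  shows "gF a * gF a * gF b - (Q + 1 / Q) *c (gF a * gF b * gF a) + gF b * gF a * gF a = 0"
proof -
  have "serre Q (fF a) (fF b) \<in> serre_rels N Q"
    unfolding serre_rels_def using ab n
    by (intro UnI1 UN_I[of a] UN_I[of b]) (auto simp: neighbours_def I_def)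
  moreover have "serre Q (fF a) (fF b) \<in> FA"
    using ab by (auto simp: serre_def)
  ultimately have "ev (serre Q (fF a) (fF b)) = ev 0"
    by (auto intro!: ev_rel simp del: ev_const)
  then show ?thesis
    using ab by (auto simp: serre_def gF_def inverse_eq_divide mult.assoc simp del: const_simps)
qed

end

section \<open>Convolution of functionals on words\<close>

definition evw :: "gen list \<Rightarrow> uq" where "evw w = prod_list (map (\<lambda>g. ev (var g)) w)"

lemma evw_simps [simp]:
  "evw [] = 1" "evw (GE a # w) = gE a * evw w" "evw (GF a # w) = gF a * evw w"
  "evw (GK a # w) = gK a * evw w" "evw (GKinv a # w) = gL a * evw w"
  "evw (v @ w) = evw v * evw w"
  by (simp_all add: evw_def gE_def gF_def gK_def gL_def)

lemma evw_Cons: "evw (g # w) = ev (var g) * evw w"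
  by (simp add: evw_def)

text \<open>The convolution, evaluated at a word, for the coproduct with
  \<open>E \<mapsto> E \<otimes> 1 + K \<otimes> E\<close> and \<open>F \<mapsto> F \<otimes> 1 + K\<inverse> \<otimes> F\<close>: on words in \<open>E\<close>, \<open>K\<close> this is \<open>coprod\<close>
  and on words in \<open>F\<close>, \<open>K\<close> it is the opposite of \<open>coprod\<close>, so that both compatibility conditions
  of the \<open>q\<close>-Killing form take the same shape.\<close>

fun conv :: "(uq \<Rightarrow> complex) \<Rightarrow> (uq \<Rightarrow> complex) \<Rightarrow> gen list \<Rightarrow> complex" where
  "conv \<phi> \<psi> [] = \<phi> 1 * \<psi> 1"
| "conv \<phi> \<psi> (GE a # w) =
     conv (\<lambda>x. \<phi> (gE a * x)) \<psi> w + conv (\<lambda>x. \<phi> (gK a * x)) (\<lambda>x. \<psi> (gE a * x)) w"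
| "conv \<phi> \<psi> (GF a # w) =
     conv (\<lambda>x. \<phi> (gF a * x)) \<psi> w + conv (\<lambda>x. \<phi> (gL a * x)) (\<lambda>x. \<psi> (gF a * x)) w"
| "conv \<phi> \<psi> (GK a # w) = conv (\<lambda>x. \<phi> (gK a * x)) (\<lambda>x. \<psi> (gK a * x)) w"
| "conv \<phi> \<psi> (GKinv a # w) = conv (\<lambda>x. \<phi> (gL a * x)) (\<lambda>x. \<psi> (gL a * x)) w"

lemma conv_snoc:
  "conv \<phi> \<psi> (w @ [GE a]) =
     conv (\<lambda>x. \<phi> (x * gE a)) \<psi> w + conv (\<lambda>x. \<phi> (x * gK a)) (\<lambda>x. \<psi> (x * gE a)) w"
  "conv \<phi> \<psi> (w @ [GF a]) =
     conv (\<lambda>x. \<phi> (x * gF a)) \<psi> w + conv (\<lambda>x. \<phi> (x * gL a)) (\<lambda>x. \<psi> (x * gF a)) w"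
  "conv \<phi> \<psi> (w @ [GK a]) = conv (\<lambda>x. \<phi> (x * gK a)) (\<lambda>x. \<psi> (x * gK a)) w"
  "conv \<phi> \<psi> (w @ [GKinv a]) = conv (\<lambda>x. \<phi> (x * gL a)) (\<lambda>x. \<psi> (x * gL a)) w"
  by (induction \<phi> \<psi> w rule: conv.induct) (simp_all add: mult.assoc)

text \<open>The closure that keeps \<open>conv\<close> within words over G: splitting off E leaves a
  K in the other factor, and splitting off F leaves a K^-1.\<close>

definition grouplike_closed :: "gen set \<Rightarrow> bool" where
  "grouplike_closed G \<longleftrightarrow> (\<forall>a. GE a \<in> G \<longrightarrow> GK a \<in> G) \<and> (\<forall>a. GF a \<in> G \<longrightarrow> GKinv a \<in> G)"

lemma grouplike_closed_gens: "grouplike_closed (gens_ge N)" "grouplike_closed (gens_le N)"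
  by (auto simp: grouplike_closed_def gens_ge_def gens_le_def)

lemma conv_cong:
  assumes "grouplike_closed G" "set w \<subseteq> G"
    and "\<And>u. set u \<subseteq> G \<Longrightarrow> \<phi> (evw u) = \<phi>' (evw u)"
    and "\<And>u. set u \<subseteq> G \<Longrightarrow> \<psi> (evw u) = \<psi>' (evw u)"
  shows "conv \<phi> \<psi> w = conv \<phi>' \<psi>' w"
  using assms(2-)
proof (induction w arbitrary: \<phi> \<psi> \<phi>' \<psi>')
  case Nil
  from Nil(2)[of "[]"] Nil(3)[of "[]"] show ?case by simp
next
  case (Cons g w)
  have 1: "\<phi> (ev (var h) * evw u) = \<phi>' (ev (var h) * evw u)"
    "\<psi> (ev (var h) * evw u) = \<psi>' (ev (var h) * evw u)" if "h \<in> G" "set u \<subseteq> G" for h u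
    using Cons.prems(2)[of "h # u"] Cons.prems(3)[of "h # u"] that by (simp_all add: evw_Cons)
  have K: "GE a \<in> G \<Longrightarrow> GK a \<in> G" "GF a \<in> G \<Longrightarrow> GKinv a \<in> G" for a
    using assms(1) by (auto simp: grouplike_closed_def)
  note E = 1[of "GE _", folded gE_def] and F = 1[of "GF _", folded gF_def]
    and K1 = 1[of "GK _", folded gK_def] and L1 = 1[of "GKinv _", folded gL_def]
  show ?case
  proof (cases g)
    case (GE a)
    then show ?thesis using Cons.prems K(1)[of a]
      by (auto intro!: arg_cong2[where f = "(+)"] Cons.IH E K1)
  next
    case (GF a)
    then show ?thesis using Cons.prems K(2)[of a]
      by (auto intro!: arg_cong2[where f = "(+)"] Cons.IH F L1)
  next
    case (GK a)
    then show ?thesis using Cons.prems by (auto intro!: Cons.IH K1)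
  next
    case (GKinv a)
    then show ?thesis using Cons.prems by (auto intro!: Cons.IH L1)
  qed
qed

section \<open>Comparison of the convolution with the coproduct of words\<close>

definition tapp :: "(uq \<Rightarrow> complex) \<Rightarrow> (uq \<Rightarrow> complex) \<Rightarrow> falg2 \<Rightarrow> complex" where
  "tapp \<phi> \<psi> t = (\<Sum>p\<in>Poly_Mapping.keys t.
     Poly_Mapping.lookup t p * (\<phi> (evw (letters (fst p))) * \<psi> (evw (letters (snd p)))))"

lemma tapp_superset:
  assumes "finite S" "Poly_Mapping.keys t \<subseteq> S"
  shows "tapp \<phi> \<psi> t = (\<Sum>p\<in>S.
     Poly_Mapping.lookup t p * (\<phi> (evw (letters (fst p))) * \<psi> (evw (letters (snd p)))))"
  unfolding tapp_def
  by (rule sum.mono_neutral_left) (use assms in \<open>auto simp: in_keys_iff\<close>)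

lemma tapp_add: "tapp \<phi> \<psi> (s + t) = tapp \<phi> \<psi> s + tapp \<phi> \<psi> t"
proof -
  let ?S = "Poly_Mapping.keys s \<union> Poly_Mapping.keys t"
  have "Poly_Mapping.keys (s + t) \<subseteq> ?S" by (rule Poly_Mapping.keys_add)
  then show ?thesis
    by (simp add: tapp_superset[of ?S] lookup_add sum.distrib distrib_right)
qed

lemma tapp_sum: "tapp \<phi> \<psi> (sum f A) = (\<Sum>i\<in>A. tapp \<phi> \<psi> (f i))"
  by (induction A rule: infinite_finite_induct) (simp_all add: tapp_add, simp_all add: tapp_def)

lemma tapp_tens_mult:
  "tapp \<phi> \<psi> (tens u v * t) = tapp (\<lambda>x. \<phi> (evw u * x)) (\<lambda>x. \<psi> (evw v * x)) t"
proof -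
  have "tapp \<phi> \<psi> (tens u v * Poly_Mapping.single p c)
      = tapp (\<lambda>x. \<phi> (evw u * x)) (\<lambda>x. \<psi> (evw v * x)) (Poly_Mapping.single p c)" for p c
    by (cases p) (simp add: tens_def mult_single tapp_def)
  then show ?thesis
    by (subst (1 2) sum_monomials[of t, symmetric]) (simp only: sum_distrib_left tapp_sum)
qed

lemma tapp_coprod:
  assumes "set w \<subseteq> gens_ge N"
  shows "tapp \<phi> \<psi> (prod_list (map coprod_gen w)) = conv \<phi> \<psi> w"
  using assms
proof (induction w arbitrary: \<phi> \<psi>)
  case Nil
  then show ?case by (simp add: tapp_def one_poly_mapping.rep_eq flip: single_one)
next
  case (Cons g w)
  then show ?case
    by (cases g) (auto simp: gens_ge_def distrib_right tapp_add tapp_tens_mult)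
qed

lemma tapp_coprod_op:
  assumes "set w \<subseteq> gens_le N"
  shows "tapp \<psi> \<phi> (prod_list (map coprod_gen w)) = conv \<phi> \<psi> w"
  using assms
proof (induction w arbitrary: \<phi> \<psi>)
  case Nil
  then show ?case by (simp add: tapp_def one_poly_mapping.rep_eq flip: single_one)
next
  case (Cons g w)
  then show ?case
    by (cases g) (auto simp: gens_le_def distrib_right tapp_add tapp_tens_mult)
qed

lemma ev_word:
  assumes "set w \<subseteq> gens N"
  shows "Poly_Mapping.single (Word w) 1 \<in> FA" "ev (Poly_Mapping.single (Word w) 1) = evw w"
proof -
  have "Poly_Mapping.single (Word w) 1 \<in> FA \<and> ev (Poly_Mapping.single (Word w) 1) = evw w"
    using assms
  proof (induction w)
    case Nil
    have "Poly_Mapping.single (Word []) 1 = (1 :: falg)"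
      by (metis single_one zero_uword_def)
    then show ?case by simp
  next
    case (Cons g w)
    have "Poly_Mapping.single (Word (g # w)) 1 = var g * Poly_Mapping.single (Word w) 1"
      by (simp add: var_def mult_single plus_uword_def)
    then show ?case using Cons by (simp add: evw_Cons)
  qed
  then show "Poly_Mapping.single (Word w) 1 \<in> FA" "ev (Poly_Mapping.single (Word w) 1) = evw w"
    by auto
qed

lemma coprod_word:
  "coprod (Poly_Mapping.single (Word w) 1) = prod_list (map coprod_gen w)"
  by (simp add: coprod_def free_ext_single)

text \<open>Ensures that the classes occurring in \<open>tens_apply\<close> come from words in the
  generators, so that each is \<open>Rep_uq\<close> of some \<open>evw\<close>.\<close>

lemma keys_coprod:
  assumes "set w \<subseteq> gens N" "p \<in> Poly_Mapping.keys (prod_list (map coprod_gen w))"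
  shows "set (letters (fst p)) \<subseteq> gens N \<and> set (letters (snd p)) \<subseteq> gens N"
  using assms
proof (induction w arbitrary: p)
  case Nil
  then show ?case by (auto simp flip: single_one split: if_splits)
next
  case (Cons g w)
  have "p \<in> Poly_Mapping.keys (coprod_gen g * prod_list (map coprod_gen w))" using Cons.prems by simp
  then obtain a b where p: "p = a + b" "a \<in> Poly_Mapping.keys (coprod_gen g)"
    "b \<in> Poly_Mapping.keys (prod_list (map coprod_gen w))" using keys_mult by blast
  have g: "g \<in> gens N" using Cons.prems by simp
  have "set (letters (fst a)) \<subseteq> gens N \<and> set (letters (snd a)) \<subseteq> gens N"
    using p(2) g
    by (cases g) (auto simp: tens_def gens_ge_def gens_le_def dest!: subsetD[OF Poly_Mapping.keys_add]
        split: if_splits)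
  then show ?case using Cons.IH[OF _ p(3)] Cons.prems p(1) by simp
qed

lemma tens_apply_coprod:
  assumes "set w \<subseteq> gens N"
  shows "tens_apply N Q (\<lambda>u v. f u * h v) (coprod (Poly_Mapping.single (Word w) 1))
    = tapp (\<lambda>x. f (Rep_uq x)) (\<lambda>x. h (Rep_uq x)) (prod_list (map coprod_gen w))"
  unfolding tens_apply_def tapp_def coprod_word case_prod_unfold
proof (rule sum.cong[OF refl])
  fix p assume "p \<in> Poly_Mapping.keys (prod_list (map coprod_gen w))"
  then have *: "set (letters (fst p)) \<subseteq> gens N" "set (letters (snd p)) \<subseteq> gens N"
    using keys_coprod[OF assms] by blast+
  have "Rep_uq (evw (letters u)) = cls N Q (Poly_Mapping.single u 1)" if "set (letters u) \<subseteq> gens N" for u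
    using ev_word[OF that] by (metis Rep_ev uword.collapse)
  then show "Poly_Mapping.lookup (prod_list (map coprod_gen w)) (fst p, snd p) *
      (f (cls N Q (Poly_Mapping.single (fst p) 1)) * h (cls N Q (Poly_Mapping.single (snd p) 1))) =
      Poly_Mapping.lookup (prod_list (map coprod_gen w)) p *
      (f (Rep_uq (evw (letters (fst p)))) * h (Rep_uq (evw (letters (snd p)))))"
    using * by simp
qed

section \<open>Subalgebras\<close>

text \<open>Scalar multiples are a closure rule here, whereas \<open>subalg\<close> has the scalars
  among its generators. In return every induction has one case for linearity in the scalar, and
  negatives come for free.\<close>

inductive_set alg :: "uq set \<Rightarrow> uq set" for S where
  one: "1 \<in> alg S"
| gen: "x \<in> S \<Longrightarrow> x \<in> alg S"
| add: "x \<in> alg S \<Longrightarrow> y \<in> alg S \<Longrightarrow> x + y \<in> alg S"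
| mult: "x \<in> alg S \<Longrightarrow> y \<in> alg S \<Longrightarrow> x * y \<in> alg S"
| sc: "x \<in> alg S \<Longrightarrow> c *c x \<in> alg S"

lemmas alg_closed [simp, intro] = alg.one alg.add alg.mult alg.sc

lemma alg_zero [simp, intro]: "0 \<in> alg S"
  using alg.sc[OF alg.one, of 0] by simp

lemma alg_minus [simp, intro]: "x \<in> alg S \<Longrightarrow> - x \<in> alg S"
  using alg.sc[of x S "- 1"] by simp

lemma alg_diff [simp, intro]: "x \<in> alg S \<Longrightarrow> y \<in> alg S \<Longrightarrow> x - y \<in> alg S"
  using alg.add[of x S "- y"] by simp

lemma alg_br [simp, intro]: "x \<in> alg S \<Longrightarrow> y \<in> alg S \<Longrightarrow> br p x y \<in> alg S"
  by (simp add: br_def)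

lemma alg_mono:
  assumes "S \<subseteq> alg S'"
  shows "alg S \<subseteq> alg S'"
proof
  fix x assume "x \<in> alg S"
  then show "x \<in> alg S'" by induction (use assms in auto)
qed

definition genF :: "uq set" where "genF = gF ` I"
definition genE :: "uq set" where "genE = gE ` I"
definition genK :: "uq set" where "genK = gK ` I \<union> gL ` I"

definition Um :: "uq set" where "Um = alg genF"
definition Up :: "uq set" where "Up = alg genE"
definition Ule :: "uq set" where "Ule = alg (genF \<union> genK)"
definition Uge :: "uq set" where "Uge = alg (genE \<union> genK)"

lemma U_closed [simp, intro]:
  "1 \<in> Ule" "0 \<in> Ule" "x \<in> Ule \<Longrightarrow> y \<in> Ule \<Longrightarrow> x + y \<in> Ule" "x \<in> Ule \<Longrightarrow> y \<in> Ule \<Longrightarrow> x - y \<in> Ule"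
  "x \<in> Ule \<Longrightarrow> y \<in> Ule \<Longrightarrow> x * y \<in> Ule" "x \<in> Ule \<Longrightarrow> - x \<in> Ule" "x \<in> Ule \<Longrightarrow> c *c x \<in> Ule"
  "1 \<in> Uge" "0 \<in> Uge" "x \<in> Uge \<Longrightarrow> y \<in> Uge \<Longrightarrow> x + y \<in> Uge" "x \<in> Uge \<Longrightarrow> y \<in> Uge \<Longrightarrow> x - y \<in> Uge"
  "x \<in> Uge \<Longrightarrow> y \<in> Uge \<Longrightarrow> x * y \<in> Uge" "x \<in> Uge \<Longrightarrow> - x \<in> Uge" "x \<in> Uge \<Longrightarrow> c *c x \<in> Uge"
  "1 \<in> Um" "0 \<in> Um" "x \<in> Um \<Longrightarrow> y \<in> Um \<Longrightarrow> x + y \<in> Um" "x \<in> Um \<Longrightarrow> y \<in> Um \<Longrightarrow> x - y \<in> Um"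
  "x \<in> Um \<Longrightarrow> y \<in> Um \<Longrightarrow> x * y \<in> Um" "x \<in> Um \<Longrightarrow> - x \<in> Um" "x \<in> Um \<Longrightarrow> c *c x \<in> Um"
  "1 \<in> Up" "0 \<in> Up" "x \<in> Up \<Longrightarrow> y \<in> Up \<Longrightarrow> x + y \<in> Up" "x \<in> Up \<Longrightarrow> y \<in> Up \<Longrightarrow> x - y \<in> Up"
  "x \<in> Up \<Longrightarrow> y \<in> Up \<Longrightarrow> x * y \<in> Up" "x \<in> Up \<Longrightarrow> - x \<in> Up" "x \<in> Up \<Longrightarrow> c *c x \<in> Up"
  "x \<in> Um \<Longrightarrow> y \<in> Um \<Longrightarrow> br p x y \<in> Um" "x \<in> Up \<Longrightarrow> y \<in> Up \<Longrightarrow> br p x y \<in> Up"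
  by (simp_all add: Ule_def Uge_def Um_def Up_def)

lemma U_gens [simp, intro]:
  "a \<in> I \<Longrightarrow> gF a \<in> Um" "a \<in> I \<Longrightarrow> gE a \<in> Up" "a \<in> I \<Longrightarrow> gK a \<in> Ule" "a \<in> I \<Longrightarrow> gL a \<in> Ule"
  "a \<in> I \<Longrightarrow> gK a \<in> Uge" "a \<in> I \<Longrightarrow> gL a \<in> Uge"
  "a \<in> I \<Longrightarrow> gE a \<in> Uge" "a \<in> I \<Longrightarrow> gF a \<in> Ule"
  by (auto simp: Ule_def Uge_def Um_def Up_def genE_def genF_def genK_def intro!: alg.gen)

lemma Um_Ule [simp, intro]: "x \<in> Um \<Longrightarrow> x \<in> Ule" and Up_Uge [simp, intro]: "x \<in> Up \<Longrightarrow> x \<in> Uge"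
  using alg_mono[of genF "genF \<union> genK"] alg_mono[of genE "genE \<union> genK"]
  by (auto simp: Ule_def Uge_def Um_def Up_def intro: alg.gen)

lemma Rep_ops:
  "Rep_uq 0 = \<zero>\<^bsub>Uq N Q\<^esub>" "Rep_uq 1 = \<one>\<^bsub>Uq N Q\<^esub>"
  "Rep_uq (x + y) = Rep_uq x \<oplus>\<^bsub>Uq N Q\<^esub> Rep_uq y" "Rep_uq (x - y) = Rep_uq x \<ominus>\<^bsub>Uq N Q\<^esub> Rep_uq y"
  "Rep_uq (x * y) = Rep_uq x \<otimes>\<^bsub>Uq N Q\<^esub> Rep_uq y" "Rep_uq (- x) = \<ominus>\<^bsub>Uq N Q\<^esub> Rep_uq x"
  "Rep_uq (c *c x) = scal N Q c (Rep_uq x)"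
proof -
  interpret U: ring "Uq N Q" by (rule ring_Uq)
  obtain f g where fg: "f \<in> FA" "x = ev f" "g \<in> FA" "y = ev g" using ev_cases by metis
  show "Rep_uq (x + y) = Rep_uq x \<oplus>\<^bsub>Uq N Q\<^esub> Rep_uq y" "Rep_uq (x - y) = Rep_uq x \<ominus>\<^bsub>Uq N Q\<^esub> Rep_uq y"
    "Rep_uq (x * y) = Rep_uq x \<otimes>\<^bsub>Uq N Q\<^esub> Rep_uq y" "Rep_uq (- x) = \<ominus>\<^bsub>Uq N Q\<^esub> Rep_uq x"
    "Rep_uq (c *c x) = scal N Q c (Rep_uq x)"
    using fg by (simp_all add: ev_ops cls_simps scal_def del: ev_simps)
  show "Rep_uq 1 = \<one>\<^bsub>Uq N Q\<^esub>" by (simp add: one_uq_def cls_one del: ev_const)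
  have "cls N Q (0 - 0) = cls N Q 0 \<ominus>\<^bsub>Uq N Q\<^esub> cls N Q 0" by (rule cls_simps) auto
  also have "\<dots> = \<zero>\<^bsub>Uq N Q\<^esub>"
    using cls_in[of 0] by (simp add: U.minus_eq U.r_neg)
  finally show "Rep_uq 0 = \<zero>\<^bsub>Uq N Q\<^esub>" by (simp add: zero_uq_def del: ev_const)
qed

lemma Rep_subalg: "subalg N Q (Rep_uq ` S) = Rep_uq ` alg S"
proof
  interpret U: ring "Uq N Q" by (rule ring_Uq)
  have c: "cls N Q (const c) = Rep_uq (c *c 1)" for c
    using Rep_ev[of "const c"] by simp
  show "subalg N Q (Rep_uq ` S) \<subseteq> Rep_uq ` alg S"
  proof
    fix x assume "x \<in> subalg N Q (Rep_uq ` S)"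
    then show "x \<in> Rep_uq ` alg S" unfolding subalg_def
    proof induction
      case one
      then show ?case by (auto simp flip: Rep_ops(2))
    next
      case (incl h)
      then show ?case by (auto simp: c intro: alg.gen)
    next
      case (a_inv h)
      then show ?case by (auto simp flip: Rep_ops)
    next
      case (eng_add h1 h2)
      then show ?case by (auto simp flip: Rep_ops)
    next
      case (eng_mult h1 h2)
      then show ?case by (auto simp flip: Rep_ops)
    qed
  qed
  have "Rep_uq x \<in> subalg N Q (Rep_uq ` S)" if "x \<in> alg S" for x
    using that
  proof induction
    case (sc x k)
    have "cls N Q (const k) \<in> subalg N Q (Rep_uq ` S)"
      unfolding subalg_def by (rule generate_ring.incl) simp
    then show ?case using sc unfolding subalg_def
      by (simp add: Rep_ops scal_def generate_ring.eng_mult)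
  qed (auto simp: subalg_def Rep_ops intro: generate_ring.intros)
  then show "Rep_uq ` alg S \<subseteq> subalg N Q (Rep_uq ` S)" by blast
qed

lemma Rep_gens:
  "a \<in> I \<Longrightarrow> Rep_uq (gE a) = E N Q a" "a \<in> I \<Longrightarrow> Rep_uq (gF a) = F N Q a"
  "a \<in> I \<Longrightarrow> Rep_uq (gK a) = K N Q a" "a \<in> I \<Longrightarrow> Rep_uq (gL a) = Kinv N Q a"
  by (simp_all add: gE_def gF_def gK_def gL_def E_def F_def K_def Kinv_def)

lemma U_le_eq: "U_le N Q = Rep_uq ` Ule" and U_ge_eq: "U_ge N Q = Rep_uq ` Uge"
proof -
  have "F N Q ` simple_roots N \<union> K N Q ` simple_roots N \<union> Kinv N Q ` simple_roots N
      = Rep_uq ` (genF \<union> genK)"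
    "E N Q ` simple_roots N \<union> K N Q ` simple_roots N \<union> Kinv N Q ` simple_roots N
      = Rep_uq ` (genE \<union> genK)"
    by (auto simp: genF_def genE_def genK_def image_Un image_image Rep_gens I_def[symmetric]
      cong: image_cong)
  then show "U_le N Q = Rep_uq ` Ule" "U_ge N Q = Rep_uq ` Uge"
    unfolding U_le_def U_ge_def Ule_def Uge_def by (simp_all only: Rep_subalg)
qed

lemma ev_free_on:
  assumes "G \<subseteq> gens N" "x \<in> alg ((\<lambda>g. ev (var g)) ` G)"
  shows "\<exists>f\<in>free_on G. x = ev f"
  using assms(2)
proof induction
  case one
  show ?case by (intro bexI[of _ 1]) auto
next
  case (gen x)
  then show ?case by auto
next
  case (add x y)
  then obtain f g where "f \<in> free_on G" "g \<in> free_on G" "x = ev f" "y = ev g" by blast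
  then show ?case using free_on_mono[OF assms(1), THEN subsetD] by (intro bexI[of _ "f + g"]) auto
next
  case (mult x y)
  then obtain f g where "f \<in> free_on G" "g \<in> free_on G" "x = ev f" "y = ev g" by blast
  then show ?case using free_on_mono[OF assms(1), THEN subsetD] by (intro bexI[of _ "f * g"]) auto
next
  case (sc x c)
  then obtain f where "f \<in> free_on G" "x = ev f" by blast
  then show ?case using free_on_mono[OF assms(1), THEN subsetD] by (intro bexI[of _ "const c * f"]) auto
qed

lemma gens_images:
  "genF \<union> genK = (\<lambda>g. ev (var g)) ` gens_le N" "genE \<union> genK = (\<lambda>g. ev (var g)) ` gens_ge N"
  by (simp_all add: genF_def genE_def genK_def gens_le_def gens_ge_def image_Un image_image
      gE_def[abs_def] gF_def[abs_def] gK_def[abs_def] gL_def[abs_def] I_def Un_assoc)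

lemma evw_in:
  "set w \<subseteq> gens_le N \<Longrightarrow> evw w \<in> Ule" "set w \<subseteq> gens_ge N \<Longrightarrow> evw w \<in> Uge"
proof -
  have *: "evw w \<in> alg ((\<lambda>g. ev (var g)) ` G)" if "set w \<subseteq> G" for G
    using that by (induction w) (auto simp: evw_Cons intro!: alg.mult intro: alg.gen)
  show "set w \<subseteq> gens_le N \<Longrightarrow> evw w \<in> Ule" "set w \<subseteq> gens_ge N \<Longrightarrow> evw w \<in> Uge"
    using * by (simp_all add: Ule_def Uge_def gens_images)
qed

definition linear_on :: "uq set \<Rightarrow> (uq \<Rightarrow> complex) \<Rightarrow> bool" where
  "linear_on S \<phi> \<longleftrightarrow> (\<forall>x\<in>S. \<forall>y\<in>S. \<phi> (x + y) = \<phi> x + \<phi> y) \<and> (\<forall>c. \<forall>x\<in>S. \<phi> (c *c x) = c * \<phi> x)"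

text \<open>The coproduct conditions on the form become usable equations at words; linearity carries
  them to the whole subalgebra. The element is lifted to the free algebra and its monomials are
  added one at a time.\<close>

lemma linear_on_words:
  assumes G: "G \<subseteq> gens N" and S: "S = alg ((\<lambda>g. ev (var g)) ` G)"
    and lin: "linear_on S \<phi>" "linear_on S \<psi>"
    and words: "\<And>w. set w \<subseteq> G \<Longrightarrow> \<phi> (evw w) = \<psi> (evw w)"
    and x: "x \<in> S"
  shows "\<phi> x = \<psi> x"
proof -
  obtain f where f: "f \<in> free_on G" "x = ev f" using ev_free_on[OF G] x S by blast
  have wS: "evw w \<in> S" if "set w \<subseteq> G" for w
    using that unfolding S by (induction w) (auto simp: evw_Cons intro!: alg.mult intro: alg.gen)
  let ?m = "\<lambda>w. Poly_Mapping.single w (Poly_Mapping.lookup f w)"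
  have m: "?m w \<in> FA \<and> ev (?m w) = Poly_Mapping.lookup f w *c evw (letters w)"
    if "w \<in> Poly_Mapping.keys f" for w
  proof -
    have w: "set (letters w) \<subseteq> gens N" using that f(1) G by (auto simp: free_on_def)
    have "?m w = const (Poly_Mapping.lookup f w) * Poly_Mapping.single (Word (letters w)) 1"
      by (simp add: const_mult_single)
    then show ?thesis using ev_word[OF w] by simp
  qed
  have "sum ?m A \<in> FA \<and> ev (sum ?m A) \<in> S \<and> \<phi> (ev (sum ?m A)) = \<psi> (ev (sum ?m A))"
    if "finite A" "A \<subseteq> Poly_Mapping.keys f" for A
    using that
  proof (induction A rule: finite_induct)
    case empty
    \<comment> \<open>\<open>linear_on\<close> has no clause for 0, so the value at 0 is obtained as
      the value at \<open>0 *c 1\<close>.\<close>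
    have "1 \<in> S" by (simp add: S)
    then have "\<phi> (0 *c 1) = 0" "\<psi> (0 *c 1) = 0"
      using lin unfolding linear_on_def by (metis mult_zero_left)+
    then show ?case by (simp add: S)
  next
    case (insert w A)
    have "set (letters w) \<subseteq> G" using insert.prems f(1) by (auto simp: free_on_def)
    then have "ev (?m w) \<in> S" "\<phi> (ev (?m w)) = \<psi> (ev (?m w))"
      using m[of w] insert.prems wS[of "letters w"] words[of "letters w"] lin
      by (auto simp: S linear_on_def)
    then show ?case using insert m[of w] lin by (auto simp: S linear_on_def)
  qed
  from this[of "Poly_Mapping.keys f"] show ?thesis by (simp add: f(2) sum_monomials)
qed

section \<open>The q-Killing form\<close>

locale killing =
  fixes J :: "uq_elem \<Rightarrow> uq_elem \<Rightarrow> complex"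
  assumes J: "q_Killing_form N Q J"
begin

definition j :: "uq \<Rightarrow> uq \<Rightarrow> complex" where "j y x = J (Rep_uq y) (Rep_uq x)"

lemma j_linear [simp]:
  assumes "y \<in> Ule" "x \<in> Uge"
  shows "y' \<in> Ule \<Longrightarrow> j (y + y') x = j y x + j y' x" "x' \<in> Uge \<Longrightarrow> j y (x + x') = j y x + j y x'"
    "j (c *c y) x = c * j y x" "j y (c *c x) = c * j y x"
  using J assms unfolding q_Killing_form_def bilinear_pairing_def U_le_eq U_ge_eq
  by (auto simp: j_def Rep_ops)

lemma j_linear' [simp]:
  assumes "y \<in> Ule" "x \<in> Uge"
  shows "j (- y) x = - j y x" "j y (- x) = - j y x" "j 0 x = 0" "j y 0 = 0"
    "y' \<in> Ule \<Longrightarrow> j (y - y') x = j y x - j y' x" "x' \<in> Uge \<Longrightarrow> j y (x - x') = j y x - j y x'"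
proof -
  have m: "j (- y) x = - j y x" "j y (- x) = - j y x" if "y \<in> Ule" "x \<in> Uge" for x y
    using j_linear(3)[of y x "- 1"] j_linear(4)[of y x "- 1"] that by simp_all
  show "j (- y) x = - j y x" "j y (- x) = - j y x" by (rule m; fact)+
  show "j 0 x = 0" "j y 0 = 0"
    using j_linear(3)[of y x 0] j_linear(4)[of y x 0] assms by simp_all
  show "y' \<in> Ule \<Longrightarrow> j (y - y') x = j y x - j y' x" "x' \<in> Uge \<Longrightarrow> j y (x - x') = j y x - j y x'"
    using assms j_linear(1)[of y x "- y'"] j_linear(2)[of y x "- x'"] m by simp_all
qed

lemma j_mult_left:
  assumes "y \<in> Ule" "y' \<in> Ule" "set w \<subseteq> gens_ge N"
  shows "j (y * y') (evw w) = conv (j y) (j y') w"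
proof -
  let ?f = "Poly_Mapping.single (Word w) 1 :: falg"
  have "?f \<in> free_on (gens_ge N)" using assms(3) by (simp add: free_on_def)
  then have "J (Rep_uq y \<otimes>\<^bsub>Uq N Q\<^esub> Rep_uq y') (cls N Q ?f)
      = tens_apply N Q (\<lambda>u v. J (Rep_uq y) u * J (Rep_uq y') v) (coprod ?f)"
    using J assms unfolding q_Killing_form_def U_le_eq by auto
  moreover have "cls N Q ?f = Rep_uq (evw w)" using ev_word[of w] assms(3) by (metis Rep_ev le_supI2)
  ultimately show ?thesis using assms(3)
    by (simp add: j_def[abs_def] Rep_ops tens_apply_coprod le_supI2 tapp_coprod)
qed

text \<open>The defining condition pairs the first coproduct factor with x'; the opposite coproduct
  in \<open>conv\<close> restores the order x, x'.\<close>

lemma j_mult_right: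
  assumes "x \<in> Uge" "x' \<in> Uge" "set w \<subseteq> gens_le N"
  shows "j (evw w) (x * x') = conv (\<lambda>y. j y x) (\<lambda>y. j y x') w"
proof -
  let ?f = "Poly_Mapping.single (Word w) 1 :: falg"
  have "?f \<in> free_on (gens_le N)" using assms(3) by (simp add: free_on_def)
  then have "J (cls N Q ?f) (Rep_uq x \<otimes>\<^bsub>Uq N Q\<^esub> Rep_uq x')
      = tens_apply N Q (\<lambda>u v. J u (Rep_uq x') * J v (Rep_uq x)) (coprod ?f)"
    using J assms unfolding q_Killing_form_def U_ge_eq by auto
  moreover have "cls N Q ?f = Rep_uq (evw w)" using ev_word[of w] assms(3) by (metis Rep_ev le_supI1)
  ultimately show ?thesis using assms(3)
    by (simp add: j_def[abs_def] Rep_ops tens_apply_coprod[where f = "\<lambda>u. J u _" and h = "\<lambda>u. J u _"]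
        le_supI1 tapp_coprod_op)
qed

text \<open>The fixed factors z and z' are the letters placed around a word; their effect is
  computed by \<open>conv\<close> at the front and by \<open>conv_snoc\<close> at the end.\<close>

lemma j_ext_right:
  assumes "y \<in> Ule" "y' \<in> Ule" "z \<in> Uge" "z' \<in> Uge"
    and "\<And>w. set w \<subseteq> gens_ge N \<Longrightarrow> j y (z * evw w * z') = j y' (evw w)" and "x \<in> Uge"
  shows "j y (z * x * z') = j y' x"
  by (rule linear_on_words[of "gens_ge N" Uge])
    (use assms in \<open>auto simp: Uge_def[symmetric] gens_images[symmetric] linear_on_def distrib_left distrib_right\<close>)

lemma j_ext_left:
  assumes "x \<in> Uge" "x' \<in> Uge" "z \<in> Ule" "z' \<in> Ule"
    and "\<And>w. set w \<subseteq> gens_le N \<Longrightarrow> j (z * evw w * z') x = j (evw w) x'" and "y \<in> Ule"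
  shows "j (z * y * z') x = j y x'"
  by (rule linear_on_words[of "gens_le N" Ule])
    (use assms in \<open>auto simp: Ule_def[symmetric] gens_images[symmetric] linear_on_def distrib_left distrib_right\<close>)

end

context
  fixes a b :: int
  assumes ab: "a \<in> I" "b \<in> I"
begin

lemma KE: "gK a * gE b = (Q powi root_form a b) *c (gE b * gK a)"
proof -
  have "gK a * gE b * gL a * gK a = (Q powi root_form a b) *c gE b * gK a" by (simp only: KEL[OF ab])
  then show ?thesis using ab by (simp add: mult.assoc)
qed

lemma KF: "gK a * gF b = (Q powi (- root_form a b)) *c (gF b * gK a)"
proof -
  have "gK a * gF b * gL a * gK a = (Q powi (- root_form a b)) *c gF b * gK a" by (simp only: KFL[OF ab])
  then show ?thesis using ab by (simp add: mult.assoc)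
qed

lemma LF: "gL a * gF b = (Q powi root_form a b) *c (gF b * gL a)"
proof -
  have "gL a * (gK a * gF b) * gL a = (Q powi (- root_form a b)) *c (gL a * gF b * gK a * gL a)"
    by (simp add: KF mult.assoc)
  then have "gF b * gL a = (Q powi (- root_form a b)) *c (gL a * gF b)"
    using ab by (simp add: mult.assoc[symmetric]) (simp add: mult.assoc)
  then show ?thesis using Q(1) by (simp flip: power_int_add)
qed

end

context killing
begin

lemma j_zero [simp]: "x \<in> Uge \<Longrightarrow> j 0 x = 0" "y \<in> Ule \<Longrightarrow> j y 0 = 0"
  by (rule j_linear'[of 1 x], auto) (rule j_linear'[of y 1], auto)

section \<open>Values of the form on generators and its behaviour under the torus\<close>

lemma finite_simple_roots: "finite (simple_roots n)"
  by (simp add: simple_roots_def)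

lemma lattice_form_single:
  assumes "a \<in> I" "b \<in> I"
  shows "lattice_form N (\<lambda>i. if i = a then c else 0) (\<lambda>i. if i = b then d else 0) = c * d * root_form a b"
proof -
  have "(\<Sum>\<gamma>\<in>I. (if \<alpha> = a then c else 0) * (if \<gamma> = b then d else 0) * root_form \<alpha> \<gamma>)
      = (if \<alpha> = a then c * d * root_form a b else 0)" for \<alpha>
    using assms(2) finite_simple_roots[of N]
      by (cases "\<alpha> = a") (auto simp: I_def if_distrib if_distribR cong: if_cong)
  then show ?thesis using assms(1)
    by (simp add: lattice_form_def I_def[symmetric]) (simp add: I_def finite_simple_roots)
qed

lemma K_lat_single:
  assumes "a \<in> I"
  shows "K_lat N Q (\<lambda>i. if i = a then c else 0) = cls N Q (fK_pow a c)"
proof -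
  have "prod_list (map (\<lambda>i. fK_pow i (if i = a then c else 0)) xs)
      = (if a \<in> set xs then fK_pow a c else 1)" if "distinct xs" for xs
    using that by (induction xs) (auto simp: fK_pow_def)
  moreover have "a \<in> set (sorted_list_of_set (simple_roots N))"
    using assms set_sorted_list_of_set[of "simple_roots N"] by (simp add: I_def finite_simple_roots)
  ultimately show ?thesis by (simp add: K_lat_def)
qed

lemma j_KK:
  assumes "a \<in> I" "b \<in> I"
  shows "j (ev (fK_pow a c)) (ev (fK_pow b d)) = Q powi (- (c * d * root_form a b))"
proof -
  have *: "fK_pow i e \<in> FA" if "i \<in> I" for i e
  proof -
    have "x ^ k \<in> FA" if "x \<in> FA" for x k using that by (induction k) auto
    then show ?thesis using that by (auto simp: fK_pow_def)
  qed
  have "J (K_lat N Q (\<lambda>i. if i = a then c else 0)) (K_lat N Q (\<lambda>i. if i = b then d else 0))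
      = Q powi (- (c * d * root_form a b))"
    using J lattice_form_single[OF assms] unfolding q_Killing_form_def by metis
  then show ?thesis using assms * by (simp add: j_def K_lat_single)
qed

lemma fK_pow_simps [simp]: "ev (fK_pow a 0) = 1" "ev (fK_pow a 1) = gK a" "ev (fK_pow a (- 1)) = gL a"
  by (simp_all add: fK_pow_def gK_def gL_def)

lemma j_grouplike [simp]:
  assumes "a \<in> I"
  shows "j 1 1 = 1" "j 1 (gK a) = 1" "j 1 (gL a) = 1" "j (gK a) 1 = 1" "j (gL a) 1 = 1"
    "b \<in> I \<Longrightarrow> j (gL a) (gL b) = Q powi (- root_form a b)"
  using j_KK[OF assms assms, of 0 0] j_KK[OF assms assms, of 0 1] j_KK[OF assms assms, of 0 "- 1"]
    j_KK[OF assms assms, of 1 0] j_KK[OF assms assms, of "- 1" 0] j_KK[OF assms, of b "- 1" "- 1"]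
  by simp_all

lemma J_lat:
  assumes "a \<in> I"
  shows "J (K_lat N Q \<xi>) (E N Q a) = 0" "J (F N Q a) (K_lat N Q \<xi>) = 0"
  using J assms unfolding q_Killing_form_def I_def by blast+

lemma j_gens [simp]:
  assumes "a \<in> I"
  shows "b \<in> I \<Longrightarrow> j (gF a) (gE b) = (if a = b then - (1 / gam) else 0)"
    "j 1 (gE a) = 0" "b \<in> I \<Longrightarrow> j (gK b) (gE a) = 0" "b \<in> I \<Longrightarrow> j (gL b) (gE a) = 0"
    "j (gF a) 1 = 0" "b \<in> I \<Longrightarrow> j (gF a) (gK b) = 0" "b \<in> I \<Longrightarrow> j (gF a) (gL b) = 0"
proof -
  have *: "K_lat N Q (\<lambda>i. if i = b then c else 0) = Rep_uq (ev (fK_pow b c))" if "b \<in> I" for b c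
  proof -
    have "x ^ k \<in> FA" if "x \<in> FA" for x k using that by (induction k) auto
    then show ?thesis using that by (auto simp: fK_pow_def K_lat_single)
  qed
  show "b \<in> I \<Longrightarrow> j (gF a) (gE b) = (if a = b then - (1 / gam) else 0)"
    using J assms unfolding q_Killing_form_def
    by (simp add: j_def Rep_gens I_def[symmetric] gam_def inverse_eq_divide)
  show "j 1 (gE a) = 0" "b \<in> I \<Longrightarrow> j (gK b) (gE a) = 0" "b \<in> I \<Longrightarrow> j (gL b) (gE a) = 0"
    "j (gF a) 1 = 0" "b \<in> I \<Longrightarrow> j (gF a) (gK b) = 0" "b \<in> I \<Longrightarrow> j (gF a) (gL b) = 0"
    using J_lat[OF assms, of "\<lambda>i. if i = _ then _ else 0", unfolded *]
      *[of b 0] *[of b 1] *[of b "- 1"] *[OF assms, of 0] assms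
      J_lat[OF assms, of "\<lambda>i. if i = b then 1 else 0"] J_lat[OF assms, of "\<lambda>i. if i = b then - 1 else 0"]
      J_lat[OF assms, of "\<lambda>i. if i = a then 0 else 0"]
    by (simp_all add: j_def Rep_gens)
qed

lemma word_gens:
  assumes "a \<in> I"
  shows "set [GF a] \<subseteq> gens_le N" "set [GK a] \<subseteq> gens_le N" "set [GKinv a] \<subseteq> gens_le N"
    "set [GE a] \<subseteq> gens_ge N" "set [GK a] \<subseteq> gens_ge N" "set [GKinv a] \<subseteq> gens_ge N"
  using assms by (auto simp: I_def gens_le_def gens_ge_def)

lemma j_F_mult:
  assumes "x \<in> Uge" "x' \<in> Uge" "a \<in> I"
  shows "j (gF a) (x * x') = j (gF a) x * j 1 x' + j (gL a) x * j (gF a) x'"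
  using j_mult_right[OF assms(1,2) word_gens(1)[OF assms(3)]] by simp

lemma j_group_mult:
  assumes "x \<in> Uge" "x' \<in> Uge"
  shows "j 1 (x * x') = j 1 x * j 1 x'"
    "a \<in> I \<Longrightarrow> j (gL a) (x * x') = j (gL a) x * j (gL a) x'"
  using j_mult_right[OF assms, of "[]"] j_mult_right[OF assms word_gens(3)] by simp_all

lemma j_mult_E:
  assumes "y \<in> Ule" "y' \<in> Ule" "a \<in> I"
  shows "j (y * y') (gE a) = j y (gE a) * j y' 1 + j y (gK a) * j y' (gE a)"
  using j_mult_left[OF assms(1,2) word_gens(4)[OF assms(3)]] by simp

lemma j_mult_group:
  assumes "y \<in> Ule" "y' \<in> Ule"
  shows "j (y * y') 1 = j y 1 * j y' 1"
  using j_mult_left[OF assms, of "[]"] by simp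

text \<open>For a single F this holds because K pairs to 0 with F and to 1 with 1. It passes to
  products because K is grouplike, so that \<open>conv_snoc\<close> multiplies both functionals by
  K.\<close>

lemma j_absorb_K:
  assumes "y \<in> Um" "x \<in> Uge" "a \<in> I"
  shows "j y (x * gK a) = j y x"
  using assms(1,2) unfolding Um_def
proof (induction arbitrary: x)
  case one
  then show ?case using assms(3) by (simp add: j_group_mult)
next
  case (gen y)
  then show ?case using assms(3) by (auto simp: genF_def j_F_mult)
next
  case (mult y y')
  then have U: "y \<in> Ule" "y' \<in> Ule" by (auto simp flip: Um_def)
  have "j (y * y') (1 * x * gK a) = j (y * y') x"
  proof (rule j_ext_right)
    fix w assume w: "set w \<subseteq> gens_ge N"
    then have "j (y * y') (evw (w @ [GK a])) = conv (j y) (j y') (w @ [GK a])"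
      using U assms(3) word_gens by (intro j_mult_left) auto
    also have "\<dots> = conv (j y) (j y') w" unfolding conv_snoc
      using mult.IH evw_in(2) w by (intro conv_cong[OF grouplike_closed_gens(1)]) auto
    also have "\<dots> = j (y * y') (evw w)" using U w by (intro j_mult_left[symmetric]) auto
    finally show "j (y * y') (1 * evw w * gK a) = j (y * y') (evw w)" by simp
  qed (use U assms(3) mult.prems in auto)
  then show ?case by simp
qed (use assms(3) in \<open>auto simp flip: Um_def\<close>)

lemma j_absorb_L:
  assumes "x \<in> Up" "y \<in> Ule" "a \<in> I"
  shows "j (y * gL a) x = j y x"
  using assms(1,2) unfolding Up_def
proof (induction arbitrary: y)
  case one
  then show ?case using assms(3) by (simp add: j_mult_group)
next
  case (gen x)
  then show ?case using assms(3) by (auto simp: genE_def j_mult_E)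
next
  case (mult x x')
  then have U: "x \<in> Uge" "x' \<in> Uge" by (auto simp flip: Up_def)
  have "j (1 * y * gL a) (x * x') = j y (x * x')"
  proof (rule j_ext_left)
    fix w assume w: "set w \<subseteq> gens_le N"
    then have "j (evw (w @ [GKinv a])) (x * x') = conv (\<lambda>y. j y x) (\<lambda>y. j y x') (w @ [GKinv a])"
      using U assms(3) word_gens by (intro j_mult_right) auto
    also have "\<dots> = conv (\<lambda>y. j y x) (\<lambda>y. j y x') w" unfolding conv_snoc
      using mult.IH evw_in(1) w by (intro conv_cong[OF grouplike_closed_gens(2)]) auto
    also have "\<dots> = j (evw w) (x * x')" using U w by (intro j_mult_right[symmetric]) auto
    finally show "j (1 * evw w * gL a) (x * x') = j (evw w) (x * x')" by simp
  qed (use U assms(3) mult.prems in auto)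
  then show ?case by simp
qed (use assms(3) in \<open>auto simp flip: Up_def simp: distrib_right\<close>)

text \<open>Invariance of the form under Ad(K), which accounts for the Ad in the condition on O_1.
  At a generator F_b both sides carry q^(-(a,b)); on the right it is the pairing of K_b^-1 with
  K_a^-1.\<close>

lemma j_conj:
  assumes "y \<in> Um" "x \<in> Uge" "a \<in> I"
  shows "j (gK a * y * gL a) x = j y (gL a * x * gK a)"
  using assms(1,2) unfolding Um_def
proof (induction arbitrary: x)
  case one
  then show ?case using assms(3) by (simp add: j_group_mult)
next
  case (gen y)
  then obtain b where b: "b \<in> I" "y = gF b" by (auto simp: genF_def)
  have "root_form b a = root_form a b" by (auto simp: root_form_def neighbours_def)
  then show ?case using b assms(3) gen.prems
    by (simp add: KFL j_F_mult j_group_mult j_absorb_K)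
next
  case (mult y y')
  then have U: "y \<in> Ule" "y' \<in> Ule" by (auto simp flip: Um_def)
  have K: "gK a \<in> Ule" "gL a \<in> Ule" using assms(3) by auto
  have "j (y * y') (gL a * x * gK a) = j (gK a * y * gL a * (gK a * y' * gL a)) x"
  proof (rule j_ext_right)
    fix w assume w: "set w \<subseteq> gens_ge N"
    then have "j (y * y') (evw (GKinv a # w @ [GK a])) = conv (j y) (j y') (GKinv a # w @ [GK a])"
      using U assms(3) word_gens by (intro j_mult_left) auto
    also have "\<dots> = conv (j (gK a * y * gL a)) (j (gK a * y' * gL a)) w"
      unfolding conv.simps conv_snoc using mult.IH evw_in(2) w
      by (intro conv_cong[OF grouplike_closed_gens(1)]) (auto simp: mult.assoc)
    also have "\<dots> = j (gK a * y * gL a * (gK a * y' * gL a)) (evw w)"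
      using U K w by (intro j_mult_left[symmetric]) auto
    finally show "j (y * y') (gL a * evw w * gK a)
        = j (gK a * y * gL a * (gK a * y' * gL a)) (evw w)" by (simp add: mult.assoc)
  qed (use U K assms(3) mult.prems in auto)
  moreover have "gK a * y * gL a * (gK a * y' * gL a) = gK a * (y * y') * gL a"
  proof -
    have "gL a * (gK a * z) = z" for z using assms(3) by (simp add: mult.assoc[symmetric])
    then show ?thesis by (simp add: mult.assoc)
  qed
  ultimately show ?case by simp
next
  case (add y y')
  then have "y \<in> Ule" "y' \<in> Ule" by (auto simp flip: Um_def)
  then show ?case using add assms(3) by (auto simp: distrib_left distrib_right)
next
  case (sc y c)
  then have "y \<in> Ule" by (auto simp flip: Um_def)
  then show ?case using sc assms(3) by auto
qed

section \<open>Skew derivations\<close>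

text \<open>Through this relation d is fixed only up to elements that pair to 0 with everything. It
  ranges over \<open>Ule\<close> because a factor K^-1 appears already at the generators.\<close>

definition derF :: "int \<Rightarrow> uq \<Rightarrow> uq \<Rightarrow> bool" where
  "derF c y d \<longleftrightarrow> y \<in> Um \<and> d \<in> Ule \<and> (\<forall>x\<in>Uge. j y (x * gE c) = j d x)"

definition derE :: "int \<Rightarrow> uq \<Rightarrow> uq \<Rightarrow> bool" where
  "derE c x d \<longleftrightarrow> x \<in> Up \<and> d \<in> Uge \<and> (\<forall>y\<in>Ule. j (y * gF c) x = j y d)"

text \<open>The coproduct of E_c leaves a K beside the first factor, which \<open>j_absorb_K\<close>
  removes. The rule thus looks like the ordinary Leibniz rule, and the twist survives only inside
  d.\<close>

lemma derF_mult:
  assumes c: "c \<in> I" and "derF c y d" "derF c y' d'"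
  shows "derF c (y * y') (d * y' + y * d')"
proof -
  have U: "y \<in> Um" "y' \<in> Um" "y \<in> Ule" "y' \<in> Ule" "d \<in> Ule" "d' \<in> Ule"
    and d: "\<And>x. x \<in> Uge \<Longrightarrow> j y (x * gE c) = j d x" "\<And>x. x \<in> Uge \<Longrightarrow> j y' (x * gE c) = j d' x"
    using assms(2,3) by (auto simp: derF_def)
  have "j (y * y') (1 * x * gE c) = j (d * y' + y * d') x" if x: "x \<in> Uge" for x
  proof (rule j_ext_right)
    fix w assume w: "set w \<subseteq> gens_ge N"
    then have "j (y * y') (evw (w @ [GE c])) = conv (j y) (j y') (w @ [GE c])"
      using U c word_gens by (intro j_mult_left) auto
    also have "\<dots> = conv (\<lambda>x. j y (x * gE c)) (j y') w
        + conv (\<lambda>x. j y (x * gK c)) (\<lambda>x. j y' (x * gE c)) w" by (rule conv_snoc)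
    also have "\<dots> = conv (j d) (j y') w + conv (j y) (j d') w"
      using d evw_in(2) w c U
      by (intro arg_cong2[where f = "(+)"] conv_cong[OF grouplike_closed_gens(1)])
        (auto simp: j_absorb_K)
    also have "\<dots> = j (d * y') (evw w) + j (y * d') (evw w)"
      using U w by (simp add: j_mult_left)
    finally show "j (y * y') (1 * evw w * gE c) = j (d * y' + y * d') (evw w)"
      using U evw_in(2)[OF w] by simp
  qed (use U c x in auto)
  then show ?thesis using U by (auto simp: derF_def)
qed

lemma derE_mult:
  assumes c: "c \<in> I" and "derE c x d" "derE c x' d'"
  shows "derE c (x * x') (d * x' + x * d')"
proof -
  have U: "x \<in> Up" "x' \<in> Up" "x \<in> Uge" "x' \<in> Uge" "d \<in> Uge" "d' \<in> Uge"
    and d: "\<And>y. y \<in> Ule \<Longrightarrow> j (y * gF c) x = j y d" "\<And>y. y \<in> Ule \<Longrightarrow> j (y * gF c) x' = j y d'"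
    using assms(2,3) by (auto simp: derE_def)
  have "j (1 * y * gF c) (x * x') = j y (d * x' + x * d')" if y: "y \<in> Ule" for y
  proof (rule j_ext_left)
    fix w assume w: "set w \<subseteq> gens_le N"
    then have "j (evw (w @ [GF c])) (x * x') = conv (\<lambda>y. j y x) (\<lambda>y. j y x') (w @ [GF c])"
      using U c word_gens by (intro j_mult_right) auto
    also have "\<dots> = conv (\<lambda>y. j (y * gF c) x) (\<lambda>y. j y x') w
        + conv (\<lambda>y. j (y * gL c) x) (\<lambda>y. j (y * gF c) x') w" by (rule conv_snoc)
    also have "\<dots> = conv (\<lambda>y. j y d) (\<lambda>y. j y x') w + conv (\<lambda>y. j y x) (\<lambda>y. j y d') w"
      using d evw_in(1) w c U
      by (intro arg_cong2[where f = "(+)"] conv_cong[OF grouplike_closed_gens(2)])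
        (auto simp: j_absorb_L)
    also have "\<dots> = j (evw w) (d * x') + j (evw w) (x * d')"
      using U w by (simp add: j_mult_right)
    finally show "j (1 * evw w * gF c) (x * x') = j (evw w) (d * x' + x * d')"
      using U evw_in(1)[OF w] by simp
  qed (use U c y in auto)
  then show ?thesis using U by (auto simp: derE_def)
qed

lemma derF_linear:
  assumes "c \<in> I" "derF c y d"
  shows "derF c y' d' \<Longrightarrow> derF c (y + y') (d + d')" "derF c (k *c y) (k *c d)"
  using assms by (auto simp: derF_def)

lemma derE_linear:
  assumes "c \<in> I" "derE c x d"
  shows "derE c x' d' \<Longrightarrow> derE c (x + x') (d + d')" "derE c (k *c x) (k *c d)"
  using assms by (auto simp: derE_def)

lemma der_gen:
  assumes "c \<in> I" "a \<in> I"
  shows "derF c (gF a) (if a = c then (- (1 / gam)) *c gL a else 0)"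
    "derE c (gE a) (if a = c then (- (1 / gam)) *c gK a else 0)"
  using assms by (auto simp: derF_def derE_def j_F_mult j_mult_E)

lemma der_one:
  assumes "c \<in> I"
  shows "derF c 1 0" "derE c 1 0"
  using assms by (auto simp: derF_def derE_def j_group_mult j_mult_group)

end

section \<open>Root vectors on the two arms of the diagram\<close>

definition ch :: "(int \<Rightarrow> uq) \<Rightarrow> int \<Rightarrow> nat \<Rightarrow> nat \<Rightarrow> uq" where
  "ch s t = chain Q (\<lambda>i. s (t * int i))"

lemma ch_simps [simp]:
  "ch s t a 0 = s (t * int a)"
  "ch s t a (Suc m) = br Q (s (t * int a)) (ch s t (Suc a) m)"
  by (simp_all add: ch_def)

text \<open>Here i counts nodes, starting next to the centre; the empty segment has root vector
  1.\<close>

definition arm_root :: "(int \<Rightarrow> uq) \<Rightarrow> int \<Rightarrow> nat \<Rightarrow> uq" where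
  "arm_root s t i = (if i = 0 then 1 else ch s t 1 (i - 1))"

text \<open>The case i = 0 is separate because \<open>br Q x 1\<close> would be (1 - Q) x.\<close>

definition attach :: "(int \<Rightarrow> uq) \<Rightarrow> int \<Rightarrow> uq \<Rightarrow> nat \<Rightarrow> uq" where
  "attach s t x i = (if i = 0 then x else br Q x (arm_root s t i))"

lemma attach_simps [simp]: "attach s t x 0 = x" "attach s t x (Suc m) = br Q x (ch s t 1 m)"
  by (simp_all add: attach_def arm_root_def)

lemma arm_I:
  assumes "t = 1 \<or> t = - 1"
  shows "t * int i \<in> I \<longleftrightarrow> i < N"
  using assms by (auto simp: I_iff)

lemma arm_dist:
  assumes "t = 1 \<or> t = - 1"
  shows "\<bar>t * int a - t * int b\<bar> = \<bar>int a - int b\<bar>" "\<bar>t * int a - - t * int b\<bar> = int a + int b"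
    "t * int a = t * int b \<longleftrightarrow> a = b"
  using assms by auto

text \<open>The relation \<open>D c y d\<close> says that the skew derivation at the node \<open>c\<close> maps \<open>y\<close> to \<open>d\<close>.  The
  assumptions hold both for the \<open>F\<close> with the \<open>K\<inverse>\<close> and for the \<open>E\<close> with the \<open>K\<close>.\<close>

locale arms =
  fixes s g :: "int \<Rightarrow> uq" and D :: "int \<Rightarrow> uq \<Rightarrow> uq \<Rightarrow> bool"
  assumes far: "\<And>a b. a \<in> I \<Longrightarrow> b \<in> I \<Longrightarrow> \<bar>a - b\<bar> \<ge> 2 \<Longrightarrow> s a * s b = s b * s a"
    and g_next: "\<And>a b. a \<in> I \<Longrightarrow> b \<in> I \<Longrightarrow> \<bar>a - b\<bar> = 1 \<Longrightarrow> g a * s b = (1 / Q) *c (s b * g a)"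
    and g_far: "\<And>a b. a \<in> I \<Longrightarrow> b \<in> I \<Longrightarrow> \<bar>a - b\<bar> \<ge> 2 \<Longrightarrow> g a * s b = s b * g a"
    and D_mult: "\<And>c y d y' d'. c \<in> I \<Longrightarrow> D c y d \<Longrightarrow> D c y' d' \<Longrightarrow> D c (y * y') (d * y' + y * d')"
    and D_add: "\<And>c y d y' d'. c \<in> I \<Longrightarrow> D c y d \<Longrightarrow> D c y' d' \<Longrightarrow> D c (y + y') (d + d')"
    and D_sc: "\<And>c y d k. c \<in> I \<Longrightarrow> D c y d \<Longrightarrow> D c (k *c y) (k *c d)"
    and D_gen: "\<And>a c. c \<in> I \<Longrightarrow> a \<in> I \<Longrightarrow> D c (s a) (if a = c then (- (1 / gam)) *c g a else 0)"
begin

lemma D_br: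
  assumes "c \<in> I" "D c y d" "D c y' d'"
  shows "D c (br Q y y') (d * y' + y * d' - Q *c (d' * y + y' * d))"
proof -
  have "D c (y * y' + (- Q) *c (y' * y)) (d * y' + y * d' + (- Q) *c (d' * y + y' * d))"
    by (intro D_add D_sc D_mult assms)
  then show ?thesis by (simp add: br_def)
qed

lemma ch_commute:
  assumes "t = 1 \<or> t = - 1" "\<And>i. a \<le> i \<Longrightarrow> i \<le> a + m \<Longrightarrow> z * s (t * int i) = s (t * int i) * z"
  shows "z * ch s t a m = ch s t a m * z"
  unfolding ch_def by (rule commute_chain) (use assms in auto)

text \<open>Only the first node of a segment can be removed. If others remain, the coefficient is
  -(1/gam) (1/Q - Q) = 1. At the second node, moving g past the first generator costs 1/Q, which
  cancels the Q of the bracket. Nodes further along follow by induction.\<close>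

lemma D_chain:
  assumes t: "t = 1 \<or> t = - 1"
  shows "a + m < N \<Longrightarrow> D (t * int a) (ch s t a m)
      (if m = 0 then (- (1 / gam)) *c g (t * int a) else ch s t (Suc a) (m - 1) * g (t * int a))"
    and "a + m < N \<Longrightarrow> c \<in> I \<Longrightarrow> c \<noteq> t * int a \<Longrightarrow> D c (ch s t a m) 0"
proof (induction m arbitrary: a c)
  case 0
  {
    case 1
    then show ?case using D_gen[of "t * int a" "t * int a"] by (simp add: arm_I[OF t])
  next
    case 2
    then show ?case using D_gen[of c "t * int a"] by (simp add: arm_I[OF t])
  }
next
  case (Suc m)
  {
    case 1
    have a: "t * int a \<in> I" using 1 by (simp add: arm_I[OF t])
    let ?g = "g (t * int a)" and ?r = "ch s t (Suc a) m"
    have r: "?g * ?r = (1 / Q) *c (?r * ?g)"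
    proof (cases m)
      case 0
      then show ?thesis using 1 arm_dist(1)[OF t, of a "Suc a"]
        by (auto simp: arm_I[OF t] simp del: of_nat_Suc intro!: g_next)
    next
      case (Suc k)
      have "?g * s (t * int (Suc a)) = (1 / Q) *c (s (t * int (Suc a)) * ?g)"
        by (rule g_next) (use 1 arm_dist(1)[OF t, of a "Suc a"] in \<open>auto simp: arm_I[OF t] simp del: of_nat_Suc\<close>)
      moreover have "?g * ch s t (Suc (Suc a)) k = ch s t (Suc (Suc a)) k * ?g"
        by (rule ch_commute[OF t], rule g_far)
          (use 1 Suc arm_dist(1)[OF t, of a] in \<open>auto simp: arm_I[OF t]\<close>)
      ultimately show ?thesis unfolding Suc ch_simps by (rule qcommute_br')
    qed
    have "D (t * int a) (s (t * int a)) ((- (1 / gam)) *c ?g)" using D_gen[OF a a] by simp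
    moreover have "D (t * int a) ?r 0"
      using Suc.IH(2)[of "Suc a" "t * int a"] a 1 t by (auto simp del: of_nat_Suc)
    ultimately have "D (t * int a) (ch s t a (Suc m))
        ((- (1 / gam)) *c ?g * ?r + s (t * int a) * 0
          - Q *c (0 * s (t * int a) + ?r * ((- (1 / gam)) *c ?g)))"
      unfolding ch_simps by (intro D_br[OF a])
    also have "(- (1 / gam)) *c ?g * ?r + s (t * int a) * 0
          - Q *c (0 * s (t * int a) + ?r * ((- (1 / gam)) *c ?g))
        = (1 / gam * (Q - 1 / Q)) *c (?r * ?g)"
      by (simp add: r diff_sc right_diff_distrib mult.commute)
    also have "\<dots> = ?r * ?g" using gam by (simp add: gam_def)
    finally show ?case by simp
  next
    case 2
    have a: "t * int a \<in> I" using 2 by (simp add: arm_I[OF t])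
    let ?r = "ch s t (Suc a) m"
    have s: "D c (s (t * int a)) 0" using D_gen[OF 2(2) a] 2(3) by simp
    show ?case
    proof (cases "c = t * int (Suc a)")
      case False
      then have "D c ?r 0" using Suc.IH(2)[of "Suc a" c] 2 by (simp del: of_nat_Suc)
      then show ?thesis using D_br[OF 2(2) s, of ?r 0] by simp
    next
      case True
      let ?d = "if m = 0 then (- (1 / gam)) *c g c else ch s t (Suc (Suc a)) (m - 1) * g c"
      have r: "D c ?r ?d" unfolding True by (rule Suc.IH(1)) (use 2 in simp)
      have g: "g c * s (t * int a) = (1 / Q) *c (s (t * int a) * g c)"
        by (rule g_next)
          (use 2 a True arm_dist(1)[OF t, of "Suc a" a] in \<open>auto simp: arm_I[OF t] simp del: of_nat_Suc\<close>)
      have "Q *c (?d * s (t * int a)) = s (t * int a) * ?d"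
      proof (cases m)
        case 0
        then show ?thesis using g Q(1) by (simp add: mult.commute)
      next
        case (Suc k)
        have "s (t * int a) * ch s t (Suc (Suc a)) k = ch s t (Suc (Suc a)) k * s (t * int a)"
          by (rule ch_commute[OF t], rule far)
            (use 2 Suc arm_dist(1)[OF t, of a] in \<open>auto simp: arm_I[OF t]\<close>)
        then show ?thesis using g Q(1) Suc by (simp add: mult.assoc) (metis mult.assoc)
      qed
      then show ?thesis using D_br[OF 2(2) s r] by simp
    qed
  }
qed

text \<open>The cancellation at the second node of a chain, with x in the role of the first
  node.\<close>

lemma D_attach:
  assumes t: "t = 1 \<or> t = - 1" and "i < N" "c \<in> I" and x: "D c x 0"
    and far: "\<And>k. 2 \<le> k \<Longrightarrow> k < N \<Longrightarrow> x * s (t * int k) = s (t * int k) * x"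
    and g: "g t * x = (1 / Q) *c (x * g t)"
  shows "D c (attach s t x i) 0"
proof (cases i)
  case 0
  then show ?thesis using x by simp
next
  case (Suc m)
  show ?thesis
  proof (cases "c = t")
    case False
    then have "D c (ch s t 1 m) 0" using D_chain(2)[OF t, of 1 m c] assms Suc by simp
    then show ?thesis using D_br[OF \<open>c \<in> I\<close> x] Suc by fastforce
  next
    case True
    let ?d = "if m = 0 then (- (1 / gam)) *c g c else ch s t 2 (m - 1) * g c"
    have two: "Suc 1 = 2" by simp
    have d: "D c (ch s t 1 m) ?d"
      unfolding True by (rule D_chain(1)[OF t, of 1 m, unfolded two of_nat_1 mult_1_right])
        (use assms Suc in simp)
    have "Q *c (?d * x) = x * ?d"
    proof (cases m)
      case 0
      then show ?thesis using g Q(1) True by (simp add: mult.commute)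
    next
      case (Suc k)
      have "x * ch s t 2 k = ch s t 2 k * x"
        by (rule ch_commute[OF t], rule far) (use assms Suc \<open>i = Suc m\<close> in auto)
      then show ?thesis using g Q(1) Suc True by (simp add: mult.assoc) (metis mult.assoc)
    qed
    then show ?thesis using D_br[OF \<open>c \<in> I\<close> x d] Suc by simp
  qed
qed

lemma attach_zero_arm:
  "attach s t (s 0) k = ch s t 0 k"
  by (cases k) simp_all

text \<open>The arm -t together with the centre is a chain starting at 0, and it serves as x in
  \<open>D_attach\<close>. For t = -1 these elements are the generators of A^- and A^+ up to
  scalars, so only the derivation at the centre can be nonzero on them.\<close>

lemma D_double_attach:
  assumes t: "t = 1 \<or> t = - 1" and ik: "i < N" "k < N" and c: "c \<in> I" "c \<noteq> 0"
  shows "D c (attach s t (attach s (- t) (s 0) k) i) 0"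
proof (cases "i = 0")
  case True
  then show ?thesis using D_chain(2)[of "- t" 0 k c] t ik c by (simp add: attach_zero_arm) auto
next
  case False
  then have tI: "t \<in> I" using arm_I[OF t, of 1] ik by simp
  have t': "- t = 1 \<or> - t = - 1" using t by auto
  show ?thesis
  proof (rule D_attach[OF t ik(1) c(1)])
    show "D c (attach s (- t) (s 0) k) 0"
      using D_chain(2)[OF t', of 0 k c] ik c by (simp add: attach_zero_arm)
    show "attach s (- t) (s 0) k * s (t * int l) = s (t * int l) * attach s (- t) (s 0) k"
      if "2 \<le> l" "l < N" for l
      unfolding attach_zero_arm
      by (rule ch_commute[OF t', symmetric], rule far)
        (use that ik t arm_dist(2)[OF t] in \<open>auto simp: I_iff\<close>)
    have 0: "g t * s 0 = (1 / Q) *c (s 0 * g t)"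
      by (rule g_next) (use tI t N in \<open>auto simp: I_iff\<close>)
    show "g t * attach s (- t) (s 0) k = (1 / Q) *c (attach s (- t) (s 0) k * g t)"
    proof (cases k)
      case (Suc m)
      have "g t * ch s (- t) 1 m = ch s (- t) 1 m * g t"
        by (rule ch_commute[OF t'], rule g_far)
          (use ik Suc t tI arm_dist(2)[OF t, of 1] in \<open>auto simp: I_iff\<close>)
      then show ?thesis using 0 Suc by (auto intro: qcommute_br')
    qed (use 0 in simp)
  qed
qed

end

context killing
begin

lemma root_form_cases:
  "\<bar>a - b\<bar> = 1 \<Longrightarrow> root_form a b = - 1" "\<bar>a - b\<bar> \<ge> 2 \<Longrightarrow> root_form a b = 0"
  by (auto simp: root_form_def neighbours_def)

sublocale AF: arms gF gL derF
  by unfold_locales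
    (auto simp: far_FF LF root_form_cases power_int_minus inverse_eq_divide
      derF_mult derF_linear der_gen)

sublocale AE: arms gE gK derE
  by unfold_locales
    (auto simp: far_EE KE root_form_cases power_int_minus inverse_eq_divide
      derE_mult derE_linear der_gen)

text \<open>Every monomial of the expanded segment ends in an F at one of its nodes; moving this F
  across the form differentiates x, which gives 0.\<close>

lemma zero_F:
  assumes t: "t = 1 \<or> t = - 1" and "y \<in> Ule" "a + l < N"
    and x: "\<And>i. a \<le> i \<Longrightarrow> i < N \<Longrightarrow> derE (t * int i) x 0"
  shows "j (y * ch gF t a l) x = 0"
  using assms(2-)
proof (induction l arbitrary: y a)
  case 0
  then show ?case using 0(3)[of a] by (auto simp: derE_def)
next
  case (Suc l)
  have I: "t * int a \<in> I" using Suc.prems arm_I[OF t] by simp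
  have x0: "derE (t * int a) x 0" using Suc.prems by simp
  have r: "ch gF t (Suc a) l \<in> Ule"
    using AF.D_chain(1)[OF t, of "Suc a" l] Suc.prems by (auto simp: derF_def)
  have "j (y * gF (t * int a) * ch gF t (Suc a) l) x = 0"
    by (rule Suc.IH) (use Suc.prems I in auto)
  moreover have "j (y * ch gF t (Suc a) l * gF (t * int a)) x = 0"
    using x0 r Suc.prems by (auto simp: derE_def)
  moreover have "x \<in> Uge" using x0 by (auto simp: derE_def)
  ultimately show ?case using r I Suc.prems
    by (simp add: br_def right_diff_distrib mult.assoc[symmetric])
qed

lemma zero_E:
  assumes t: "t = 1 \<or> t = - 1" and "x \<in> Uge" "a + l < N"
    and y: "\<And>i. a \<le> i \<Longrightarrow> i < N \<Longrightarrow> derF (t * int i) y 0"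
  shows "j y (x * ch gE t a l) = 0"
  using assms(2-)
proof (induction l arbitrary: x a)
  case 0
  then show ?case using 0(3)[of a] by (auto simp: derF_def)
next
  case (Suc l)
  have I: "t * int a \<in> I" using Suc.prems arm_I[OF t] by simp
  have y0: "derF (t * int a) y 0" using Suc.prems by simp
  have r: "ch gE t (Suc a) l \<in> Uge"
    using AE.D_chain(1)[OF t, of "Suc a" l] Suc.prems by (auto simp: derE_def)
  have "j y (x * gE (t * int a) * ch gE t (Suc a) l) = 0"
    by (rule Suc.IH) (use Suc.prems I in auto)
  moreover have "j y (x * ch gE t (Suc a) l * gE (t * int a)) = 0"
    using y0 r Suc.prems by (auto simp: derF_def)
  moreover have "y \<in> Ule" using y0 by (auto simp: derF_def)
  ultimately show ?case using r I Suc.prems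
    by (simp add: br_def right_diff_distrib mult.assoc[symmetric])
qed

text \<open>Let r be the E segment without its first node a. In E_a r - Q r E_a the first term pairs
  to 0 by \<open>zero_E\<close>, because the derivations beyond a annihilate the F side. The second
  term removes the node a from both segments at the cost of -Q. Equal segments end with the factor
  -1/gam; otherwise one is exhausted first and \<open>zero_F\<close> or \<open>zero_E\<close>
  applies.\<close>

lemma pair_arm:
  assumes t: "t = 1 \<or> t = - 1" and "a + l < N" "a + m < N" "x \<in> Up"
    and "\<And>i. a \<le> i \<Longrightarrow> i < N \<Longrightarrow> derF (t * int i) y 0"
    and "\<And>i. a \<le> i \<Longrightarrow> i < N \<Longrightarrow> derE (t * int i) x 0"
  shows "j (y * ch gF t a l) (x * ch gE t a m)
      = (if l = m then (- Q) ^ m * (- (1 / gam)) * j y x else 0)"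
  using assms(2-)
proof (induction m arbitrary: a l)
  case (0 a l)
  have I: "t * int a \<in> I" using 0 arm_I[OF t] by simp
  have y: "y \<in> Um" using 0(4)[of a] 0 by (auto simp: derF_def)
  let ?d = "if l = 0 then (- (1 / gam)) *c gL (t * int a) else ch gF t (Suc a) (l - 1) * gL (t * int a)"
  have "derF (t * int a) (y * ch gF t a l) (0 * ch gF t a l + y * ?d)"
    by (intro derF_mult I AF.D_chain(1)[OF t]) (use 0 in auto)
  then have *: "j (y * ch gF t a l) (x * gE (t * int a)) = j (y * ?d) x"
    using 0 by (auto simp: derF_def)
  show ?case
  proof (cases l)
    case 0
    then show ?thesis using * I y \<open>x \<in> Up\<close> j_absorb_L[of x y "t * int a"] by simp
  next
    case (Suc k)
    have "ch gF t (Suc a) k \<in> Um"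
      using AF.D_chain(1)[OF t, of "Suc a" k] 0 Suc by (auto simp: derF_def)
    then have "j (y * ?d) x = j (y * ch gF t (Suc a) k) x"
      using j_absorb_L[of x "y * ch gF t (Suc a) k" "t * int a"] Suc y I \<open>x \<in> Up\<close>
      by (simp add: mult.assoc)
    also have "\<dots> = 0" by (rule zero_F[OF t]) (use 0 Suc y in auto)
    finally show ?thesis using * Suc by simp
  qed
next
  case (Suc m a l)
  have I: "t * int a \<in> I" using Suc.prems arm_I[OF t] by simp
  have y: "y \<in> Um" using Suc.prems(4)[of a] Suc.prems by (auto simp: derF_def)
  let ?d = "if l = 0 then (- (1 / gam)) *c gL (t * int a) else ch gF t (Suc a) (l - 1) * gL (t * int a)"
  let ?r = "ch gE t (Suc a) m"
  have r: "?r \<in> Up" using AE.D_chain(1)[OF t, of "Suc a" m] Suc.prems by (auto simp: derE_def)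
  have dy: "derF (t * int i) (y * ch gF t a l) (0 * ch gF t a l + y * 0)" if "Suc a \<le> i" "i < N" for i
    by (intro derF_mult AF.D_chain(2)[OF t]) (use that Suc.prems t in \<open>auto simp: arm_I[OF t]\<close>)
  have c: "ch gF t a l \<in> Um" using AF.D_chain(1)[OF t, of a l] Suc.prems by (auto simp: derF_def)
  have "derF (t * int a) (y * ch gF t a l) (0 * ch gF t a l + y * ?d)"
    by (intro derF_mult I AF.D_chain(1)[OF t]) (use Suc.prems in auto)
  then have *: "j (y * ch gF t a l) (x * ?r * gE (t * int a)) = j (y * ?d) (x * ?r)"
    using Suc.prems r by (auto simp: derF_def)
  have z: "j (y * ch gF t a l) (x * gE (t * int a) * ?r) = 0"
    by (rule zero_E[OF t]) (use Suc.prems I dy in auto)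
  have eq: "j (y * ch gF t a l) (x * ch gE t a (Suc m)) = - Q * j (y * ?d) (x * ?r)"
  proof -
    have "x * ch gE t a (Suc m) = x * gE (t * int a) * ?r - Q *c (x * ?r * gE (t * int a))"
      by (simp add: br_def right_diff_distrib mult.assoc)
    then show ?thesis using z * c r y I Suc.prems by simp
  qed
  show ?case
  proof (cases l)
    case 0
    have "j (y * gL (t * int a)) (x * ?r) = j y (x * ?r)"
      using j_absorb_L[of "x * ?r" y "t * int a"] r y I Suc.prems by simp
    also have "\<dots> = 0" by (rule zero_E[OF t]) (use Suc.prems in auto)
    finally show ?thesis unfolding eq using 0 r y I Suc.prems by simp
  next
    case (Suc k)
    have "ch gF t (Suc a) k \<in> Um"
      using AF.D_chain(1)[OF t, of "Suc a" k] Suc.prems Suc by (auto simp: derF_def)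
    then have "j (y * ?d) (x * ?r) = j (y * ch gF t (Suc a) k) (x * ?r)"
      using j_absorb_L[of "x * ?r" "y * ch gF t (Suc a) k" "t * int a"] Suc y I r Suc.prems
      by (simp add: mult.assoc)
    also have "\<dots> = (if k = m then (- Q) ^ m * (- (1 / gam)) * j y x else 0)"
      by (rule Suc.IH) (use Suc.prems Suc in auto)
    finally show ?thesis unfolding eq using Suc by simp
  qed
qed

end

section \<open>The commutator with \<open>E\<^sub>\<beta>\<close>\<close>

lemma zero_I [simp]: "0 \<in> I"
  using N by (simp add: I_iff)

text \<open>For the generators \<open>F\<close> this is \<open>W\<close> at \<open>(i + 1, k + 1)\<close>, and for the \<open>E\<close> it is \<open>Z\<close> up to the
  factor \<open>(- 1 / Q) ^ (i + k)\<close>.\<close>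

definition Wt :: "(int \<Rightarrow> uq) \<Rightarrow> nat \<Rightarrow> nat \<Rightarrow> uq" where
  "Wt s i k = attach s (- 1) (attach s 1 (s 0) k) i"

definition Am :: "uq set" where "Am = alg {Wt gF i k | i k. i < N \<and> k < N}"
definition Ap :: "uq set" where "Ap = alg {Wt gE i k | i k. i < N \<and> k < N}"

lemma Am_closed [simp, intro]:
  "1 \<in> Am" "0 \<in> Am" "x \<in> Am \<Longrightarrow> y \<in> Am \<Longrightarrow> x + y \<in> Am" "x \<in> Am \<Longrightarrow> y \<in> Am \<Longrightarrow> x - y \<in> Am"
  "x \<in> Am \<Longrightarrow> y \<in> Am \<Longrightarrow> x * y \<in> Am" "x \<in> Am \<Longrightarrow> c *c x \<in> Am"
  "i < N \<Longrightarrow> k < N \<Longrightarrow> Wt gF i k \<in> Am"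
  by (auto simp: Am_def intro: alg.gen)

lemma arms_far:
  assumes "t = 1 \<or> t = - 1" "a + m < N" "b + k < N" "a \<ge> 1" "b \<ge> 1"
  shows "ch gF t a m * ch gF (- t) b k = ch gF (- t) b k * ch gF t a m"
  unfolding ch_def
  by (intro commute_chain commute_chain[symmetric] far_FF)
    (use assms in \<open>auto simp: I_iff\<close>)

lemma root_commute:
  assumes "i < N" "k < N"
  shows "arm_root gF (- 1) i * arm_root gF 1 k = arm_root gF 1 k * arm_root gF (- 1) i"
  using assms arms_far[of "- 1" 1 "i - 1" 1 "k - 1"] by (simp add: arm_root_def)

text \<open>The arms commute with each other, so either one can be merged with the centre into a
  chain. This lets straightening treat one arm at a time.\<close>

lemma Wt_arm:
  assumes "i < N" "k < N"
  shows "Wt gF i k = attach gF 1 (ch gF (- 1) 0 i) k" "Wt gF i k = attach gF (- 1) (ch gF 1 0 k) i"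
proof -
  show "Wt gF i k = attach gF (- 1) (ch gF 1 0 k) i" by (cases k) (simp_all add: Wt_def)
  show "Wt gF i k = attach gF 1 (ch gF (- 1) 0 i) k"
    using br_right_commute[of "arm_root gF (- 1) i" "arm_root gF 1 k" Q "gF 0"] root_commute[OF assms]
    by (cases i; cases k) (simp_all add: Wt_def arm_root_def)
qed

text \<open>The coefficient Q + 1/Q splits the cubic relation into a q-commutation rule for the
  q-bracket. The two rules come from the Serre relations for the two orders of the pair.\<close>

lemma serre_chain_gF:
  assumes t: "t = 1 \<or> t = - 1"
  shows "serre_chain Q (\<lambda>i. gF (t * int i)) (N - 1)"
proof
  show "Q \<noteq> 0" "Q\<^sup>2 \<noteq> - 1" using Q(1) Q2 by auto
  have lt: "i \<le> N - 1 \<longleftrightarrow> i < N" for i using N by auto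
  show "gF (t * int i) * gF (t * int k) = gF (t * int k) * gF (t * int i)" if "i + 2 \<le> k" "k \<le> N - 1" for i k
    by (rule far_FF) (use that N arm_dist(1)[OF t, of i k] in \<open>auto simp: arm_I[OF t]\<close>)
  fix i assume "Suc i \<le> N - 1"
  then have I: "t * int i \<in> I" "t * int (Suc i) \<in> I" and d: "\<bar>t * int i - t * int (Suc i)\<bar> = 1"
    "\<bar>t * int (Suc i) - t * int i\<bar> = 1"
    unfolding arm_I[OF t] arm_dist(1)[OF t] by auto
  let ?A = "gF (t * int i)" and ?B = "gF (t * int (Suc i))"
  show "?A * br Q ?A ?B = (1 / Q) *c (br Q ?A ?B * ?A)"
  proof -
    have "?A * ?A * ?B = Q *c (?A * ?B * ?A) + (1 / Q) *c (?A * ?B * ?A) - ?B * ?A * ?A"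
      using serre_FF[OF I d(1)] by (simp add: add_sc algebra_simps)
    then show ?thesis using Q(1) by (simp add: br_def calg_simps)
  qed
  show "?B * br Q ?A ?B = Q *c (br Q ?A ?B * ?B)"
  proof -
    have *: "?B * ?B * ?A = Q *c (?B * ?A * ?B) + (1 / Q) *c (?B * ?A * ?B) - ?A * ?B * ?B"
      using serre_FF[OF I(2,1) d(2)] by (simp add: add_sc algebra_simps)
    have "?B * br Q ?A ?B = ?B * ?A * ?B - Q *c (?B * ?B * ?A)"
      by (simp add: br_def calg_simps)
    also have "\<dots> = Q *c (?A * ?B * ?B) - (Q * Q) *c (?B * ?A * ?B)"
      unfolding * using Q(1) by (simp add: calg_simps)
    finally show ?thesis by (simp add: br_def calg_simps)
  qed
qed

section \<open>Straightening root vectors of the arms past A^-\<close>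

lemma delta_mult: "(if P then x else 0) * y = (if P then x * y else (0 :: uq))"
  by simp

text \<open>The left \<open>Am\<close>-module spanned by the root vectors of one arm, with
  coefficients that need not be unique.\<close>

definition arm_span :: "int \<Rightarrow> uq \<Rightarrow> bool" where
  "arm_span t x \<longleftrightarrow> (\<exists>b. (\<forall>i. b i \<in> Am) \<and> x = (\<Sum>i<N. b i * arm_root gF t i))"

lemma arm_span_add: "arm_span t x \<Longrightarrow> arm_span t y \<Longrightarrow> arm_span t (x + y)"
  unfolding arm_span_def
  by (elim exE conjE, rule_tac x = "\<lambda>i. b i + ba i" in exI) (auto simp: distrib_right sum.distrib)

lemma arm_span_left: "g \<in> Am \<Longrightarrow> arm_span t x \<Longrightarrow> arm_span t (g * x)"
  unfolding arm_span_def
  by (elim exE conjE, rule_tac x = "\<lambda>i. g * b i" in exI) (auto simp: sum_distrib_left mult.assoc)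

lemma arm_span_sc: "arm_span t x \<Longrightarrow> arm_span t (c *c x)"
  using arm_span_left[of "c *c 1" t x] by simp

lemma arm_span_diff: "arm_span t x \<Longrightarrow> arm_span t y \<Longrightarrow> arm_span t (x - y)"
  using arm_span_add[of t x "(- 1) *c y"] arm_span_sc[of t y "- 1"] by simp

lemma arm_span_root:
  assumes "g \<in> Am" "i < N"
  shows "arm_span t (g * arm_root gF t i)"
  unfolding arm_span_def
  by (rule exI[of _ "\<lambda>k. if k = i then g else 0"]) (use assms in \<open>auto simp: delta_mult cong: if_cong\<close>)

lemma arm_span_sum:
  assumes "finite A" "\<And>i. i \<in> A \<Longrightarrow> arm_span t (f i)"
  shows "arm_span t (sum f A)"
  using assms
proof (induction A rule: finite_induct)
  case empty
  show ?case using arm_span_root[of 0 0 t] N by simp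
qed (auto intro: arm_span_add)

lemma attach_commute:
  assumes "r * arm_root s t k = arm_root s t k * r"
  shows "r * attach s t x k = attach s t (r * x) k" "attach s t x k * r = attach s t (x * r) k"
proof -
  have "r * (arm_root s t k * x) = arm_root s t k * (r * x)" "x * (arm_root s t k * r) = x * (r * arm_root s t k)"
    using assms by (metis mult.assoc)+
  then show "r * attach s t x k = attach s t (r * x) k" "attach s t x k * r = attach s t (x * r) k"
    by (auto simp: attach_def br_def calg_simps)
qed

lemma attach_linear:
  "attach s t (x + y) k = attach s t x k + attach s t y k"
  "attach s t (x - y) k = attach s t x k - attach s t y k"
  "attach s t (c *c x) k = c *c attach s t x k"
  by (auto simp: attach_def br_def calg_simps mult.commute)

text \<open>The root vector of the arm t commutes with that of the other arm and hence acts inside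
  \<open>attach\<close>. This leaves a product of two segments of one chain, and the four cases
  compare their right ends.\<close>

lemma root_mult_Wt:
  assumes t: "t = 1 \<or> t = - 1" and "l < N" "i < N" "k < N"
  shows "arm_span t (arm_root gF t l * attach gF (- t) (ch gF t 0 i) k)"
proof -
  have W: "attach gF (- t) (ch gF t 0 p) k \<in> Am" if "p < N" for p
    using t Am_closed(7)[OF that \<open>k < N\<close>] Am_closed(7)[OF \<open>k < N\<close> that]
    unfolding Wt_arm(1)[OF that \<open>k < N\<close>] Wt_arm(2)[OF \<open>k < N\<close> that] by auto
  show ?thesis
  proof (cases l)
    case 0
    then show ?thesis using arm_span_root[OF W[OF \<open>i < N\<close>], of 0 t] N by (simp add: arm_root_def)
  next
    case (Suc m)
    interpret C: serre_chain Q "\<lambda>i. gF (t * int i)" "N - 1" by (rule serre_chain_gF[OF t])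
    note C = C.tail_commute C.tail_qcommute C.tail_commutator
    note C = C[folded ch_def]
    let ?a = "\<lambda>x. attach gF (- t) x k"
    have com: "ch gF t 1 p * arm_root gF (- t) k = arm_root gF (- t) k * ch gF t 1 p" if "Suc p < N" for p
      using arms_far[OF t, of 1 p 1 "k - 1"] that \<open>k < N\<close> by (simp add: arm_root_def)
    note right = attach_commute(2)[OF com]
    have span: "arm_span t (?a (ch gF t 0 p * ch gF t 1 r))" if "p < N" "Suc r < N" for p r
      using arm_span_root[OF W[OF that(1)] that(2), of t] right[OF that(2)] by (simp add: arm_root_def)
    have "arm_root gF t l * ?a (ch gF t 0 i) = ?a (ch gF t 1 m * ch gF t 0 i)"
      using attach_commute(1)[OF com] Suc \<open>l < N\<close> by (simp add: arm_root_def)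
    also have "arm_span t \<dots>"
    proof -
      consider "i = 0" | "i = Suc m" | "Suc m < i" | p where "i = Suc p" "p < m"
        by (metis Suc_less_eq less_Suc_eq_0_disj linorder_neqE_nat)
      then show ?thesis
      proof cases
        case 1
        \<comment> \<open>The definition of the segment \<open>ch gF t 0 (Suc m)\<close>, solved for
          the product in the wrong order.\<close>
        have "ch gF t 1 m * ch gF t 0 0 = (1 / Q) *c (ch gF t 0 0 * ch gF t 1 m - ch gF t 0 (Suc m))"
          using Q(1) by (simp add: br_def sc_diff)
        moreover have "arm_span t (?a (ch gF t 0 (Suc m)))"
          using arm_span_root[OF W[of "Suc m"], of 0 t] N Suc \<open>l < N\<close> by (simp add: arm_root_def)
        ultimately show ?thesis using 1 span[of 0 m] Suc \<open>l < N\<close> N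
          by (simp only: attach_linear) (auto intro!: arm_span_sc arm_span_diff)
      next
        case 2
        then show ?thesis using C(2)[of m] span[of i m] Suc assms
          by (auto simp: attach_linear intro!: arm_span_sc)
      next
        case 3
        then show ?thesis using C(1)[of m i] span[of i m] Suc assms by auto
      next
        case 4
        then show ?thesis using C(3)[of p m] span[of i m] span[of l p] Suc assms
          by (auto simp: attach_linear intro!: arm_span_add arm_span_sc)
      qed
    qed
    finally show ?thesis .
  qed
qed

lemma root_mult_Am:
  assumes t: "t = 1 \<or> t = - 1" and "g \<in> Am" "l < N"
  shows "arm_span t (arm_root gF t l * g)"
  using assms(2,3) unfolding Am_def
proof (induction arbitrary: l)
  case one
  then show ?case using arm_span_root[of 1 l t] by simp
next
  case (gen x)
  then show ?case using t root_mult_Wt[OF t] Wt_arm by auto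
next
  case (add x y)
  then show ?case by (auto simp: distrib_left intro: arm_span_add)
next
  case (sc x c)
  then show ?case by (auto intro: arm_span_sc)
next
  case (mult x y)
  obtain b where b: "\<And>i. b i \<in> Am" "arm_root gF t l * x = (\<Sum>i<N. b i * arm_root gF t i)"
    using mult.IH(1)[OF mult.prems] unfolding arm_span_def by blast
  \<comment> \<open>Straightening past x may yield root vectors of every length, which is why the
    induction is over all l.\<close>
  have "arm_root gF t l * (x * y) = (\<Sum>i<N. b i * (arm_root gF t i * y))"
    by (simp add: mult.assoc[symmetric] b(2) sum_distrib_right)
  also have "arm_span t \<dots>" by (rule arm_span_sum, simp, rule arm_span_left) (use b(1) mult.IH(2) in auto)
  finally show ?case .
qed

definition double_span :: "uq \<Rightarrow> bool" where
  "double_span x \<longleftrightarrow> (\<exists>b. (\<forall>i k. b i k \<in> Am) \<and>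
     x = (\<Sum>i<N. \<Sum>k<N. b i k * (arm_root gF (- 1) i * arm_root gF 1 k)))"

lemma double_span_add: "double_span x \<Longrightarrow> double_span y \<Longrightarrow> double_span (x + y)"
  unfolding double_span_def
  by (elim exE conjE, rule_tac x = "\<lambda>i k. b i k + ba i k" in exI) (auto simp: distrib_right sum.distrib)

lemma double_span_left: "g \<in> Am \<Longrightarrow> double_span x \<Longrightarrow> double_span (g * x)"
  unfolding double_span_def
  by (elim exE conjE, rule_tac x = "\<lambda>i k. g * b i k" in exI) (auto simp: sum_distrib_left mult.assoc)

lemma double_span_sc: "double_span x \<Longrightarrow> double_span (c *c x)"
  using double_span_left[of "c *c 1" x] by simp

lemma double_span_root:
  assumes "g \<in> Am" "i < N" "k < N"
  shows "double_span (g * (arm_root gF (- 1) i * arm_root gF 1 k))"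
  unfolding double_span_def
  by (rule exI[of _ "\<lambda>p l. if l = k then if p = i then g else 0 else 0"])
    (use assms in \<open>auto simp: delta_mult cong: if_cong\<close>)

lemma double_span_sum:
  assumes "finite A" "\<And>i. i \<in> A \<Longrightarrow> double_span (f i)"
  shows "double_span (sum f A)"
  using assms
proof (induction A rule: finite_induct)
  case empty
  show ?case using double_span_root[of 0 0 0] N by simp
qed (auto intro: double_span_add)

text \<open>The root vector of the arm 1 passes g first. The resulting coefficients lie in
  \<open>Am\<close> again and are then passed by the root vector of the arm -1.\<close>

lemma double_span_right:
  assumes "double_span x" "g \<in> Am"
  shows "double_span (x * g)"
proof -
  have 1: "double_span (arm_root gF (- 1) i * arm_root gF 1 k * g)" if ik: "i < N" "k < N" for i k
  proof -
    obtain b where b: "\<And>l. b l \<in> Am" "arm_root gF 1 k * g = (\<Sum>l<N. b l * arm_root gF 1 l)"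
      using root_mult_Am[of 1 g k] assms(2) ik unfolding arm_span_def by auto
    have "double_span (arm_root gF (- 1) i * b l * arm_root gF 1 l)" if "l < N" for l
    proof -
      obtain c where c: "\<And>p. c p \<in> Am" "arm_root gF (- 1) i * b l = (\<Sum>p<N. c p * arm_root gF (- 1) p)"
        using root_mult_Am[of "- 1" "b l" i] b(1) \<open>i < N\<close> unfolding arm_span_def by auto
      have "arm_root gF (- 1) i * b l * arm_root gF 1 l = (\<Sum>p<N. c p * (arm_root gF (- 1) p * arm_root gF 1 l))"
        by (simp add: c(2) sum_distrib_right mult.assoc)
      also have "double_span \<dots>"
        using c(1) that by (intro double_span_sum double_span_root) auto
      finally show ?thesis .
    qed
    moreover have "arm_root gF (- 1) i * arm_root gF 1 k * g = (\<Sum>l<N. arm_root gF (- 1) i * b l * arm_root gF 1 l)"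
      by (simp add: mult.assoc b(2) sum_distrib_left)
    ultimately show ?thesis by (auto intro!: double_span_sum)
  qed
  obtain b where b: "\<And>i k. b i k \<in> Am"
    "x = (\<Sum>i<N. \<Sum>k<N. b i k * (arm_root gF (- 1) i * arm_root gF 1 k))"
    using assms(1) unfolding double_span_def by blast
  have "x * g = (\<Sum>i<N. \<Sum>k<N. b i k * (arm_root gF (- 1) i * arm_root gF 1 k * g))"
    by (simp add: b(2) sum_distrib_right mult.assoc)
  also have "double_span \<dots>"
    by (rule double_span_sum, simp, rule double_span_sum, simp, rule double_span_left) (use b(1) 1 in auto)
  finally show ?thesis .
qed

section \<open>Moving the torus elements at the centre past A^-\<close>

lemma L_root:
  assumes "t = 1 \<or> t = - 1" "Suc m < N"
  shows "gL 0 * ch gF t 1 m = (1 / Q) *c (ch gF t 1 m * gL 0)"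
proof -
  have t: "t \<in> I" "\<bar>0 - t\<bar> = 1" using assms by (auto simp: I_iff)
  have 0: "gL 0 * gF t = (1 / Q) *c (gF t * gL 0)"
    using LF[of 0 t] t by (simp add: root_form_def neighbours_def power_int_minus inverse_eq_divide) auto
  show ?thesis
  proof (cases m)
    case (Suc k)
    have "gL 0 * ch gF t (Suc (Suc 0)) k = ch gF t (Suc (Suc 0)) k * gL 0"
      unfolding ch_def
    proof (rule commute_chain)
      fix i assume "Suc (Suc 0) \<le> i" "i \<le> Suc (Suc 0) + k"
      then show "gL 0 * gF (t * int i) = gF (t * int i) * gL 0"
        using LF[of 0 "t * int i"] assms Suc by (auto simp: I_iff root_form_def neighbours_def)
    qed
    then show ?thesis using 0 Suc by (auto intro: qcommute_br')
  qed (use 0 in simp)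
qed

text \<open>Each generator is a weight vector; p is recorded as nonzero so that the rule can be
  inverted for \<open>gK 0\<close>.\<close>

lemma conj_L_W:
  assumes "i < N" "k < N"
  shows "\<exists>p. p \<noteq> 0 \<and> gL 0 * Wt gF i k = p *c (Wt gF i k * gL 0)"
proof -
  have step: "\<exists>p. p \<noteq> 0 \<and> gL 0 * attach gF t x i = p *c (attach gF t x i * gL 0)"
    if t: "t = 1 \<or> t = - 1" "i < N" and x: "\<exists>p. p \<noteq> 0 \<and> gL 0 * x = p *c (x * gL 0)" for t x i
  proof (cases i)
    case 0
    then show ?thesis using x by simp
  next
    case (Suc m)
    obtain p where p: "p \<noteq> 0" "gL 0 * x = p *c (x * gL 0)" using x by blast
    have r: "gL 0 * ch gF t 1 m = (1 / Q) *c (ch gF t 1 m * gL 0)" using L_root t Suc by simp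
    have "gL 0 * (x * z) = p *c (x * (gL 0 * z))" "gL 0 * (ch gF t 1 m * z) = (1 / Q) *c (ch gF t 1 m * (gL 0 * z))" for z
      using p(2) r by (metis mult.assoc sc_mult)+
    then have "gL 0 * attach gF t x i = (p * (1 / Q)) *c (attach gF t x i * gL 0)"
      using p(2) r Suc by (simp add: br_def calg_simps mult.commute mult.left_commute)
    then show ?thesis using p(1) Q(1) by (intro exI[of _ "p * (1 / Q)"]) simp
  qed
  have "gL 0 * gF 0 = (Q powi 2) *c (gF 0 * gL 0)"
    using LF[of 0 0] by (simp add: root_form_def)
  then have "\<exists>p. p \<noteq> 0 \<and> gL 0 * gF 0 = p *c (gF 0 * gL 0)" using Q(1) by (intro exI[of _ "Q powi 2"]) simp
  then show ?thesis unfolding Wt_def using assms by (intro step) auto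
qed

lemma alg_move:
  assumes "\<And>x. x \<in> S \<Longrightarrow> \<exists>p. u * x = p *c (x * u)" "x \<in> alg S"
  shows "\<exists>x'\<in>alg S. u * x = x' * u"
  using assms(2)
proof induction
  case (gen x)
  then obtain p where "u * x = p *c x * u" using assms(1) by fastforce
  then show ?case using gen by (blast intro: alg.gen alg.sc)
next
  case (add x y)
  then obtain x' y' where "x' \<in> alg S" "y' \<in> alg S" "u * x = x' * u" "u * y = y' * u" by blast
  then show ?case by (intro bexI[of _ "x' + y'"]) (auto simp: distrib_left distrib_right)
next
  case (mult x y)
  then obtain x' y' where "x' \<in> alg S" "y' \<in> alg S" "u * x = x' * u" "u * y = y' * u" by blast
  then show ?case by (intro bexI[of _ "x' * y'"]) (simp_all add: mult.assoc[symmetric], simp add: mult.assoc)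
next
  case (sc x c)
  then obtain x' where "x' \<in> alg S" "u * x = x' * u" by blast
  then show ?case by (intro bexI[of _ "c *c x'"]) auto
qed (intro bexI[of _ 1], auto)

lemma L_move:
  assumes "g \<in> Am"
  shows "\<exists>g'\<in>Am. gL 0 * g = g' * gL 0" "\<exists>g'\<in>Am. gK 0 * g = g' * gK 0"
proof -
  have L: "\<exists>p. gL 0 * x = p *c (x * gL 0)" and K: "\<exists>p. gK 0 * x = p *c (x * gK 0)"
    if x: "x \<in> {Wt gF i k | i k. i < N \<and> k < N}" for x
  proof -
    obtain i k where "x = Wt gF i k" "i < N" "k < N" using x by blast
    then obtain p where p: "p \<noteq> 0" "gL 0 * x = p *c (x * gL 0)" using conj_L_W by blast
    then show "\<exists>p. gL 0 * x = p *c (x * gL 0)" by blast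
    have "gK 0 * (gL 0 * x) * gK 0 = p *c (gK 0 * (x * gL 0) * gK 0)" by (simp add: p(2))
    moreover have "gK 0 * (gL 0 * x) = x" "x * gL 0 * gK 0 = x" for x
      by (simp_all add: mult.assoc) (simp flip: mult.assoc)
    ultimately have "x * gK 0 = p *c (gK 0 * x)" by (simp add: mult.assoc)
    then show "\<exists>p. gK 0 * x = p *c (x * gK 0)" using p(1) by (intro exI[of _ "1 / p"]) simp
  qed
  show "\<exists>g'\<in>Am. gL 0 * g = g' * gL 0"
    unfolding Am_def by (rule alg_move, erule L, rule assms[unfolded Am_def])
  show "\<exists>g'\<in>Am. gK 0 * g = g' * gK 0"
    unfolding Am_def by (rule alg_move, erule K, rule assms[unfolded Am_def])
qed

context killing
begin

text \<open>The last clause is the condition that determines \<open>O\<^sub>1\<close>, and \<open>derF 0 g d\<close> is the one for the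
  right multiplication by \<open>E\<^sub>\<beta>\<close>, from which \<open>O\<^sub>2\<close> and the \<open>O\<^sub>i\<^sub>j\<close> are obtained.\<close>

definition comm0 :: "uq \<Rightarrow> uq \<Rightarrow> uq \<Rightarrow> bool" where
  "comm0 g a d \<longleftrightarrow> derF 0 g d \<and> a \<in> Ule \<and> gE 0 * g - g * gE 0 = a * gK 0 + d \<and>
     (\<forall>x\<in>Uge. j g (gE 0 * (gL 0 * x * gK 0)) = - j a x)"

text \<open>In the commutator, K_0 must move to the right past g', which replaces g' by K_0 g'
  K_0^-1. In the pairing the same conjugation arises from the coproduct of the word E_0 K_0^-1 w
  K_0, by \<open>j_conj\<close>.\<close>

lemma comm0_mult:
  assumes "comm0 g a d" "comm0 g' a' d'"
  shows "comm0 (g * g') (a * (gK 0 * g' * gL 0) + g * a') (d * g' + g * d')"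
proof -
  have U: "g \<in> Um" "g' \<in> Um" "a \<in> Ule" "a' \<in> Ule"
    and com: "gE 0 * g - g * gE 0 = a * gK 0 + d" "gE 0 * g' - g' * gE 0 = a' * gK 0 + d'"
    and left: "\<And>x. x \<in> Uge \<Longrightarrow> j g (gE 0 * (gL 0 * x * gK 0)) = - j a x"
      "\<And>x. x \<in> Uge \<Longrightarrow> j g' (gE 0 * (gL 0 * x * gK 0)) = - j a' x"
    and der: "derF 0 (g * g') (d * g' + g * d')"
    using assms derF_mult[OF zero_I] by (auto simp: comm0_def derF_def)
  have LK: "x * gL 0 * gK 0 = x" for x by (simp add: mult.assoc)
  have "gE 0 * (g * g') - g * g' * gE 0 = (gE 0 * g - g * gE 0) * g' + g * (gE 0 * g' - g' * gE 0)"
    by (simp add: algebra_simps)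
  also have "\<dots> = (a * (gK 0 * g' * gL 0) + g * a') * gK 0 + (d * g' + g * d')"
    unfolding com by (simp add: algebra_simps)
  finally have 1: "gE 0 * (g * g') - g * g' * gE 0
      = (a * (gK 0 * g' * gL 0) + g * a') * gK 0 + (d * g' + g * d')" .
  have KgL: "gK 0 * g' * gL 0 \<in> Ule" using U by auto
  have "j (g * g') (gE 0 * gL 0 * x * gK 0) = j (- (a * (gK 0 * g' * gL 0) + g * a')) x"
    if "x \<in> Uge" for x
  proof (rule j_ext_right)
    fix w assume w: "set w \<subseteq> gens_ge N"
    have ww: "set (GE 0 # GKinv 0 # w @ [GK 0]) \<subseteq> gens_ge N"
      using w word_gens[OF zero_I] by auto
    have KL: "gK 0 * (gL 0 * x) = x" for x by (simp flip: mult.assoc)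
    have "j (g * g') (gE 0 * gL 0 * evw w * gK 0) = j (g * g') (evw (GE 0 # GKinv 0 # w @ [GK 0]))"
      by (simp add: mult.assoc)
    also have "\<dots> = conv (j g) (j g') (GE 0 # GKinv 0 # w @ [GK 0])"
      by (rule j_mult_left) (use U ww in auto)
    also have "\<dots> = conv (\<lambda>x. j g (gE 0 * (gL 0 * (x * gK 0)))) (\<lambda>x. j g' (gL 0 * (x * gK 0))) w
        + conv (\<lambda>x. j g (gK 0 * (gL 0 * (x * gK 0)))) (\<lambda>x. j g' (gE 0 * (gL 0 * (x * gK 0)))) w"
      by (simp only: conv.simps conv_snoc)
    also have "\<dots> = conv (j (- a)) (j (gK 0 * g' * gL 0)) w + conv (j g) (j (- a')) w"
      by (intro arg_cong2[where f = "(+)"] conv_cong[OF grouplike_closed_gens(1) w])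
        (use evw_in(2) U left in \<open>auto simp: j_conj j_absorb_K KL mult.assoc[symmetric]\<close>)
    also have "\<dots> = j (- a * (gK 0 * g' * gL 0)) (evw w) + j (g * - a') (evw w)"
      by (intro arg_cong2[where f = "(+)"] j_mult_left[symmetric]) (use U KgL w in auto)
    finally show "j (g * g') (gE 0 * gL 0 * evw w * gK 0)
        = j (- (a * (gK 0 * g' * gL 0) + g * a')) (evw w)"
      using U KgL evw_in(2)[OF w] by simp
  qed (use U KgL that in auto)
  then show ?thesis using 1 der U KgL by (auto simp: comm0_def mult.assoc)
qed

lemma comm0_add: "comm0 g a d \<Longrightarrow> comm0 g' a' d' \<Longrightarrow> comm0 (g + g') (a + a') (d + d')"
  unfolding comm0_def using derF_linear(1)[OF zero_I]
  by (auto simp: derF_def algebra_simps)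

lemma comm0_sc: "comm0 g a d \<Longrightarrow> comm0 (c *c g) (c *c a) (c *c d)"
  unfolding comm0_def using derF_linear(2)[OF zero_I]
  by (auto simp: derF_def sc_add[symmetric] sc_diff[symmetric])

lemma comm0_gen:
  assumes "a \<in> I"
  shows "comm0 (gF a) (if a = 0 then (1 / gam) *c 1 else 0) (if a = 0 then (- (1 / gam)) *c gL 0 else 0)"
proof -
  have "j (gF a) (gE 0 * (gL 0 * x * gK 0)) = (if a = 0 then - (1 / gam) * j 1 x else 0)"
    if "x \<in> Uge" for x
    using assms that by (simp add: j_F_mult j_group_mult)
  moreover have "gE 0 * gF a - gF a * gE 0 = (if a = 0 then (1 / gam) *c 1 else 0) * gK 0
      + (if a = 0 then (- (1 / gam)) *c gL 0 else 0)"
    using EF[OF zero_I assms] by (auto simp: sc_diff)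
  ultimately show ?thesis using der_gen(1)[OF zero_I assms] by (auto simp: comm0_def)
qed

lemma comm0_br:
  assumes "comm0 g a d" "comm0 r 0 0"
  shows "comm0 (br Q g r) (a * (gK 0 * r * gL 0) - Q *c (r * a)) (d * r - Q *c (r * d))"
  using comm0_add[OF comm0_mult[OF assms] comm0_sc[OF comm0_mult[OF assms(2,1)], of "- Q"]]
  by (simp add: br_def)

lemma comm0_chain:
  assumes t: "t = 1 \<or> t = - 1"
  shows "a \<ge> 1 \<Longrightarrow> a + m < N \<Longrightarrow> comm0 (ch gF t a m) 0 0"
proof (induction m arbitrary: a)
  case 0
  then show ?case using comm0_gen[of "t * int a"] t by (auto simp: arm_I)
next
  case (Suc m)
  have "comm0 (gF (t * int a)) 0 0" using Suc.prems comm0_gen[of "t * int a"] t by (auto simp: arm_I)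
  from comm0_br[OF this] show ?case using Suc by simp
qed

text \<open>Since K_0 r K_0^-1 = Q r, the bracket cancels in the first component, and p' = 0 as soon
  as an arm is attached. In the second component, moving K_0^-1 past r gives the factor 1/Q - Q. The
  constants stay existential because the coefficients are recovered from the pairing later.\<close>

lemma comm0_attach:
  assumes t: "t = 1 \<or> t = - 1" and x: "comm0 x (p *c 1) (c *c (z * gL 0))"
    and z: "z * arm_root gF t i = arm_root gF t i * z" and "i < N"
  shows "\<exists>p' c'. comm0 (attach gF t x i) (p' *c 1) (c' *c (arm_root gF t i * z * gL 0))"
proof (cases i)
  case 0
  then show ?thesis using x by (auto simp: arm_root_def)
next
  case (Suc m)
  define r where "r = ch gF t 1 m"
  have rt: "arm_root gF t i = r" "attach gF t x i = br Q x r"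
    using Suc by (simp_all add: arm_root_def r_def)
  have L: "gL 0 * r = (1 / Q) *c (r * gL 0)" using L_root[OF t, of m] Suc \<open>i < N\<close> by (simp add: r_def)
  have "r = gK 0 * (gL 0 * r)" by (simp flip: mult.assoc)
  also have "\<dots> = (1 / Q) *c (gK 0 * r * gL 0)" unfolding L by (simp add: mult.assoc)
  finally have "Q *c r = Q *c (1 / Q) *c (gK 0 * r * gL 0)" by metis
  then have K: "gK 0 * r * gL 0 = Q *c r" using Q(1) by simp
  have "comm0 (br Q x r) (p *c 1 * (gK 0 * r * gL 0) - Q *c (r * (p *c 1)))
      (c *c (z * gL 0) * r - Q *c (r * (c *c (z * gL 0))))"
    unfolding r_def by (rule comm0_br[OF x comm0_chain[OF t]]) (use Suc \<open>i < N\<close> in auto)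
  moreover have "p *c 1 * (gK 0 * r * gL 0) - Q *c (r * (p *c 1)) = 0 *c 1"
    by (simp add: K mult.commute)
  moreover have "c *c (z * gL 0) * r - Q *c (r * (c *c (z * gL 0)))
      = (c * (1 / Q - Q)) *c (arm_root gF t i * z * gL 0)"
  proof -
    have "z * r = r * z" using z by (simp add: rt)
    then have "z * (r * gL 0) = r * (z * gL 0)" by (metis mult.assoc)
    then show ?thesis using L
      by (simp add: rt mult.assoc right_diff_distrib diff_sc mult.commute)
  qed
  ultimately have "comm0 (br Q x r) (0 *c 1) ((c * (1 / Q - Q)) *c (arm_root gF t i * z * gL 0))"
    by (simp only:)
  then show ?thesis unfolding rt(2) by blast
qed

lemma comm0_Wt:
  assumes "i < N" "k < N"
  shows "\<exists>p c. comm0 (Wt gF i k) (p *c 1) (c *c (arm_root gF (- 1) i * arm_root gF 1 k * gL 0))"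
proof -
  have "comm0 (gF 0) ((1 / gam) *c 1) ((- (1 / gam)) *c (1 * gL 0))"
    using comm0_gen[OF zero_I] by simp
  from comm0_attach[OF _ this, of 1 k] assms obtain p c where
    "comm0 (attach gF 1 (gF 0) k) (p *c 1) (c *c (arm_root gF 1 k * gL 0))" by auto
  from comm0_attach[OF _ this, of "- 1" i] show ?thesis
    using assms root_commute[OF assms] by (auto simp: Wt_def)
qed

text \<open>The critical case is a product, which creates the term x K_0^-1 g'. First K_0^-1 and
  then the root vectors in x have to pass g', by \<open>L_move\<close> and
  \<open>double_span_right\<close>.\<close>

lemma comm0_Am:
  assumes "g \<in> Am"
  obtains a x where "a \<in> Am" "double_span x" "comm0 g a (x * gL 0)"
proof -
  define good where "good g \<longleftrightarrow> (\<exists>a x. a \<in> Am \<and> double_span x \<and> comm0 g a (x * gL 0))" for g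
  have goodI: "good g" if "a \<in> Am" "double_span x" "comm0 g a (x * gL 0)" for g a x
    using that by (auto simp: good_def)
  have "good g" using assms unfolding Am_def
  proof (induction rule: alg.induct)
    case one
    have "comm0 1 0 (0 * gL 0)" using der_one(1)[OF zero_I] by (auto simp: comm0_def j_group_mult)
    then show ?case using double_span_root[of 0 0 0] N by (intro goodI[of 0 0]) auto
  next
    case (gen g)
    then obtain i k where g: "g = Wt gF i k" "i < N" "k < N" by blast
    obtain p c where "comm0 g (p *c 1) (c *c (arm_root gF (- 1) i * arm_root gF 1 k * gL 0))"
      using comm0_Wt g by blast
    then have "comm0 g (p *c 1) (c *c 1 * (arm_root gF (- 1) i * arm_root gF 1 k) * gL 0)" by simp
    moreover have "double_span (c *c 1 * (arm_root gF (- 1) i * arm_root gF 1 k))"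
      by (rule double_span_root) (use g in auto)
    ultimately show ?case by (intro goodI[of "p *c 1"]) auto
  next
    case (add g g')
    then obtain a x a' x' where "a \<in> Am" "double_span x" "comm0 g a (x * gL 0)"
      "a' \<in> Am" "double_span x'" "comm0 g' a' (x' * gL 0)" unfolding good_def by blast
    then show ?case
      by (intro goodI[of "a + a'" "x + x'"]) (auto simp: distrib_right intro: double_span_add comm0_add)
  next
    case (sc g c)
    then obtain a x where "a \<in> Am" "double_span x" "comm0 g a (x * gL 0)" unfolding good_def by blast
    then show ?case
      using comm0_sc[of g a "x * gL 0" c]
      by (intro goodI[of "c *c a" "c *c x"]) (auto intro: double_span_sc)
  next
    case (mult g g')
    then obtain a x a' x' where *: "a \<in> Am" "double_span x" "comm0 g a (x * gL 0)"
      "a' \<in> Am" "double_span x'" "comm0 g' a' (x' * gL 0)" unfolding good_def by blast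
    have g: "g \<in> Am" "g' \<in> Am" using mult.hyps by (simp_all add: Am_def)
    obtain gl gk where gl: "gl \<in> Am" "gL 0 * g' = gl * gL 0" and gk: "gk \<in> Am" "gK 0 * g' = gk * gK 0"
      using L_move[OF g(2)] by blast
    have "gK 0 * g' * gL 0 = gk" by (simp add: gk(2) mult.assoc)
    moreover have "x * gL 0 * g' + g * (x' * gL 0) = (x * gl + g * x') * gL 0"
      using gl(2) by (simp add: distrib_right mult.assoc)
    ultimately have "comm0 (g * g') (a * gk + g * a') ((x * gl + g * x') * gL 0)"
      using comm0_mult[OF *(3,6)] by simp
    moreover have "double_span (x * gl + g * x')"
      by (intro double_span_add double_span_right double_span_left) fact+
    moreover have "a * gk + g * a' \<in> Am" using * g gk by auto
    ultimately show ?case by (intro goodI)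
  qed
  then show ?thesis using that unfolding good_def by blast
qed

section \<open>Pairing with the root vectors\<close>

text \<open>The pairing of dual root vectors in their q-commutator form, before the normalisation by
  powers of -1/Q in \<open>Rep_roots\<close>.\<close>

definition root_norm :: "nat \<Rightarrow> complex" where
  "root_norm i = (if i = 0 then 1 else (- Q) ^ (i - 1) * (- (1 / gam)))"

lemma pair_root:
  assumes t: "t = 1 \<or> t = - 1" and "p < N" "i < N" "x \<in> Up" "y \<in> Ule"
    and y: "\<And>i. 1 \<le> i \<Longrightarrow> i < N \<Longrightarrow> derF (t * int i) y 0"
    and x: "\<And>i. 1 \<le> i \<Longrightarrow> i < N \<Longrightarrow> derE (t * int i) x 0"
  shows "j (y * arm_root gF t p) (x * arm_root gE t i) = (if p = i then root_norm i * j y x else 0)"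
proof (cases "p = 0 \<or> i = 0")
  case True
  then show ?thesis
    using zero_F[OF t _ _ x, of y 1 "p - 1"] zero_E[OF t _ _ y, of x 1 "i - 1"] assms
    by (auto simp: arm_root_def root_norm_def)
next
  case False
  then show ?thesis using pair_arm[OF t _ _ _ y x, of 1 "p - 1" "i - 1"] assms
    by (auto simp: arm_root_def root_norm_def)
qed

lemma derF_Am:
  assumes "g \<in> Am" "c \<in> I" "c \<noteq> 0"
  shows "derF c g 0"
  using assms(1) unfolding Am_def
proof induction
  case one
  then show ?case using der_one assms by blast
next
  case (gen x)
  then show ?case using AF.D_double_attach[of "- 1" _ _ c] assms by (auto simp: Wt_def)
next
  case (add x y)
  then show ?case using derF_linear(1)[OF assms(2)] by fastforce
next
  case (mult x y)
  then show ?case using derF_mult[OF assms(2)] by fastforce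
next
  case (sc x k)
  then show ?case using derF_linear(2)[OF assms(2)] by fastforce
qed

lemma derE_Ap:
  assumes "g \<in> Ap" "c \<in> I" "c \<noteq> 0"
  shows "derE c g 0"
  using assms(1) unfolding Ap_def
proof induction
  case one
  then show ?case using der_one assms by blast
next
  case (gen x)
  then show ?case using AE.D_double_attach[of "- 1" _ _ c] assms by (auto simp: Wt_def)
next
  case (add x y)
  then show ?case using derE_linear(1)[OF assms(2)] by fastforce
next
  case (mult x y)
  then show ?case using derE_mult[OF assms(2)] by fastforce
next
  case (sc x k)
  then show ?case using derE_linear(2)[OF assms(2)] by fastforce
qed

lemma Am_Um: "g \<in> Am \<Longrightarrow> g \<in> Um" and Ap_Up: "x \<in> Ap \<Longrightarrow> x \<in> Up"
proof -
  have ch: "ch gF t a m \<in> Um" "ch gE t a m \<in> Up" if "t = 1 \<or> t = - 1" "a + m < N" for t a m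
    using AF.D_chain(1)[OF that] AE.D_chain(1)[OF that] by (simp_all add: derF_def derE_def)
  have att: "x \<in> Um \<Longrightarrow> attach gF t x i \<in> Um" "x \<in> Up \<Longrightarrow> attach gE t x i \<in> Up"
    if "t = 1 \<or> t = - 1" "i < N" for t x i
    using ch[of t 1 "i - 1"] that by (auto simp: attach_def arm_root_def)
  have "{Wt gF i k | i k. i < N \<and> k < N} \<subseteq> Um" "{Wt gE i k | i k. i < N \<and> k < N} \<subseteq> Up"
    by (auto simp: Wt_def intro!: att)
  then have "Am \<subseteq> Um" "Ap \<subseteq> Up" unfolding Am_def Ap_def Um_def Up_def by (simp_all add: alg_mono)
  then show "g \<in> Am \<Longrightarrow> g \<in> Um" "x \<in> Ap \<Longrightarrow> x \<in> Up" by auto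
qed

lemma root_in:
  assumes "t = 1 \<or> t = - 1" "i < N"
  shows "arm_root gF t i \<in> Um" "arm_root gE t i \<in> Up"
  using AF.D_chain(1)[OF assms(1), of 1 "i - 1"] AE.D_chain(1)[OF assms(1), of 1 "i - 1"] assms(2)
  by (auto simp: arm_root_def derF_def derE_def)

lemma root_der:
  assumes "t = 1 \<or> t = - 1" "i < N" "1 \<le> k" "k < N"
  shows "derF (- t * int k) (arm_root gF t i) 0" "derE (- t * int k) (arm_root gE t i) 0"
proof -
  have "- t * int k \<in> I" "- t * int k \<noteq> t * int 1" using assms by (auto simp: I_iff)
  then show "derF (- t * int k) (arm_root gF t i) 0" "derE (- t * int k) (arm_root gE t i) 0"
    using AF.D_chain(2)[OF assms(1), of 1 "i - 1"] AE.D_chain(2)[OF assms(1), of 1 "i - 1"] assms(2) der_one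
    by (auto simp: arm_root_def)
qed

text \<open>The term of the bracket that ends in the arm root vector pairs to 0 with A^- by
  \<open>zero_E\<close>; the other one ends in x and carries -Q.\<close>

lemma j_attach:
  assumes t: "t = 1 \<or> t = - 1" and "i < N" "g \<in> Am" "z \<in> Uge" "x \<in> Uge"
  shows "j g (z * attach gE t x i) = (if i = 0 then 1 else - Q) * j g (z * arm_root gE t i * x)"
proof (cases i)
  case (Suc m)
  have r: "ch gE t 1 m \<in> Uge" using root_in(2)[OF t \<open>i < N\<close>] Suc by (auto simp: arm_root_def)
  have "j g (z * x * ch gE t 1 m) = 0"
    by (rule zero_E[OF t]) (use assms Suc derF_Am in \<open>auto simp: I_iff\<close>)
  then show ?thesis using Suc assms r Am_Um[of g]
    by (simp add: arm_root_def br_def right_diff_distrib mult.assoc)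
qed (simp add: arm_root_def)

text \<open>Two uses of \<open>j_attach\<close> bring E_0 to the end, \<open>comm0\<close> trades it
  for the double sum, and \<open>pair_root\<close>, applied to each arm, singles out one
  summand.\<close>

lemma comm0_pair:
  assumes "\<And>i k. b i k \<in> Am" "g \<in> Am" "i < N" "k < N" "\<psi> \<in> Ap"
    and comm: "comm0 g a ((\<Sum>p<N. \<Sum>l<N. b p l * (arm_root gF (- 1) p * arm_root gF 1 l)) * gL 0)"
  shows "j g (\<psi> * Wt gE i k)
      = (if i = 0 then 1 else - Q) * (if k = 0 then 1 else - Q) * (root_norm i * root_norm k) * j (b i k) \<psi>"
proof -
  let ?X = "arm_root gE (- 1) i" and ?Y = "arm_root gE 1 k"
  let ?s = "\<Sum>p<N. \<Sum>l<N. b p l * (arm_root gF (- 1) p * arm_root gF 1 l)"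
  have \<psi>: "\<psi> \<in> Up" using Ap_Up assms by auto
  have XY: "?X \<in> Up" "?Y \<in> Up" using root_in(2) assms by auto
  have b: "b p l \<in> Um" for p l using Am_Um assms by auto
  have R: "arm_root gF (- 1) p \<in> Um" "arm_root gF 1 p \<in> Um" if "p < N" for p
    using root_in(1) that by auto
  have term_in: "b p l * (arm_root gF (- 1) p * arm_root gF 1 l) \<in> Um" if "p < N" "l < N" for p l
    using b R that by auto
  have sum_in: "sum f A \<in> Um" if "finite A" "\<And>i. i \<in> A \<Longrightarrow> f i \<in> Um" for f and A :: "nat set"
    using that by (induction A rule: finite_induct) auto
  have j_sum: "j (sum f A) x = (\<Sum>i\<in>A. j (f i) x)" if "finite A" "\<And>i. i \<in> A \<Longrightarrow> f i \<in> Um" "x \<in> Uge"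
    for f x and A :: "nat set"
    using that
  proof (induction A rule: finite_induct)
    case (insert c A)
    then have "sum f A \<in> Um" by (intro sum_in) auto
    then show ?case using insert by simp
  qed simp
  have s: "?s \<in> Um" by (intro sum_in term_in) auto
  have "attach gE 1 (gE 0) k \<in> Uge"
    using XY(2) by (auto simp: attach_def)
  then have "j g (\<psi> * Wt gE i k)
      = (if i = 0 then 1 else - Q) * ((if k = 0 then 1 else - Q) * j g (\<psi> * ?X * ?Y * gE 0))"
    unfolding Wt_def using assms \<psi> XY by (simp add: j_attach)
  also have "j g (\<psi> * ?X * ?Y * gE 0) = j (?s * gL 0) (\<psi> * ?X * ?Y)"
    using comm \<psi> XY by (auto simp: comm0_def derF_def)
  also have "\<dots> = j ?s (\<psi> * ?X * ?Y)"
    by (rule j_absorb_L) (use \<psi> XY s in auto)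
  also have "\<dots> = (\<Sum>p<N. \<Sum>l<N. j (b p l * (arm_root gF (- 1) p * arm_root gF 1 l)) (\<psi> * ?X * ?Y))"
  proof -
    have x: "\<psi> * ?X * ?Y \<in> Uge" using \<psi> XY by auto
    show ?thesis
      by (rule trans[OF j_sum sum.cong[OF refl j_sum]]) (auto intro!: sum_in term_in x)
  qed
  also have "\<dots> = (\<Sum>p<N. \<Sum>l<N. if l = k then if p = i then root_norm i * root_norm k * j (b i k) \<psi> else 0 else 0)"
  proof (intro sum.cong refl)
    fix p l assume "p \<in> {..<N}" "l \<in> {..<N}"
    then have pl: "p < N" "l < N" by auto
    \<comment> \<open>The arm 1 is stripped off first, so the root vectors of the arm -1 still
      belong to the elements that its derivations must annihilate.\<close>
    have d1: "derF (1 * int c) (b p l * arm_root gF (- 1) p) 0"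
      "derE (1 * int c) (\<psi> * ?X) 0" if c: "1 \<le> c" "c < N" for c
    proof -
      have I: "1 * int c \<in> I" "1 * int c \<noteq> 0" using c by (auto simp: I_iff)
      have "derF (1 * int c) (arm_root gF (- 1) p) 0" "derE (1 * int c) ?X 0"
        using root_der(1)[of "- 1" p c] root_der(2)[of "- 1" i c] pl assms c by simp_all
      note r = derF_mult[OF I(1) derF_Am[OF assms(1) I] this(1)]
        derE_mult[OF I(1) derE_Ap[OF assms(5) I] this(2)]
      show "derF (1 * int c) (b p l * arm_root gF (- 1) p) 0" using r(1) by simp
      show "derE (1 * int c) (\<psi> * ?X) 0"
        using r(2) by simp
    qed
    have d2: "derF (- 1 * int c) (b p l) 0" "derE (- 1 * int c) \<psi> 0" if c: "1 \<le> c" "c < N" for c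
      using derF_Am[OF assms(1), of "- 1 * int c"] derE_Ap[OF assms(5), of "- 1 * int c"] c
      by (auto simp: I_iff)
    have "j (b p l * arm_root gF (- 1) p * arm_root gF 1 l) (\<psi> * ?X * ?Y)
        = (if l = k then root_norm k * j (b p l * arm_root gF (- 1) p) (\<psi> * ?X) else 0)"
      by (rule pair_root[OF _ _ _ _ _ d1]) (use pl assms b R \<psi> XY in auto)
    also have "j (b p l * arm_root gF (- 1) p) (\<psi> * ?X) = (if p = i then root_norm i * j (b p l) \<psi> else 0)"
      by (rule pair_root[OF _ _ _ _ _ d2]) (use pl assms b R \<psi> XY in auto)
    finally show "j (b p l * (arm_root gF (- 1) p * arm_root gF 1 l)) (\<psi> * ?X * ?Y)
        = (if l = k then if p = i then root_norm i * root_norm k * j (b i k) \<psi> else 0 else 0)"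
      by (simp add: mult.assoc)
  qed
  also have "\<dots> = root_norm i * root_norm k * j (b i k) \<psi>"
    using assms by (simp cong: if_cong)
  finally show ?thesis by simp
qed

end

section \<open>Evaluation of Lusztig's automorphisms\<close>

lemma T_comp_simps [simp]:
  "T_comp q [] x = x" "T_comp q (a # as) x = T q a (T_comp q as x)"
  "T_comp q (as @ bs) x = T_comp q as (T_comp q bs x)"
  by (simp_all add: T_comp_def)

lemma T_comp_hom [simp]:
  "T_comp q as (x * y) = T_comp q as x * T_comp q as y"
  "T_comp q as (x - y) = T_comp q as x - T_comp q as y"
  "T_comp q as (const c) = const c"
  by (induction as) (simp_all add: T_def)

text \<open>One treatment for both kinds of generators: \<kappa> is 1 for F, and it is -1/q for E
  because E_a E_b - q^-1 E_b E_a is -1/q times E_b E_a - q E_a E_b.\<close>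

locale lusztig_generators =
  fixes f :: "int \<Rightarrow> falg" and s :: "int \<Rightarrow> uq" and \<kappa> :: complex
  assumes f_FA: "a \<in> I \<Longrightarrow> f a \<in> FA" and ev_f: "ev (f a) = s a"
    and T_next: "neighbours a b \<Longrightarrow> T Q a (f b) = const \<kappa> * (f b * f a - const Q * (f a * f b))"
    and T_far: "a \<noteq> b \<Longrightarrow> \<not> neighbours a b \<Longrightarrow> T Q a (f b) = f b"
begin

lemma T_comp_far:
  "(\<And>a. a \<in> set as \<Longrightarrow> a \<noteq> b \<and> \<not> neighbours a b) \<Longrightarrow> T_comp Q as (f b) = f b"
  by (induction as) (auto simp: T_far)

definition lift :: "int \<Rightarrow> nat \<Rightarrow> nat \<Rightarrow> falg" where
  "lift t k m = T_comp Q (map (\<lambda>i. t * int i) (rev [Suc k..<Suc (k + m)])) (f (t * int k))"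

lemma lift_0: "lift t k 0 = f (t * int k)"
  by (simp add: lift_def)

text \<open>The innermost automorphism, at k + 1, creates the bracket. The remaining ones fix the
  generator at k and extend the one at k + 1, so the recursion is that of
  \<open>chain\<close>.\<close>

lemma lift_Suc:
  assumes t: "t = 1 \<or> t = - 1"
  shows "lift t k (Suc m)
    = const \<kappa> * (f (t * int k) * lift t (Suc k) m - const Q * (lift t (Suc k) m * f (t * int k)))"
proof -
  have "rev [Suc k..<Suc (k + Suc m)] = rev [Suc (Suc k)..<Suc (Suc k + m)] @ [Suc k]"
    by (simp add: upt_rec[of "Suc k"])
  moreover have "T_comp Q (map (\<lambda>i. t * int i) (rev [Suc (Suc k)..<Suc (Suc k + m)])) (f (t * int k))
      = f (t * int k)"
    by (rule T_comp_far) (use t in \<open>auto simp: neighbours_def\<close>)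
  moreover have "neighbours (t * int (Suc k)) (t * int k)"
    using t by (auto simp: neighbours_def)
  ultimately show ?thesis by (simp add: lift_def T_next del: upt_Suc of_nat_Suc)
qed

lemma lift_FA:
  assumes t: "t = 1 \<or> t = - 1"
  shows "k + m < N \<Longrightarrow> lift t k m \<in> FA"
  by (induction m arbitrary: k) (auto simp: lift_0 lift_Suc[OF t] arm_I[OF t] f_FA simp del: of_nat_Suc)

lemma ev_lift:
  assumes t: "t = 1 \<or> t = - 1"
  shows "k + m < N \<Longrightarrow> ev (lift t k m) = \<kappa> ^ m *c ch s t k m"
proof (induction m arbitrary: k)
  case 0
  then show ?case by (simp add: lift_0 ev_f)
next
  case (Suc m)
  have "lift t (Suc k) m \<in> FA" "f (t * int k) \<in> FA"
    using Suc.prems by (auto intro!: lift_FA[OF t] f_FA simp: arm_I[OF t])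
  then show ?case using Suc.IH[of "Suc k"] Suc.prems
    by (simp add: lift_Suc[OF t] ev_f br_def sc_diff mult.commute mult.left_commute)
qed

text \<open>With k \<ge> 1 the segment avoids the centre, so no node of the other arm is adjacent to
  it.\<close>

lemma T_comp_lift:
  assumes t: "t = 1 \<or> t = - 1" and as: "\<And>a. a \<in> set as \<Longrightarrow> \<exists>i\<ge>1. a = - t * int i"
  shows "k \<ge> 1 \<Longrightarrow> T_comp Q as (lift t k m) = lift t k m"
proof (induction m arbitrary: k)
  case 0
  show ?case unfolding lift_0
    by (rule T_comp_far) (use t 0 in \<open>auto simp: neighbours_def dest!: as\<close>)
next
  case (Suc m)
  have "T_comp Q as (f (t * int k)) = f (t * int k)"
    by (rule T_comp_far) (use t Suc.prems in \<open>auto simp: neighbours_def dest!: as\<close>)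
  then show ?case using Suc.IH[of "Suc k"] by (simp add: lift_Suc[OF t])
qed

text \<open>The automorphisms of the \<mu> arm act first; in the bracket they produce, those of the
  \<nu> arm change only the factor \<open>f 0\<close>.\<close>

lemma ev_double_lift:
  assumes "i < N" "k < N"
  shows "T_comp Q (map nu (rev [1..<Suc k]) @ map mu (rev [1..<Suc i])) (f 0) \<in> FA"
    "ev (T_comp Q (map nu (rev [1..<Suc k]) @ map mu (rev [1..<Suc i])) (f 0))
      = \<kappa> ^ (i + k) *c Wt s i k"
proof -
  define as where "as = map nu (rev [1..<Suc k])"
  have m: "map mu (rev [1..<Suc i]) = map (\<lambda>i. - 1 * int i) (rev [Suc 0..<Suc (0 + i)])"
    by (simp add: mu_def)
  have n: "as = map (\<lambda>i. 1 * int i) (rev [Suc 0..<Suc (0 + k)])"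
    by (simp add: as_def nu_def)
  have B: "T_comp Q as (f 0) = lift 1 0 k" unfolding n lift_def by simp
  have BFA: "lift 1 0 k \<in> FA" by (rule lift_FA) (use assms in auto)
  have evB: "ev (lift 1 0 k) = \<kappa> ^ k *c attach s 1 (s 0) k"
    using ev_lift[of 1 0 k] assms by (cases k) simp_all
  have A: "T_comp Q (as @ map mu (rev [1..<Suc i])) (f 0) = T_comp Q as (lift (- 1) 0 i)"
    unfolding m lift_def by simp
  have as: "a \<in> set as \<Longrightarrow> \<exists>i\<ge>1. a = - (- 1) * int i" for a by (auto simp: as_def nu_def)
  show "T_comp Q (map nu (rev [1..<Suc k]) @ map mu (rev [1..<Suc i])) (f 0) \<in> FA"
    "ev (T_comp Q (map nu (rev [1..<Suc k]) @ map mu (rev [1..<Suc i])) (f 0))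
      = \<kappa> ^ (i + k) *c Wt s i k"
    unfolding as_def[symmetric]
  proof (atomize (full), cases i)
    case 0
    then show "T_comp Q (as @ map mu (rev [1..<Suc i])) (f 0) \<in> FA \<and>
        ev (T_comp Q (as @ map mu (rev [1..<Suc i])) (f 0)) = \<kappa> ^ (i + k) *c Wt s i k"
      unfolding A using BFA evB by (simp add: lift_0 B Wt_def)
  next
    case (Suc m)
    have "T_comp Q as (lift (- 1) 1 m) = lift (- 1) 1 m"
      by (rule T_comp_lift) (use as in auto)
    moreover have "lift (- 1) 1 m \<in> FA" by (rule lift_FA) (use assms Suc in auto)
    moreover have "ev (lift (- 1) 1 m) = \<kappa> ^ m *c ch s (- 1) 1 m"
      by (rule ev_lift) (use assms Suc in auto)
    ultimately show "T_comp Q (as @ map mu (rev [1..<Suc i])) (f 0) \<in> FA \<and>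
        ev (T_comp Q (as @ map mu (rev [1..<Suc i])) (f 0)) = \<kappa> ^ (i + k) *c Wt s i k"
      unfolding A using BFA evB Suc
      by (simp add: lift_Suc B Wt_def br_def sc_diff power_add mult_ac del: upt_Suc)
  qed
qed

end

interpretation LF: lusztig_generators fF gF 1
  by unfold_locales (auto simp: gF_def T_def neighbours_def)

interpretation LE: lusztig_generators fE gE "- 1 / Q"
proof
  fix a b assume n: "neighbours a b"
  have "const (- 1 / Q) * const Q = (const (- 1) :: falg)"
    using Q(1) by (simp flip: const_simps(5))
  then have "const (- 1 / Q) * const Q * z = - z" for z :: falg by simp
  moreover have "const (- 1 / Q) = (- const (inverse Q) :: falg)"
    by (simp add: inverse_eq_divide del: const_simps flip: const_simps(4))
  ultimately show "T Q a (fE b) = const (- 1 / Q) * (fE b * fE a - const Q * (fE a * fE b))"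
    using n by (auto simp: T_def neighbours_def right_diff_distrib mult.assoc)
qed (auto simp: gE_def T_def neighbours_def)

section \<open>Identification of the given root vectors and subalgebras\<close>

lemma Rep_W: "i < N \<Longrightarrow> k < N \<Longrightarrow> W N Q (i + 1) (k + 1) = Rep_uq (Wt gF i k)"
  using LF.ev_double_lift[of i k] by (simp add: W_def beta_def del: upt_Suc flip: Rep_ev)

lemma Rep_Z:
  "i < N \<Longrightarrow> k < N \<Longrightarrow> Z N Q (i + 1) (k + 1) = Rep_uq ((- 1 / Q) ^ (i + k) *c Wt gE i k)"
  using LE.ev_double_lift[of i k] by (simp add: Z_def beta_def del: upt_Suc flip: Rep_ev)

lemma Rep_roots:
  assumes "1 \<le> i" "i < N"
  shows "X N Q i = Rep_uq (arm_root gF (- 1) i)" "Y N Q i = Rep_uq (arm_root gF 1 i)"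
    "X_check N Q i = Rep_uq ((- 1 / Q) ^ (i - 1) *c arm_root gE (- 1) i)"
    "Y_check N Q i = Rep_uq ((- 1 / Q) ^ (i - 1) *c arm_root gE 1 i)"
proof -
  obtain m where m: "i = Suc m" using assms by (cases i) auto
  have F: "cls N Q (LF.lift t 1 m) = Rep_uq (ch gF t 1 m)"
    and E: "cls N Q (LE.lift t 1 m) = Rep_uq ((- 1 / Q) ^ m *c ch gE t 1 m)" if "t = 1 \<or> t = - 1" for t
    using LF.ev_lift[OF that, of 1 m] LF.lift_FA[OF that, of 1 m]
      LE.ev_lift[OF that, of 1 m] LE.lift_FA[OF that, of 1 m] assms m
    by (simp_all flip: Rep_ev)
  show "X N Q i = Rep_uq (arm_root gF (- 1) i)" "Y N Q i = Rep_uq (arm_root gF 1 i)"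
    "X_check N Q i = Rep_uq ((- 1 / Q) ^ (i - 1) *c arm_root gE (- 1) i)"
    "Y_check N Q i = Rep_uq ((- 1 / Q) ^ (i - 1) *c arm_root gE 1 i)"
    using F[of "- 1"] F[of 1] E[of "- 1"] E[of 1] m
    by (simp_all add: X_def Y_def X_check_def Y_check_def LF.lift_def LE.lift_def arm_root_def
        mu_def[abs_def] nu_def[abs_def] numeral_2_eq_2 del: upt_Suc)
qed

lemma A_minus_eq: "A_minus N Q = Rep_uq ` Am"
proof -
  have "{W N Q i k | i k. i \<in> {1..N} \<and> k \<in> {1..N}} = Rep_uq ` {Wt gF i k | i k. i < N \<and> k < N}"
  proof (rule Set.set_eqI, rule iffI)
    fix x assume "x \<in> {W N Q i k | i k. i \<in> {1..N} \<and> k \<in> {1..N}}"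
    then obtain i k where "x = W N Q i k" "i \<in> {1..N}" "k \<in> {1..N}" by blast
    then show "x \<in> Rep_uq ` {Wt gF i k | i k. i < N \<and> k < N}"
      using Rep_W[of "i - 1" "k - 1"] by fastforce
  next
    fix x assume "x \<in> Rep_uq ` {Wt gF i k | i k. i < N \<and> k < N}"
    then obtain i k where "x = Rep_uq (Wt gF i k)" "i < N" "k < N" by blast
    then show "x \<in> {W N Q i k | i k. i \<in> {1..N} \<and> k \<in> {1..N}}"
      using Rep_W[of i k] by fastforce
  qed
  then show ?thesis unfolding A_minus_def Am_def by (simp only: Rep_subalg)
qed

lemma A_plus_sub: "A_plus N Q \<subseteq> Rep_uq ` Ap"
proof -
  let ?S = "{(- 1 / Q) ^ (i + k) *c Wt gE i k | i k. i < N \<and> k < N}"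
  have "{Z N Q i k | i k. i \<in> {1..N} \<and> k \<in> {1..N}} = Rep_uq ` ?S"
  proof (rule Set.set_eqI, rule iffI)
    fix x assume "x \<in> {Z N Q i k | i k. i \<in> {1..N} \<and> k \<in> {1..N}}"
    then obtain i k where ik: "x = Z N Q i k" "i \<in> {1..N}" "k \<in> {1..N}" by blast
    then obtain i' k' where "i = i' + 1" "i' < N" "k = k' + 1" "k' < N"
      by (metis Suc_eq_plus1 Suc_le_eq atLeastAtMost_iff not0_implies_Suc not_one_le_zero)
    then show "x \<in> Rep_uq ` ?S" unfolding ik(1) by (simp only: Rep_Z) blast
  next
    fix x assume "x \<in> Rep_uq ` ?S"
    then obtain i k where "x = Rep_uq ((- 1 / Q) ^ (i + k) *c Wt gE i k)" "i < N" "k < N" by blast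
    then have "x = Z N Q (i + 1) (k + 1)" "i + 1 \<in> {1..N}" "k + 1 \<in> {1..N}" by (simp_all only: Rep_Z) auto
    then show "x \<in> {Z N Q i k | i k. i \<in> {1..N} \<and> k \<in> {1..N}}" by blast
  qed
  then have "A_plus N Q = Rep_uq ` alg ?S" unfolding A_plus_def by (simp only: Rep_subalg)
  moreover have "alg ?S \<subseteq> Ap" unfolding Ap_def by (rule alg_mono) (auto intro: alg.gen)
  ultimately show ?thesis by blast
qed

section \<open>The commutator formula\<close>

context killing
begin

text \<open>The uniqueness of \<open>L\<close> already contains the non-degeneracy that is needed: if \<open>h\<close> were orthogonal
  to \<open>A\<^sup>+\<close>, then \<open>L + (\<cdot>, 1) h\<close> would be another solution, so \<open>h = (1, 1) h = 0\<close>.\<close>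

lemma Am_nondegenerate:
  assumes det: "determined_by N Q J R L" and "a \<in> Am" "g \<in> Am"
    and a: "\<And>\<psi>. \<psi> \<in> A_plus N Q \<Longrightarrow> J (Rep_uq a) \<psi> = R (Rep_uq g) \<psi>"
  shows "L (Rep_uq g) = Rep_uq a"
proof -
  define l where "l x = Abs_uq (L (Rep_uq x))" for x
  note det = det[unfolded determined_by_def Let_def A_minus_eq]
  have lin: "linear_endo N Q (Rep_uq ` Am) L" using det by (elim conjE)
  have sol: "J (L (Rep_uq x)) \<psi> = R (Rep_uq x) \<psi>" if "x \<in> Am" "\<psi> \<in> A_plus N Q" for x \<psi>
    using det that by (meson imageI)
  have unique: "M (Rep_uq 1) = L (Rep_uq 1)" if "linear_endo N Q (Rep_uq ` Am) M"
    "\<And>x \<psi>. x \<in> Am \<Longrightarrow> \<psi> \<in> A_plus N Q \<Longrightarrow> J (M (Rep_uq x)) \<psi> = R (Rep_uq x) \<psi>" for M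
  proof -
    have "\<forall>g\<in>Rep_uq ` Am. \<forall>\<psi>\<in>A_plus N Q. J (M g) \<psi> = R g \<psi>" using that(2) by blast
    then show ?thesis using det that(1) Am_closed(1) by (meson imageI)
  qed
  have lin: "L (Rep_uq x) \<in> Rep_uq ` Am"
    "y \<in> Am \<Longrightarrow> L (Rep_uq (x + y)) = L (Rep_uq x) \<oplus>\<^bsub>Uq N Q\<^esub> L (Rep_uq y)"
    "L (Rep_uq (c *c x)) = scal N Q c (L (Rep_uq x))" if "x \<in> Am" for x y c
    using lin that unfolding linear_endo_def Rep_ops by blast+
  have l: "L (Rep_uq x) = Rep_uq (l x)" "l x \<in> Am" if "x \<in> Am" for x
  proof -
    obtain z where z: "L (Rep_uq x) = Rep_uq z" "z \<in> Am" using lin(1)[OF \<open>x \<in> Am\<close>] by blast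
    have "l x = z" by (simp only: l_def z(1) Rep_uq_inverse)
    then show "L (Rep_uq x) = Rep_uq (l x)" "l x \<in> Am" using z by (simp_all only:)
  qed
  have l_add: "l (x + y) = l x + l y" if "x \<in> Am" "y \<in> Am" for x y
  proof -
    have "Rep_uq (l (x + y)) = L (Rep_uq (x + y))"
      by (rule l(1)[symmetric]) (intro Am_closed that)
    also have "\<dots> = Rep_uq (l x + l y)" unfolding lin(2)[OF that] by (simp only: l that Rep_ops(3))
    finally have "Rep_uq (l (x + y)) = Rep_uq (l x + l y)" .
    then show ?thesis by (simp only: Rep_uq_inject)
  qed
  have l_sc: "l (c *c x) = c *c l x" if "x \<in> Am" for x c
  proof -
    have "Rep_uq (l (c *c x)) = L (Rep_uq (c *c x))"
      by (rule l(1)[symmetric]) (intro Am_closed that)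
    also have "\<dots> = Rep_uq (c *c l x)" unfolding lin(3)[OF that] by (simp only: l that Rep_ops(7))
    finally have "Rep_uq (l (c *c x)) = Rep_uq (c *c l x)" .
    then show ?thesis by (simp only: Rep_uq_inject)
  qed
  define h where "h = a - l g"
  have h: "h \<in> Am" using assms l by (auto simp: h_def)
  have Am_le: "x \<in> Ule" if "x \<in> Am" for x using Am_Um that by auto
  have Jh: "j h \<psi> = 0" if "\<psi> \<in> Ap" "Rep_uq \<psi> \<in> A_plus N Q" for \<psi>
  proof -
    have "j a \<psi> = j (l g) \<psi>" unfolding j_def
      using a sol[of g "Rep_uq \<psi>"] l(1)[of g] assms that by simp
    then show ?thesis using that assms l Ap_Up Am_le by (auto simp: h_def)
  qed
  define M where "M x = Rep_uq (l (Abs_uq x) + j (Abs_uq x) 1 *c h)" for x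
  have M: "M (Rep_uq x) = Rep_uq (l x + j x 1 *c h)" for x
    by (simp add: M_def Rep_uq_inverse)
  have "M (Rep_uq 1) = L (Rep_uq 1)"
  proof (rule unique)
    show "linear_endo N Q (Rep_uq ` Am) M"
      unfolding linear_endo_def
    proof (intro conjI ballI allI; elim imageE; hypsubst)
      fix x assume "x \<in> Am"
      then show "M (Rep_uq x) \<in> Rep_uq ` Am" using l h by (auto simp: M)
    next
      fix x y assume "x \<in> Am" "y \<in> Am"
      then show "M (Rep_uq x \<oplus>\<^bsub>Uq N Q\<^esub> Rep_uq y) = M (Rep_uq x) \<oplus>\<^bsub>Uq N Q\<^esub> M (Rep_uq y)"
        using Am_le by (simp add: M l_add add_sc algebra_simps flip: Rep_ops)
    next
      fix c x assume "x \<in> Am"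
      then show "M (scal N Q c (Rep_uq x)) = scal N Q c (M (Rep_uq x))"
        using Am_le by (simp add: M l_sc sc_add flip: Rep_ops)
    qed
  next
    fix x \<psi> assume x: "x \<in> Am" "\<psi> \<in> A_plus N Q"
    then obtain \<psi>' where \<psi>: "\<psi> = Rep_uq \<psi>'" "\<psi>' \<in> Ap" using A_plus_sub by blast
    have "j (l x + j x 1 *c h) \<psi>' = j (l x) \<psi>'"
      using Jh[of \<psi>'] \<psi> x l h Am_le Ap_Up by auto
    then show "J (M (Rep_uq x)) \<psi> = R (Rep_uq x) \<psi>"
      using sol[OF x] l(1)[OF x(1)] by (simp add: M \<psi> j_def)
  qed
  then have "l 1 + h = l 1" using l(1)[of 1] j_grouplike(1)[OF zero_I] by (simp add: M Rep_uq_inject)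
  then show ?thesis using l(1)[OF \<open>g \<in> Am\<close>] by (simp add: h_def)
qed

text \<open>The common value of (X_i, \<check>X_i)_J and (Y_i, \<check>Y_i)_J, extended by 1 to the
  empty segment so that one formula covers O_2 and all O_ij.\<close>

definition nrm :: "nat \<Rightarrow> complex" where
  "nrm i = (if i = 0 then 1 else - (1 / gam))"

text \<open>The factor (-1/Q)^i stems from \<open>Rep_Z\<close>, the -Q from \<open>j_attach\<close>
  and (-Q)^(i-1) from \<open>root_norm\<close>; the powers cancel.\<close>

lemma nrm_root_norm: "(- 1 / Q) ^ i * ((if i = 0 then 1 else - Q) * root_norm i) = nrm i"
proof (cases i)
  case (Suc m)
  have "(- 1 / Q) ^ Suc m * ((- Q) ^ Suc m * (- (1 / gam))) = - (1 / gam)"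
    using Q(1) by (simp only: mult.assoc[symmetric] power_mult_distrib[symmetric]) simp
  then show ?thesis by (simp only: Suc nrm_def root_norm_def) simp
qed (simp add: nrm_def root_norm_def)

lemma j_roots:
  assumes "1 \<le> i" "i < N"
  shows "J (X N Q i) (X_check N Q i) = - (1 / gam)" "J (Y N Q i) (Y_check N Q i) = - (1 / gam)"
proof -
  have "j (arm_root gF t i) ((- 1 / Q) ^ (i - 1) *c arm_root gE t i) = - (1 / gam)"
    if t: "t = 1 \<or> t = - 1" for t
  proof -
    have "j (1 * arm_root gF t i) (1 * arm_root gE t i) = (if i = i then root_norm i * j 1 1 else 0)"
      by (rule pair_root[OF t]) (use assms t in \<open>auto simp: I_iff intro!: der_one\<close>)
    then have "j (arm_root gF t i) ((- 1 / Q) ^ (i - 1) *c arm_root gE t i)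
        = (- 1 / Q) ^ (i - 1) * root_norm i"
      using root_in[OF t] assms j_grouplike(1)[OF zero_I] by simp
    also have "\<dots> = - (1 / gam)"
    proof -
      have "(- 1 / Q) ^ (i - 1) * ((- Q) ^ (i - 1) * (- (1 / gam))) = - (1 / gam)"
        using Q(1) by (simp only: mult.assoc[symmetric] power_mult_distrib[symmetric]) simp
      then show ?thesis using assms by (simp only: root_norm_def) simp
    qed
    finally show ?thesis .
  qed
  then show "J (X N Q i) (X_check N Q i) = - (1 / gam)" "J (Y N Q i) (Y_check N Q i) = - (1 / gam)"
    using assms by (simp_all add: Rep_roots j_def)
qed

lemma finsum_Rep:
  assumes "finite A" "\<And>i. i \<in> A \<Longrightarrow> f i = Rep_uq (h i)"
  shows "(\<Oplus>\<^bsub>Uq N Q\<^esub>i\<in>A. f i) = Rep_uq (sum h A)"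
proof -
  interpret U: ring "Uq N Q" by (rule ring_Uq)
  have "(\<Oplus>\<^bsub>Uq N Q\<^esub>i\<in>A. f i) = (\<Oplus>\<^bsub>Uq N Q\<^esub>i\<in>A. Rep_uq (h i))"
    by (rule U.add.finprod_cong') (use assms Rep_uq in auto)
  also have "\<dots> = Rep_uq (sum h A)"
    using assms(1) by (induction A rule: finite_induct) (auto simp: Rep_ops Rep_uq)
  finally show ?thesis .
qed

lemma sum_split_zero:
  fixes f :: "nat \<Rightarrow> uq"
  shows "(\<Sum>i<N. f i) = f 0 + (\<Sum>i=1..N-1. f i)"
proof -
  have "{..<N} = insert 0 {1..N-1}" using N by auto
  then show ?thesis by simp
qed

lemma commutator_formula:
  assumes O1: "determined_by N Q J
      (\<lambda>g \<psi>. - J g (Z N Q 1 1 \<otimes>\<^bsub>Uq N Q\<^esub> (Kinv N Q beta \<otimes>\<^bsub>Uq N Q\<^esub> \<psi> \<otimes>\<^bsub>Uq N Q\<^esub> K N Q beta))) O1"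
    and O2: "determined_by N Q J (\<lambda>g \<psi>. J g (\<psi> \<otimes>\<^bsub>Uq N Q\<^esub> Z N Q 1 1)) O2"
    and Op: "\<And>i k. i \<le> N - 1 \<Longrightarrow> k \<le> N - 1 \<Longrightarrow> (i, k) \<noteq> (0, 0) \<Longrightarrow>
      determined_by N Q J (\<lambda>g \<psi>. J g (\<psi> \<otimes>\<^bsub>Uq N Q\<^esub> Z N Q (i + 1) (k + 1))) (Op i k)"
    and g: "g \<in> A_minus N Q"
  shows "commutator_formula N Q J O1 O2 Op g"
proof -
  obtain u where u: "u \<in> Am" "g = Rep_uq u" using g by (auto simp: A_minus_eq)
  obtain a x where a: "a \<in> Am" "double_span x" "comm0 u a (x * gL 0)" using comm0_Am[OF u(1)] by blast
  obtain b where b: "\<And>i k. b i k \<in> Am"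
    "x = (\<Sum>i<N. \<Sum>k<N. b i k * (arm_root gF (- 1) i * arm_root gF 1 k))"
    using a(2) unfolding double_span_def by blast
  note comm = a(3)[unfolded b(2)]
  have Z1: "Z N Q 1 1 = Rep_uq (gE 0)" using Rep_Z[of 0 0] N by (simp add: Wt_def)
  have gens0: "E N Q beta = Rep_uq (gE 0)" "K N Q beta = Rep_uq (gK 0)" "Kinv N Q beta = Rep_uq (gL 0)"
    by (simp_all add: Rep_gens beta_def)
  have E1: "O1 g = Rep_uq a" unfolding u(2)
  proof (rule Am_nondegenerate[OF O1 a(1) u(1)])
    fix \<psi> assume "\<psi> \<in> A_plus N Q"
    then obtain \<psi>' where "\<psi> = Rep_uq \<psi>'" "\<psi>' \<in> Ap" using A_plus_sub by blast
    moreover have "j u (gE 0 * (gL 0 * \<psi>' * gK 0)) = - j a \<psi>'"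
      using a(3) Ap_Up[OF \<open>\<psi>' \<in> Ap\<close>] unfolding comm0_def by auto
    ultimately show "J (Rep_uq a) \<psi> = - J (Rep_uq u) (Z N Q 1 1 \<otimes>\<^bsub>Uq N Q\<^esub>
        (Kinv N Q beta \<otimes>\<^bsub>Uq N Q\<^esub> \<psi> \<otimes>\<^bsub>Uq N Q\<^esub> K N Q beta))"
      unfolding Z1 gens0 j_def by (simp flip: Rep_ops)
  qed
  \<comment> \<open>For i = k = 0 this is the condition that determines O_2, otherwise the one for
    O_ik.\<close>
  have Zb: "J (Rep_uq ((nrm i * nrm k) *c b i k)) \<psi> = J (Rep_uq u) (\<psi> \<otimes>\<^bsub>Uq N Q\<^esub> Z N Q (i + 1) (k + 1))"
    if ik: "i < N" "k < N" and \<psi>: "\<psi> \<in> A_plus N Q" for i k \<psi>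
  proof -
    obtain \<psi>' where \<psi>': "\<psi> = Rep_uq \<psi>'" "\<psi>' \<in> Ap" using A_plus_sub \<psi> by blast
    have W: "Wt gE i k \<in> Up" using Ap_Up ik by (auto simp: Ap_def intro: alg.gen)
    have "j u (\<psi>' * ((- 1 / Q) ^ (i + k) *c Wt gE i k)) = (- 1 / Q) ^ (i + k) * j u (\<psi>' * Wt gE i k)"
      using u(1) W \<psi>' Am_Um Ap_Up by (auto simp del: minus_divide_left)
    also have "\<dots> = ((- 1 / Q) ^ i * ((if i = 0 then 1 else - Q) * root_norm i))
        * ((- 1 / Q) ^ k * ((if k = 0 then 1 else - Q) * root_norm k)) * j (b i k) \<psi>'"
      unfolding comm0_pair[OF b(1) u(1) ik \<psi>'(2) comm] power_add by (simp only: mult_ac)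
    also have "\<dots> = j ((nrm i * nrm k) *c b i k) \<psi>'"
      unfolding nrm_root_norm using b(1) Am_Um Ap_Up \<psi>' by auto
    finally show ?thesis unfolding Rep_Z[OF ik] \<psi>'(1) Rep_ops(5)[symmetric] j_def ..
  qed
  have E2: "O2 g = Rep_uq (b 0 0)" unfolding u(2)
    using Am_nondegenerate[OF O2 b(1)[of 0 0] u(1)] Zb[of 0 0] N by (simp add: nrm_def)
  have Eik: "Op i k g = Rep_uq ((nrm i * nrm k) *c b i k)"
    if "i < N" "k < N" "(i, k) \<noteq> (0, 0)" for i k
    unfolding u(2) by (rule Am_nondegenerate[OF Op _ u(1)]) (use that b(1) Zb in auto)
  let ?r = "\<lambda>i k. arm_root gF (- 1) i * arm_root gF 1 k"
  have X: "scal N Q (1 / J (X N Q i) (X_check N Q i)) (X N Q i) = Rep_uq ((- gam) *c arm_root gF (- 1) i)"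
    and Y: "scal N Q (1 / J (Y N Q i) (Y_check N Q i)) (Y N Q i) = Rep_uq ((- gam) *c arm_root gF 1 i)"
    if "1 \<le> i" "i < N" for i
    unfolding j_roots[OF that] unfolding Rep_roots(1,2)[OF that] Rep_ops(7)[symmetric] by simp_all
  have XY: "scal N Q (1 / (J (X N Q i) (X_check N Q i) * J (Y N Q k) (Y_check N Q k)))
      (X N Q i \<otimes>\<^bsub>Uq N Q\<^esub> Y N Q k) = Rep_uq ((gam * gam) *c ?r i k)"
    if "1 \<le> i" "i < N" "1 \<le> k" "k < N" for i k
    unfolding j_roots[OF that(1,2)] j_roots[OF that(3,4)]
    unfolding Rep_roots(1,2)[OF that(1,2)] Rep_roots(1,2)[OF that(3,4)] Rep_ops(5,7)[symmetric] by simp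
  have r0: "?r i 0 = arm_root gF (- 1) i" "?r 0 i = arm_root gF 1 i" for i by (simp_all add: arm_root_def)
  have S1: "(\<Oplus>\<^bsub>Uq N Q\<^esub>i\<in>{1..N-1}. Op i 0 g \<otimes>\<^bsub>Uq N Q\<^esub>
      scal N Q (1 / J (X N Q i) (X_check N Q i)) (X N Q i) \<otimes>\<^bsub>Uq N Q\<^esub> Kinv N Q beta)
      = Rep_uq (\<Sum>i=1..N-1. b i 0 * ?r i 0 * gL 0)"
  proof (rule finsum_Rep, simp)
    fix i assume "i \<in> {1..N-1}"
    then have i: "1 \<le> i" "i < N" "0 < N" "(i, 0) \<noteq> (0, 0 :: nat)" by auto
    \<comment> \<open>For i \<ge> 1, \<open>nrm i\<close> is -1/gam, so the division by (X_i,
      \<check>X_i)_J cancels it exactly.\<close>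
    have "(nrm i * nrm 0) *c b i 0 * ((- gam) *c arm_root gF (- 1) i) * gL 0 = b i 0 * ?r i 0 * gL 0"
      using gam i unfolding r0 by (simp add: nrm_def)
    then show "Op i 0 g \<otimes>\<^bsub>Uq N Q\<^esub> scal N Q (1 / J (X N Q i) (X_check N Q i)) (X N Q i)
        \<otimes>\<^bsub>Uq N Q\<^esub> Kinv N Q beta = Rep_uq (b i 0 * ?r i 0 * gL 0)"
      unfolding X[OF i(1,2)] Eik[OF i(2-4)] gens0 Rep_ops(5)[symmetric] by (rule arg_cong)
  qed
  have S2: "(\<Oplus>\<^bsub>Uq N Q\<^esub>k\<in>{1..N-1}. Op 0 k g \<otimes>\<^bsub>Uq N Q\<^esub>
      scal N Q (1 / J (Y N Q k) (Y_check N Q k)) (Y N Q k) \<otimes>\<^bsub>Uq N Q\<^esub> Kinv N Q beta)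
      = Rep_uq (\<Sum>k=1..N-1. b 0 k * ?r 0 k * gL 0)"
  proof (rule finsum_Rep, simp)
    fix k assume "k \<in> {1..N-1}"
    then have k: "1 \<le> k" "k < N" "0 < N" "(0, k) \<noteq> (0 :: nat, 0)" by auto
    have "(nrm 0 * nrm k) *c b 0 k * ((- gam) *c arm_root gF 1 k) * gL 0 = b 0 k * ?r 0 k * gL 0"
      using gam k unfolding r0 by (simp add: nrm_def)
    then show "Op 0 k g \<otimes>\<^bsub>Uq N Q\<^esub> scal N Q (1 / J (Y N Q k) (Y_check N Q k)) (Y N Q k)
        \<otimes>\<^bsub>Uq N Q\<^esub> Kinv N Q beta = Rep_uq (b 0 k * ?r 0 k * gL 0)"
      unfolding Y[OF k(1,2)] Eik[OF k(3,2,4)] gens0 Rep_ops(5)[symmetric] by (rule arg_cong)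
  qed
  have S3: "(\<Oplus>\<^bsub>Uq N Q\<^esub>i\<in>{1..N-1}. \<Oplus>\<^bsub>Uq N Q\<^esub>k\<in>{1..N-1}. Op i k g \<otimes>\<^bsub>Uq N Q\<^esub>
      scal N Q (1 / (J (X N Q i) (X_check N Q i) * J (Y N Q k) (Y_check N Q k))) (X N Q i \<otimes>\<^bsub>Uq N Q\<^esub> Y N Q k)
        \<otimes>\<^bsub>Uq N Q\<^esub> Kinv N Q beta)
      = Rep_uq (\<Sum>i=1..N-1. \<Sum>k=1..N-1. b i k * ?r i k * gL 0)"
  proof (rule finsum_Rep, simp, rule finsum_Rep, simp)
    fix i k assume "i \<in> {1..N-1}" "k \<in> {1..N-1}"
    then have ik: "1 \<le> i" "i < N" "1 \<le> k" "k < N" "(i, k) \<noteq> (0, 0)" by auto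
    have "(nrm i * nrm k) *c b i k * ((gam * gam) *c ?r i k) * gL 0 = b i k * ?r i k * gL 0"
      using gam ik by (simp add: nrm_def)
    then show "Op i k g \<otimes>\<^bsub>Uq N Q\<^esub>
        scal N Q (1 / (J (X N Q i) (X_check N Q i) * J (Y N Q k) (Y_check N Q k))) (X N Q i \<otimes>\<^bsub>Uq N Q\<^esub> Y N Q k)
        \<otimes>\<^bsub>Uq N Q\<^esub> Kinv N Q beta = Rep_uq (b i k * ?r i k * gL 0)"
      unfolding XY[OF ik(1-4)] Eik[OF ik(2,4,5)] gens0 Rep_ops(5)[symmetric] by (rule arg_cong)
  qed
  have "gE 0 * u - u * gE 0 = a * gK 0 + x * gL 0" using a(3) by (simp add: comm0_def)
  also have "x * gL 0 = (\<Sum>i<N. \<Sum>k<N. b i k * ?r i k * gL 0)"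
    by (simp add: b(2) sum_distrib_right)
  also have "\<dots> = b 0 0 * gL 0 + (\<Sum>i=1..N-1. b i 0 * ?r i 0 * gL 0)
      + (\<Sum>k=1..N-1. b 0 k * ?r 0 k * gL 0) + (\<Sum>i=1..N-1. \<Sum>k=1..N-1. b i k * ?r i k * gL 0)"
    by (simp only: sum_split_zero sum.distrib) (simp add: arm_root_def)
  finally have *: "gE 0 * u - u * gE 0 = a * gK 0 + b 0 0 * gL 0 + (\<Sum>i=1..N-1. b i 0 * ?r i 0 * gL 0)
      + (\<Sum>k=1..N-1. b 0 k * ?r 0 k * gL 0) + (\<Sum>i=1..N-1. \<Sum>k=1..N-1. b i k * ?r i k * gL 0)"
    by (simp add: add.assoc)
  show ?thesis
    unfolding commutator_formula_def Let_def S1 S2 S3 E1 E2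
    unfolding u(2) gens0 Rep_ops(3-5)[symmetric] * ..
qed

end

lemma commutator_claim_crit: "commutator_claim crit"
proof -
  have crit: "crit = (N, Q)" by (simp add: N_def Q_def)
  show ?thesis
    unfolding commutator_claim_def crit prod.case
  proof (intro allI impI)
    fix J O1 O2 Op g
    assume "q_Killing_form N Q J"
      and O: "determined_by N Q J (\<lambda>g \<psi>. - J g (Z N Q 1 1 \<otimes>\<^bsub>Uq N Q\<^esub>
          (Kinv N Q beta \<otimes>\<^bsub>Uq N Q\<^esub> \<psi> \<otimes>\<^bsub>Uq N Q\<^esub> K N Q beta))) O1"
        "determined_by N Q J (\<lambda>g \<psi>. J g (\<psi> \<otimes>\<^bsub>Uq N Q\<^esub> Z N Q 1 1)) O2"
        "\<forall>i j. i \<le> N - 1 \<longrightarrow> j \<le> N - 1 \<longrightarrow> (i, j) \<noteq> (0, 0) \<longrightarrow>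
          determined_by N Q J (\<lambda>g \<psi>. J g (\<psi> \<otimes>\<^bsub>Uq N Q\<^esub> Z N Q (i + 1) (j + 1))) (Op i j)"
      and g: "g \<in> A_minus N Q"
    then interpret killing J by unfold_locales
    show "commutator_formula N Q J O1 O2 Op g"
      by (rule commutator_formula[OF O(1,2) _ g]) (use O(3) in blast)
  qed
qed

theorem theorem7p2p1:
  fixes n :: nat and q :: complex and U (structure)
    and J :: "uq_elem \<Rightarrow> uq_elem \<Rightarrow> complex"
    and O1 O2 :: "uq_elem \<Rightarrow> uq_elem" and Op :: "nat \<Rightarrow> nat \<Rightarrow> uq_elem \<Rightarrow> uq_elem"
  assumes n: "n \<ge> 1"
    and q: "q \<noteq> 0" "\<And>k::nat. k \<ge> 1 \<Longrightarrow> q ^ k \<noteq> 1"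
    and U: "U = Uq n q"
    and J: "q_Killing_form n q J"
    and O1: "determined_by n q J
      (\<lambda>g \<psi>. - J g (Z n q 1 1 \<otimes> (Kinv n q beta \<otimes> \<psi> \<otimes> K n q beta))) O1"
    and O2: "determined_by n q J (\<lambda>g \<psi>. J g (\<psi> \<otimes> Z n q 1 1)) O2"
    and Op: "\<And>i j. i \<le> n - 1 \<Longrightarrow> j \<le> n - 1 \<Longrightarrow> (i, j) \<noteq> (0, 0) \<Longrightarrow>
      determined_by n q J (\<lambda>g \<psi>. J g (\<psi> \<otimes> Z n q (i + 1) (j + 1))) (Op i j)"
    and g: "g \<in> A_minus n q"
  shows "E n q beta \<otimes> g \<ominus> g \<otimes> E n q beta =
      O1 g \<otimes> K n q beta \<oplus> O2 g \<otimes> Kinv n q beta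
      \<oplus> (\<Oplus>i\<in>{1..n-1}. Op i 0 g
            \<otimes> scal n q (1 / J (X n q i) (X_check n q i)) (X n q i) \<otimes> Kinv n q beta)
      \<oplus> (\<Oplus>j\<in>{1..n-1}. Op 0 j g
            \<otimes> scal n q (1 / J (Y n q j) (Y_check n q j)) (Y n q j) \<otimes> Kinv n q beta)
      \<oplus> (\<Oplus>i\<in>{1..n-1}. \<Oplus>j\<in>{1..n-1}. Op i j g
            \<otimes> scal n q (1 / (J (X n q i) (X_check n q i) * J (Y n q j) (Y_check n q j)))
                (X n q i \<otimes> Y n q j) \<otimes> Kinv n q beta)"
proof -
  have "commutator_claim (n, q)"
    by (rule crit(2)[OF commutator_claim_crit]) (use n q in \<open>simp add: admissible_def\<close>)
  then have "commutator_formula n q J O1 O2 Op g"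
    unfolding commutator_claim_def prod.case using J O1 O2 Op g unfolding U by blast
  then show ?thesis unfolding commutator_formula_def Let_def U .
qed

end
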